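(* Let $p$ be a prime. The number of commutative rings of order $p^n$ up to isomorphism is $$p^{\frac{2}{27} n^3 + O(n^{8/3})}$$ as $n \to \infty$. The implied constant can be chosen independent of $p$.
   Context: All rings are commutative, associative, and with $1$. The order of a finite ring is its number of elements. *)

theory Defs
  imports "HOL-Computational_Algebra.Primes" Complex_Main "HOL-Algebra.QuotRing"
begin

text \<open>Rings are those of HOL-Algebra; \<open>cring\<close> is a commutative, associative ring with 1 (the zero
  ring is allowed), and homomorphisms preserve 1.  Carriers are subsets of the countably infinite
  type \<^typ>\<open>nat\<close>, so that every finite ring, of any type, has an isomorphic copy among them
  (\<open>finite_cring_has_copy\<close> below).\<close>

definition crings_of_order :: "nat \<Rightarrow> nat ring set" where
  "crings_of_order q = {R. cring R \<and> finite (carrier R) \<and> order R = q}"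

definition ring_iso_rel :: "nat \<Rightarrow> (nat ring \<times> nat ring) set" where
  "ring_iso_rel q = {(R, S). R \<in> crings_of_order q \<and> S \<in> crings_of_order q \<and> R \<simeq> S}"

text \<open>The set \<^term>\<open>crings_of_order q\<close> itself is infinite, but it has only finitely many
  isomorphism classes (\<open>finite_iso_classes\<close> below), so \<^const>\<open>card\<close> does not degenerate here.\<close>

definition num_crings :: "nat \<Rightarrow> nat" where
  "num_crings q = card (crings_of_order q // ring_iso_rel q)"

lemma equiv_ring_iso_rel: "equiv (crings_of_order q) (ring_iso_rel q)"
proof (rule equivI)
  show "ring_iso_rel q \<subseteq> crings_of_order q \<times> crings_of_order q"
    by (auto simp: ring_iso_rel_def)
  show "refl_on (crings_of_order q) (ring_iso_rel q)"
    by (auto simp: refl_on_def ring_iso_rel_def ring_iso_refl)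
  show "sym (ring_iso_rel q)"
    by (auto simp: sym_def ring_iso_rel_def crings_of_order_def intro: ring_iso_sym cring.axioms(1))
  show "trans (ring_iso_rel q)"
    by (auto simp: trans_def ring_iso_rel_def intro: ring_iso_trans)
qed

definition ring_of_tables ::
    "nat \<Rightarrow> (nat \<times> nat \<Rightarrow> nat) \<times> (nat \<times> nat \<Rightarrow> nat) \<times> nat \<times> nat \<Rightarrow> nat ring" where
  "ring_of_tables q = (\<lambda>(m, a, e, z).
     \<lparr>carrier = {..<q}, mult = curry m, one = e, zero = z, add = curry a\<rparr>)"

definition ring_tables ::
    "nat \<Rightarrow> ((nat \<times> nat \<Rightarrow> nat) \<times> (nat \<times> nat \<Rightarrow> nat) \<times> nat \<times> nat) set" where
  "ring_tables q = (({..<q} \<times> {..<q}) \<rightarrow>\<^sub>E {..<q}) \<times> (({..<q} \<times> {..<q}) \<rightarrow>\<^sub>E {..<q}) \<times> {..<q} \<times> {..<q}"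

lemma cring_iso_ring_of_tables:
  fixes R :: "'a ring"
  assumes R: "cring R" and fin: "finite (carrier R)"
  shows "\<exists>t \<in> ring_tables (order R). ring_of_tables (order R) t \<in> crings_of_order (order R) \<and>
           R \<simeq> ring_of_tables (order R) t"
proof -
  interpret cring R by (rule R)
  define q where "q = order R"
  obtain f where f: "bij_betw f (carrier R) {..<q}"
    using ex_bij_betw_finite_nat[OF fin] by (auto simp: q_def order_def atLeast0LessThan)
  define g where "g = inv_into (carrier R) f"
  have g: "g x \<in> carrier R" if "x < q" for x
    using f that unfolding g_def by (metis bij_betw_def inv_into_into lessThan_iff)
  have fl: "f x < q" if "x \<in> carrier R" for x
    using f that by (auto simp: bij_betw_def)
  have gf: "g (f x) = x" if "x \<in> carrier R" for x
    using f that by (simp add: g_def bij_betw_def)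
  define m where "m = (\<lambda>(x, y) \<in> {..<q} \<times> {..<q}. f (g x \<otimes>\<^bsub>R\<^esub> g y))"
  define a where "a = (\<lambda>(x, y) \<in> {..<q} \<times> {..<q}. f (g x \<oplus>\<^bsub>R\<^esub> g y))"
  define t where "t = (m, a, f \<one>\<^bsub>R\<^esub>, f \<zero>\<^bsub>R\<^esub>)"
  define S where "S = ring_of_tables q t"
  have S: "S = \<lparr>carrier = {..<q}, mult = curry m, one = f \<one>\<^bsub>R\<^esub>, zero = f \<zero>\<^bsub>R\<^esub>, add = curry a\<rparr>"
    by (simp add: S_def ring_of_tables_def t_def)
  have t: "t \<in> ring_tables q"
    by (auto simp: t_def ring_tables_def m_def a_def g fl)
  have iso: "f \<in> ring_iso R S"
    by (rule ring_iso_memI) (use f in \<open>auto simp: S m_def a_def fl gf\<close>)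
  have "cring S"
    using ring_iso_imp_img_cring[OF iso] by (simp add: S)
  then have "S \<in> crings_of_order q"
    by (simp add: crings_of_order_def order_def S)
  with t iso show ?thesis
    unfolding S_def q_def is_ring_iso_def by blast
qed

lemma finite_cring_has_copy:
  fixes R :: "'a ring"
  assumes "cring R" and "finite (carrier R)"
  shows "\<exists>S \<in> crings_of_order (order R). R \<simeq> S"
  using cring_iso_ring_of_tables[OF assms] by blast

lemma finite_iso_classes: "finite (crings_of_order q // ring_iso_rel q)"
proof (rule finite_subset)
  show "crings_of_order q // ring_iso_rel q
          \<subseteq> (\<lambda>t. ring_iso_rel q `` {ring_of_tables q t}) ` ring_tables q"
  proof
    fix X assume "X \<in> crings_of_order q // ring_iso_rel q"
    then obtain R where R: "R \<in> crings_of_order q" and X: "X = ring_iso_rel q `` {R}"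
      by (auto simp: quotient_def)
    then obtain t where t: "t \<in> ring_tables q" "(R, ring_of_tables q t) \<in> ring_iso_rel q"
      using cring_iso_ring_of_tables[of R] by (auto simp: crings_of_order_def ring_iso_rel_def)
    then show "X \<in> (\<lambda>t. ring_iso_rel q `` {ring_of_tables q t}) ` ring_tables q"
      using equiv_class_eq[OF equiv_ring_iso_rel] X by blast
  qed
  show "finite ((\<lambda>t. ring_iso_rel q `` {ring_of_tables q t}) ` ring_tables q)"
    by (auto simp: ring_tables_def intro!: finite_PiE)
qed

end

theory Submission
  imports Defs "HOL-Algebra.Multiplicative_Group" "HOL-Algebra.Ideal_Product" "HOL-Algebra.Subrings"
    "HOL-Number_Theory.Cong"
begin

text \<open>Lower bound: a symmetric bilinear map from \<open>F\<^sub>p\<^sup>d\<close> to \<open>F\<^sub>p\<^sup>r\<close> makes the sum of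
  \<open>F\<^sub>p\<close>, \<open>F\<^sub>p\<^sup>d\<close> and \<open>F\<^sub>p\<^sup>r\<close> into a ring of order \<open>p\<^sup>n\<close>, \<open>n = 1 + d + r\<close>.  There are
  \<open>p\<close> to the power \<open>r d (d + 1) / 2\<close> such maps, and an isomorphism to a fixed ring is determined by
  the images of \<open>n\<close> basis vectors, so each isomorphism class is hit by at most \<open>p\<close> to the power
  \<open>n\<^sup>2\<close> of them; take \<open>r\<close> near \<open>n / 3\<close>.

  Upper bound: let \<open>J\<close> be the nilradical of \<open>R\<close>, of order at most \<open>p\<^sup>n\<close>, generated modulo
  \<open>J\<^sup>2\<close> by \<open>X\<close> with \<open>d\<close> elements, so that \<open>J\<^sup>2\<close> has order at most \<open>p\<close> to the power
  \<open>n - d\<close>.  The products of elements of \<open>X\<close> contribute the main term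
  \<open>(n - d) d (d + 1) / 2\<close>.  The rest of the multiplication is pinned down by \<open>O(n t)\<close> further
  products, where \<open>t\<close> is about the square root of \<open>n\<close>, each costing \<open>O(n)\<close>.  Indeed, choose a set \<open>S\<close>
  of at most \<open>t\<close> elements of \<open>J\<close> such that every \<open>x\<close> in \<open>J\<close> acts on \<open>J / S J\<close> with rank
  less than \<open>t\<close>, and record the products of \<open>S\<close> with additive generators.  Choose at most \<open>n\<close> elements
  \<open>u = x b\<close>, \<open>x \<in> X\<close>, that span \<open>J\<close> together with \<open>X\<close> and \<open>S J\<close>.  For fixed \<open>u\<close>, every \<open>y\<close> in the span of
  \<open>X\<close> satisfies \<open>x y \<in> S J\<close> up to a combination of at most \<open>t\<close> elements of \<open>X\<close>, whose products with
  \<open>u\<close> are recorded; and if \<open>x y \<in> S J\<close>, then \<open>y u = (x y) b\<close> is a sum of products \<open>s (c b)\<close>, which is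
  known by induction along the powers of \<open>J\<close>.  Finally \<open>R / J\<close> is a product of fields, hence
  generated by \<open>O(log n)\<close> elements, whose action on \<open>R\<close> is recorded as well.\<close>

section \<open>Spans and powers of ideals\<close>

lemma finite_has_greatest_nat:
  fixes f :: "'a \<Rightarrow> nat"
  assumes "finite F" "F \<noteq> {}"
  shows "\<exists>y\<in>F. \<forall>z\<in>F. f z \<le> f y"
proof -
  have "Max (f ` F) \<in> f ` F" using assms by (intro Max_in) auto
  then obtain y where "y \<in> F" "f y = Max (f ` F)" by (metis imageE)
  then show ?thesis using assms(1) by (intro bexI[of _ y]) auto
qed

text \<open>By Lagrange both orders are powers of \<open>p\<close>, so a strictly larger subgroup is
  larger by a factor of at least \<open>p\<close>. This takes the place of counting
  dimensions.\<close>

lemma (in group) card_generate_insert: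
  assumes p: "prime p" and ord: "order G = p ^ n" and H: "subgroup H G"
    and x: "x \<in> carrier G" "x \<notin> H"
  shows "p * card H \<le> card (generate G (insert x H))"
proof -
  have fin: "finite (carrier G)"
    using ord p by (metis order_gt_0_iff_finite prime_gt_0_nat zero_less_power)
  define K where "K = generate G (insert x H)"
  have sub: "insert x H \<subseteq> carrier G" using H x subgroup.subset by blast
  have K: "subgroup K G" unfolding K_def by (rule generate_is_subgroup[OF sub])
  have HK: "H \<subset> K" using x generate.incl[of _ "insert x H" G] unfolding K_def by blast
  have finK: "finite K" using K fin finite_subset subgroup.subset by blast
  have "card H dvd p ^ n" "card K dvd p ^ n"
    using lagrange[OF H] lagrange[OF K] ord by (metis dvd_triv_right)+
  then obtain i j where ij: "card H = p ^ i" "card K = p ^ j"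
    using p by (metis divides_primepow_nat)
  have "card H < card K" using HK finK psubset_card_mono by blast
  then have "i < j" using ij p by (metis power_strict_increasing_iff prime_gt_1_nat)
  then have "p ^ Suc i \<le> p ^ j" using prime_ge_1_nat[OF p] by (intro power_increasing) auto
  then show ?thesis using ij unfolding K_def by simp
qed

lemma (in group) generate_insert_generate:
  assumes "A \<subseteq> carrier G" "B \<subseteq> carrier G"
  shows "generate G (generate G A \<union> B) = generate G (A \<union> B)"
proof
  have AB: "A \<union> B \<subseteq> carrier G" using assms by blast
  show "generate G (generate G A \<union> B) \<subseteq> generate G (A \<union> B)"
  proof (rule generate_subgroup_incl[OF _ generate_is_subgroup[OF AB]])
    show "generate G A \<union> B \<subseteq> generate G (A \<union> B)"
      using mono_generate[of A "A \<union> B"] generate.incl[of _ "A \<union> B" G] by blast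
  qed
  show "generate G (A \<union> B) \<subseteq> generate G (generate G A \<union> B)"
    using generate.incl[of _ A G] by (intro mono_generate) blast
qed

text \<open>\<open>Y\<close> has maximal size among the subsets in which every element accounts for
  a factor \<open>p\<close> of the order; an element of \<open>X\<close> outside the generated
  subgroup could still be added. The inequality between orders matters as much as the bound on
  \<open>card Y\<close>: it later yields the factor \<open>n - d\<close> and the rank
  bounds.\<close>

lemma (in group) exists_small_generating_subset:
  assumes p: "prime p" and ord: "order G = p ^ n" and H: "subgroup H G" and X: "X \<subseteq> carrier G"
  obtains Y where "Y \<subseteq> X" "finite Y" "X \<subseteq> generate G (H \<union> Y)"
    "p ^ card Y * card H \<le> card (generate G (H \<union> Y))" "card Y \<le> n"
proof -
  have fin: "finite (carrier G)"
    using ord p by (metis order_gt_0_iff_finite prime_gt_0_nat zero_less_power)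
  then have finX: "finite X" using X finite_subset by blast
  have Hc: "H \<subseteq> carrier G" using H subgroup.subset by blast
  let ?F = "{Y. Y \<subseteq> X \<and> p ^ card Y * card H \<le> card (generate G (H \<union> Y))}"
  have "generate G H = H"
    using generate_subgroup_incl[OF subset_refl H] generate.incl[of _ H G] by blast
  then have "{} \<in> ?F" by simp
  moreover have "finite ?F" using finX by (auto intro: finite_subset[OF _ finite_Pow_iff[THEN iffD2]])
  ultimately obtain Y where Y: "Y \<in> ?F" and max: "\<And>Z. Z \<in> ?F \<Longrightarrow> card Z \<le> card Y"
    using finite_has_greatest_nat[of ?F card] by blast
  have finY: "finite Y" using Y finX finite_subset by blast
  have Yc: "H \<union> Y \<subseteq> carrier G" using Hc Y X by blast
  have gen: "X \<subseteq> generate G (H \<union> Y)"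
  proof
    fix x assume x: "x \<in> X"
    show "x \<in> generate G (H \<union> Y)"
    proof (rule ccontr)
      assume nx: "x \<notin> generate G (H \<union> Y)"
      then have xY: "x \<notin> Y" using generate.incl[of x "H \<union> Y" G] by blast
      have "p * card (generate G (H \<union> Y)) \<le> card (generate G (insert x (generate G (H \<union> Y))))"
        using card_generate_insert[OF p ord generate_is_subgroup[OF Yc] _ nx] x X by blast
      also have "generate G (insert x (generate G (H \<union> Y))) = generate G (H \<union> insert x Y)"
        using generate_insert_generate[OF Yc, of "{x}"] x X by (auto simp: insert_commute)
      finally have "p * card (generate G (H \<union> Y)) \<le> card (generate G (H \<union> insert x Y))" .
      moreover have "p * (p ^ card Y * card H) \<le> p * card (generate G (H \<union> Y))"
        using Y by (intro mult_le_mono2) simp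
      ultimately have "p ^ card (insert x Y) * card H \<le> card (generate G (H \<union> insert x Y))"
        using finY xY by (metis (no_types, lifting) card_insert_disjoint mult.assoc order.trans power_Suc)
      then have "insert x Y \<in> ?F"
        using Y x by simp
      then show False using max[of "insert x Y"] xY finY by simp
    qed
  qed
  have fg: "card (generate G (H \<union> Y)) \<le> p ^ n"
    using card_mono[OF fin generate_incl[OF Yc]] ord by (simp add: order_def)
  have "card H \<ge> 1" using H Hc fin
    by (metis One_nat_def Suc_leI card_gt_0_iff empty_iff finite_subset subgroup.one_closed)
  then have "p ^ card Y \<le> p ^ card Y * card H" by simp
  also have "\<dots> \<le> p ^ n" using Y fg by auto
  finally have "card Y \<le> n" using power_le_imp_le_exp prime_gt_1_nat[OF p] by blast
  then show ?thesis using that[of Y] Y finY gen by blast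
qed

text \<open>The additive group need not be elementary abelian, so subgroups take the place of
  subspaces and their orders the place of dimensions.\<close>

abbreviation aspan :: "('a, 'b) ring_scheme \<Rightarrow> 'a set \<Rightarrow> 'a set" where
  "aspan R X \<equiv> generate (add_monoid R) X"

lemma (in ring) aspan_least:
  "X \<subseteq> H \<Longrightarrow> additive_subgroup H R \<Longrightarrow> aspan R X \<subseteq> H"
  using add.generate_subgroup_incl additive_subgroup.a_subgroup by blast

lemma (in ring) additive_subgroup_aspan:
  "X \<subseteq> carrier R \<Longrightarrow> additive_subgroup (aspan R X) R"
  using add.generate_is_subgroup[of X] by (intro additive_subgroupI) simp

lemma aspan_superset: "X \<subseteq> aspan R X"
  using generate.incl[of _ X "add_monoid R"] by blast

lemma (in ring) additive_subgroupI':
  assumes "H \<subseteq> carrier R" "\<zero> \<in> H" "\<And>a. a \<in> H \<Longrightarrow> \<ominus> a \<in> H"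
    "\<And>a b. a \<in> H \<Longrightarrow> b \<in> H \<Longrightarrow> a \<oplus> b \<in> H"
  shows "additive_subgroup H R"
  using assms by (intro additive_subgroupI add.subgroupI) (auto simp: a_inv_def)

lemma (in ring) additive_subgroup_minus_closed:
  assumes "additive_subgroup H R" "a \<in> H" "b \<in> H"
  shows "a \<ominus> b \<in> H"
  using assms additive_subgroup.a_closed additive_subgroup.a_inv_closed by (metis a_minus_def minus_eq)

lemma (in ring) ideal_prod_least:
  assumes "additive_subgroup H R" "\<And>i j. i \<in> I \<Longrightarrow> j \<in> J \<Longrightarrow> i \<otimes> j \<in> H"
  shows "I \<cdot> J \<subseteq> H"
proof
  fix x assume "x \<in> I \<cdot> J"
  then show "x \<in> H"
    by induction (use assms additive_subgroup.a_closed in auto)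
qed

text \<open>The index is shifted by one: \<open>jpow R J m\<close> is the ideal power with exponent
  \<open>m + 1\<close>, so \<open>jpow R J 1\<close> is the square of \<open>J\<close>.\<close>

primrec jpow :: "('a, 'b) ring_scheme \<Rightarrow> 'a set \<Rightarrow> nat \<Rightarrow> 'a set" where
  "jpow R J 0 = J"
| "jpow R J (Suc m) = J \<cdot>\<^bsub>R\<^esub> jpow R J m"

lemma (in ring) ideal_jpow: "ideal J R \<Longrightarrow> ideal (jpow R J m) R"
  by (induction m) (auto intro: ideal_prod_is_ideal)

lemma (in ring) jpow_Suc_subset: "ideal J R \<Longrightarrow> jpow R J (Suc m) \<subseteq> jpow R J m"
  using ideal_prod_inter[of J "jpow R J m"] ideal_jpow[of J m] by auto

text \<open>A nil ideal of a finite ring is nilpotent. The powers become constant at some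
  \<open>I\<close> with \<open>J I = I\<close>. If \<open>I\<close> is nonzero, take
  \<open>x\<close> with \<open>x I\<close> nonzero of least size. Then \<open>y x I = 0\<close> for
  every \<open>y\<close> in \<open>J\<close>, whence \<open>x I = x J I = 0\<close>, a
  contradiction.\<close>

lemma (in cring) jpow_eventually_zero:
  assumes fin: "finite (carrier R)" and J: "ideal J R"
    and nil: "\<And>x. x \<in> J \<Longrightarrow> \<exists>k::nat. x [^] k = \<zero>"
  shows "\<exists>m. jpow R J m = {\<zero>}"
proof -
  have Jc: "J \<subseteq> carrier R" using J by (rule ideal.Icarr[THEN subsetI])
  have subc: "jpow R J m \<subseteq> carrier R" for m
    using ideal.Icarr[OF ideal_jpow[OF J]] by blast
  have "\<exists>m. jpow R J (Suc m) = jpow R J m"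
  proof (rule ccontr)
    assume ne: "\<not> ?thesis"
    have "card (jpow R J m) + m \<le> card (carrier R)" for m
    proof (induction m)
      case 0
      show ?case using card_mono[OF fin Jc] by simp
    next
      case (Suc m)
      have "card (jpow R J (Suc m)) < card (jpow R J m)"
        using ne jpow_Suc_subset[OF J, of m] finite_subset[OF subc fin]
        by (metis psubsetI psubset_card_mono)
      then show ?case using Suc by linarith
    qed
    from this[of "Suc (card (carrier R))"] show False by simp
  qed
  then obtain m where m: "jpow R J (Suc m) = jpow R J m" by blast
  define I where "I = jpow R J m"
  have I: "ideal I R" unfolding I_def by (rule ideal_jpow[OF J])
  have Ic: "I \<subseteq> carrier R" unfolding I_def by (rule subc)
  have zI: "\<zero> \<in> I" using I by (simp add: additive_subgroup.zero_closed ideal.axioms(1))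
  have JI: "J \<cdot> I = I" using m unfolding I_def by simp
  have "I = {\<zero>}"
  proof (rule ccontr)
    assume nz: "I \<noteq> {\<zero>}"
    let ?img = "\<lambda>x. (\<lambda>a. x \<otimes> a) ` I"
    let ?P = "\<lambda>x. x \<in> carrier R \<and> ?img x \<noteq> {\<zero>}"
    have "?img \<one> = I" using Ic by (force simp: image_iff)
    then have "?P \<one>" using nz by simp
    then obtain x where x: "?P x" and min: "\<And>z. ?P z \<Longrightarrow> card (?img x) \<le> card (?img z)"
      using ex_has_least_nat[of ?P \<one> "\<lambda>x. card (?img x)"] by blast
    have xc: "x \<in> carrier R" using x by blast
    have kill: "(y \<otimes> x) \<otimes> i = \<zero>" if y: "y \<in> J" and i: "i \<in> I" for y i
    proof (rule ccontr)
      assume nk: "(y \<otimes> x) \<otimes> i \<noteq> \<zero>"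
      have yc: "y \<in> carrier R" using y Jc by blast
      have "?img (y \<otimes> x) \<noteq> {\<zero>}" using nk i by blast
      then have "card (?img x) \<le> card (?img (y \<otimes> x))" using min yc xc by blast
      moreover have "?img (y \<otimes> x) \<subseteq> ?img x"
      proof clarify
        fix a assume a: "a \<in> I"
        have "(y \<otimes> x) \<otimes> a = x \<otimes> (y \<otimes> a)"
          using a Ic yc xc by (metis m_assoc m_comm subsetD)
        then show "(y \<otimes> x) \<otimes> a \<in> ?img x"
          using ideal.I_l_closed[OF I a yc] by blast
      qed
      ultimately have eq: "?img (y \<otimes> x) = ?img x"
        using finite_subset[OF Ic fin] by (intro card_seteq) auto
      \<comment> \<open>Iterating \<open>y x I = x I\<close> pulls any power of \<open>y\<close> out
        of \<open>x a\<close>, and some power of \<open>y\<close> is zero.\<close>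
      have pw: "\<exists>b\<in>I. x \<otimes> a = (y [^] k) \<otimes> (x \<otimes> b)" if "a \<in> I" for a and k :: nat
        using that
      proof (induction k arbitrary: a)
        case 0
        then show ?case using xc Ic by (intro bexI[of _ a]) auto
      next
        case (Suc k)
        obtain b where b: "b \<in> I" "x \<otimes> a = (y \<otimes> x) \<otimes> b"
          using eq Suc.prems by blast
        obtain c where c: "c \<in> I" "x \<otimes> b = (y [^] k) \<otimes> (x \<otimes> c)"
          using Suc.IH[OF b(1)] by blast
        have "b \<in> carrier R" "c \<in> carrier R" using b c Ic by auto
        then have "x \<otimes> a = (y [^] Suc k) \<otimes> (x \<otimes> c)"
          using b c xc yc by (metis m_assoc m_closed m_comm nat_pow_Suc nat_pow_closed)
        then show ?case using c by blast
      qed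
      obtain k :: nat where "y [^] k = \<zero>" using nil[OF y] by blast
      then have "x \<otimes> a = \<zero>" if "a \<in> I" for a
        using pw[OF that, of k] xc Ic by (metis l_null m_closed subsetD)
      then have "?img x = {\<zero>}" using zI by force
      then show False using x by blast
    qed
    have "additive_subgroup {a \<in> carrier R. x \<otimes> a = \<zero>} R"
      by (rule additive_subgroupI') (use xc in \<open>auto simp: r_minus r_distr\<close>)
    then have "J \<cdot> I \<subseteq> {a \<in> carrier R. x \<otimes> a = \<zero>}"
    proof (rule ideal_prod_least)
      fix y i assume "y \<in> J" "i \<in> I"
      then show "y \<otimes> i \<in> {a \<in> carrier R. x \<otimes> a = \<zero>}"
        using kill[of y i] Jc Ic xc by (auto simp: m_comm m_assoc m_lcomm subset_iff)
    qed
    then have "?img x = {\<zero>}" using JI zI by force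
    then show False using x by blast
  qed
  then show ?thesis unfolding I_def by blast
qed

section \<open>Two multiplications on one additive group\<close>

text \<open>Uniqueness of a description is proved by comparing two multiplications on literally the
  same additive group. The units are not assumed equal; \<open>ring_iso_id\<close> derives this once
  the multiplications agree.\<close>

locale same_additive_group = R: cring R + R': cring R' for R :: "'a ring" and R' :: "'a ring" +
  assumes carrier_eq: "carrier R' = carrier R"
    and add_eq: "add R' = add R"
    and zero_eq: "zero R' = zero R"
begin

text \<open>This difference is symmetric and biadditive, so agreement of the two products modulo a
  subgroup passes from generators to their span.\<close>

definition mult_diff :: "'a \<Rightarrow> 'a \<Rightarrow> 'a" where
  "mult_diff a b = a \<otimes>\<^bsub>R\<^esub> b \<ominus>\<^bsub>R\<^esub> a \<otimes>\<^bsub>R'\<^esub> b"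

lemma a_inv_eq: "a_inv R' = a_inv R"
  by (rule ext) (simp add: a_inv_def m_inv_def carrier_eq add_eq zero_eq)

lemma mult'_closed [simp, intro]:
  "a \<in> carrier R \<Longrightarrow> b \<in> carrier R \<Longrightarrow> a \<otimes>\<^bsub>R'\<^esub> b \<in> carrier R"
  using R'.m_closed carrier_eq by simp

lemma l_distr':
  "a \<in> carrier R \<Longrightarrow> b \<in> carrier R \<Longrightarrow> c \<in> carrier R \<Longrightarrow>
    (a \<oplus>\<^bsub>R\<^esub> b) \<otimes>\<^bsub>R'\<^esub> c = a \<otimes>\<^bsub>R'\<^esub> c \<oplus>\<^bsub>R\<^esub> b \<otimes>\<^bsub>R'\<^esub> c"
  using R'.l_distr[of a b c] by (simp add: carrier_eq add_eq)

lemma l_minus': "a \<in> carrier R \<Longrightarrow> b \<in> carrier R \<Longrightarrow>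
    (\<ominus>\<^bsub>R\<^esub> a) \<otimes>\<^bsub>R'\<^esub> b = \<ominus>\<^bsub>R\<^esub> (a \<otimes>\<^bsub>R'\<^esub> b)"
  using R'.l_minus[of a b] by (simp add: carrier_eq a_inv_eq)

lemma l_null': "b \<in> carrier R \<Longrightarrow> \<zero>\<^bsub>R\<^esub> \<otimes>\<^bsub>R'\<^esub> b = \<zero>\<^bsub>R\<^esub>"
  using R'.l_null[of b] by (simp add: carrier_eq zero_eq)

lemma m_comm': "a \<in> carrier R \<Longrightarrow> b \<in> carrier R \<Longrightarrow> a \<otimes>\<^bsub>R'\<^esub> b = b \<otimes>\<^bsub>R'\<^esub> a"
  using R'.m_comm[of a b] by (simp add: carrier_eq)

lemma m_assoc': "a \<in> carrier R \<Longrightarrow> b \<in> carrier R \<Longrightarrow> c \<in> carrier R \<Longrightarrow>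
    a \<otimes>\<^bsub>R'\<^esub> b \<otimes>\<^bsub>R'\<^esub> c = a \<otimes>\<^bsub>R'\<^esub> (b \<otimes>\<^bsub>R'\<^esub> c)"
  using R'.m_assoc[of a b c] by (simp add: carrier_eq)

lemma mult_diff_closed [simp, intro]:
  "a \<in> carrier R \<Longrightarrow> b \<in> carrier R \<Longrightarrow> mult_diff a b \<in> carrier R"
  by (simp add: mult_diff_def)

lemma mult_diff_comm: "a \<in> carrier R \<Longrightarrow> b \<in> carrier R \<Longrightarrow> mult_diff a b = mult_diff b a"
  by (simp add: mult_diff_def R.m_comm m_comm')

lemma mult_diff_add:
  assumes "a \<in> carrier R" "b \<in> carrier R" "c \<in> carrier R"
  shows "mult_diff (a \<oplus>\<^bsub>R\<^esub> b) c = mult_diff a c \<oplus>\<^bsub>R\<^esub> mult_diff b c"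
  using assms by (simp add: mult_diff_def l_distr' R.l_distr R.minus_eq R.minus_add R.a_ac)

lemma mult_diff_inv:
  assumes "a \<in> carrier R" "c \<in> carrier R"
  shows "mult_diff (\<ominus>\<^bsub>R\<^esub> a) c = \<ominus>\<^bsub>R\<^esub> mult_diff a c"
  using assms by (simp add: mult_diff_def l_minus' R.l_minus R.minus_eq R.minus_add)

lemma mult_diff_eq_0_iff:
  assumes "a \<in> carrier R" "b \<in> carrier R"
  shows "mult_diff a b = \<zero>\<^bsub>R\<^esub> \<longleftrightarrow> a \<otimes>\<^bsub>R\<^esub> b = a \<otimes>\<^bsub>R'\<^esub> b"
  using assms by (simp add: mult_diff_def)

lemma additive_subgroup_mult_diff:
  assumes I: "additive_subgroup I R" and b: "b \<in> carrier R"
  shows "additive_subgroup {a \<in> carrier R. mult_diff a b \<in> I} R"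
proof (rule R.additive_subgroupI')
  have "mult_diff \<zero>\<^bsub>R\<^esub> b = \<zero>\<^bsub>R\<^esub>" using b by (simp add: mult_diff_eq_0_iff l_null')
  then show "\<zero>\<^bsub>R\<^esub> \<in> {a \<in> carrier R. mult_diff a b \<in> I}"
    using I by (simp add: additive_subgroup.zero_closed)
qed (use b I in \<open>auto simp: mult_diff_add mult_diff_inv additive_subgroup.a_closed
       additive_subgroup.a_inv_closed\<close>)

lemma mult_diff_aspan:
  assumes "additive_subgroup I R" "b \<in> carrier R" "X \<subseteq> carrier R"
    and "\<And>x. x \<in> X \<Longrightarrow> mult_diff x b \<in> I" and "a \<in> aspan R X"
  shows "mult_diff a b \<in> I"
proof -
  have "aspan R X \<subseteq> {a \<in> carrier R. mult_diff a b \<in> I}"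
    using assms by (intro R.aspan_least additive_subgroup_mult_diff) auto
  then show ?thesis using assms by blast
qed

definition common_mult :: "'a set" where
  "common_mult = {a \<in> carrier R. \<forall>b\<in>carrier R. a \<otimes>\<^bsub>R\<^esub> b = a \<otimes>\<^bsub>R'\<^esub> b}"

text \<open>Modulo each power of \<open>J\<close> in turn, the difference of the two multiplications is killed by
  associativity: if \<open>x y \<in> W\<close> then \<open>y (x b) = (x y) b\<close> is a sum of products
  \<open>s (c b)\<close> with \<open>s \<in> S\<close>, and \<open>c b\<close> is already known modulo the previous power.\<close>

proposition mult_eq_on_nilpotent_ideal:
  assumes J: "ideal J R" and J': "\<And>a b. a \<in> J \<Longrightarrow> b \<in> J \<Longrightarrow> a \<otimes>\<^bsub>R'\<^esub> b \<in> J"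
    and nil: "jpow R J m = {\<zero>\<^bsub>R\<^esub>}"
    and S: "S \<subseteq> J" "S \<subseteq> common_mult"
    and V: "V \<subseteq> J" "\<And>x y. x \<in> V \<Longrightarrow> y \<in> V \<Longrightarrow> x \<otimes>\<^bsub>R\<^esub> y = x \<otimes>\<^bsub>R'\<^esub> y"
    and W: "W = aspan R {s \<otimes>\<^bsub>R\<^esub> c | s c. s \<in> S \<and> c \<in> J}"
    and U: "U \<subseteq> J" "J \<subseteq> aspan R (V \<union> W \<union> U)"
    and Y: "\<And>u. u \<in> U \<Longrightarrow> \<exists>x\<in>V. \<exists>b\<in>J. \<exists>Y\<subseteq>V. u = x \<otimes>\<^bsub>R\<^esub> b \<and> u = x \<otimes>\<^bsub>R'\<^esub> b \<and>
        (\<forall>y\<in>Y. y \<otimes>\<^bsub>R\<^esub> u = y \<otimes>\<^bsub>R'\<^esub> u) \<and> V \<subseteq> aspan R (Y \<union> {v \<in> V. x \<otimes>\<^bsub>R\<^esub> v \<in> W})"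
    and ab: "a \<in> J" "b \<in> J"
  shows "a \<otimes>\<^bsub>R\<^esub> b = a \<otimes>\<^bsub>R'\<^esub> b"
proof -
  have Jc: "J \<subseteq> carrier R" using J by (rule ideal.Icarr[THEN subsetI])
  have Jsub: "additive_subgroup J R" using J by (rule ideal.axioms(1))
  have WJ: "W \<subseteq> J"
    unfolding W using S ideal.I_r_closed[OF J] Jc by (intro R.aspan_least Jsub) blast
  have cJ: "x \<in> carrier R" if "x \<in> J" for x using that Jc by blast
  \<comment> \<open>Each round of the induction gains one power of \<open>J\<close>, for all pairs
    in \<open>J\<close> simultaneously. Within a round the cases are treated in the order
    \<open>W\<close> with \<open>J\<close>, \<open>V\<close> with \<open>U\<close>, \<open>V\<close>
    with \<open>J\<close>, and finally \<open>J\<close> with \<open>J\<close>.\<close>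
  have key: "\<forall>a\<in>J. \<forall>b\<in>J. mult_diff a b \<in> jpow R J m" for m
  proof (induction m)
    case 0
    show ?case using J J' ideal.I_r_closed[OF J] cJ R.additive_subgroup_minus_closed[OF Jsub]
      by (simp add: mult_diff_def)
  next
    case (Suc m)
    let ?J = "jpow R J (Suc m)"
    have sub: "additive_subgroup ?J R"
      using R.ideal_jpow[OF J] ideal.axioms(1) by blast
    have up: "s \<otimes>\<^bsub>R\<^esub> c \<in> ?J" if "s \<in> J" "c \<in> jpow R J m" for s c
      using that ideal_prod.prod[of s J c "jpow R J m" R] by simp
    \<comment> \<open>Multiplication by \<open>s\<close> is the same in both rings, so the
      difference at \<open>(s d, c)\<close> is \<open>s\<close> times the difference at
      \<open>(d, c)\<close>, which lies in the previous power.\<close>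
    have WD: "mult_diff w c \<in> ?J" if w: "w \<in> W" and c: "c \<in> J" for w c
    proof (rule mult_diff_aspan[OF sub cJ[OF c] _ _ w[unfolded W]])
      show "{s \<otimes>\<^bsub>R\<^esub> c | s c. s \<in> S \<and> c \<in> J} \<subseteq> carrier R" using S cJ by auto
      fix v assume "v \<in> {s \<otimes>\<^bsub>R\<^esub> c | s c. s \<in> S \<and> c \<in> J}"
      then obtain s d where v: "v = s \<otimes>\<^bsub>R\<^esub> d" and s: "s \<in> S" and d: "d \<in> J" by blast
      have sc: "s \<in> carrier R" "s \<in> J" using s S cJ by auto
      have sm: "s \<otimes>\<^bsub>R\<^esub> e = s \<otimes>\<^bsub>R'\<^esub> e" if "e \<in> carrier R" for e
        using s S(2) that unfolding common_mult_def by blast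
      note [simp] = cJ[OF d] cJ[OF c] sc
      have 1: "v \<otimes>\<^bsub>R\<^esub> c = s \<otimes>\<^bsub>R\<^esub> (d \<otimes>\<^bsub>R\<^esub> c)"
        by (simp add: v R.m_assoc)
      have 2: "v \<otimes>\<^bsub>R'\<^esub> c = s \<otimes>\<^bsub>R\<^esub> (d \<otimes>\<^bsub>R'\<^esub> c)"
        by (simp add: v sm m_assoc')
      have "mult_diff v c = s \<otimes>\<^bsub>R\<^esub> (mult_diff d c)"
        unfolding mult_diff_def 1 2 by (simp add: R.minus_eq R.r_distr R.r_minus)
      moreover have "mult_diff d c \<in> jpow R J m" using Suc d c by blast
      ultimately show "mult_diff v c \<in> ?J" using up[OF sc(2)] by simp
    qed
    have VU: "mult_diff v u \<in> ?J" if v: "v \<in> V" and u: "u \<in> U" for v u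
    proof -
      obtain x b Y where x: "x \<in> V" and b: "b \<in> J" and Yv: "Y \<subseteq> V"
        and ux: "u = x \<otimes>\<^bsub>R\<^esub> b" "u = x \<otimes>\<^bsub>R'\<^esub> b"
        and Yu: "\<forall>y\<in>Y. y \<otimes>\<^bsub>R\<^esub> u = y \<otimes>\<^bsub>R'\<^esub> u"
        and VY: "V \<subseteq> aspan R (Y \<union> {v \<in> V. x \<otimes>\<^bsub>R\<^esub> v \<in> W})"
        using Y[OF u] by blast
      have uc: "u \<in> carrier R" using u U(1) cJ by blast
      have xc: "x \<in> carrier R" using x V(1) cJ by blast
      show ?thesis
      proof (rule mult_diff_aspan[OF sub uc _ _ VY[THEN subsetD, OF v]])
        show "Y \<union> {v \<in> V. x \<otimes>\<^bsub>R\<^esub> v \<in> W} \<subseteq> carrier R" using Yv V(1) Jc by blast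
        fix y assume "y \<in> Y \<union> {v \<in> V. x \<otimes>\<^bsub>R\<^esub> v \<in> W}"
        then show "mult_diff y u \<in> ?J"
        proof
          assume "y \<in> Y"
          then have "mult_diff y u = \<zero>\<^bsub>R\<^esub>"
            using Yu uc Yv V(1) cJ by (subst mult_diff_eq_0_iff) auto
          then show ?thesis using sub by (simp add: additive_subgroup.zero_closed)
        next
          assume "y \<in> {v \<in> V. x \<otimes>\<^bsub>R\<^esub> v \<in> W}"
          then have y: "y \<in> V" "x \<otimes>\<^bsub>R\<^esub> y \<in> W" by auto
          have yc: "y \<in> carrier R" using y(1) V(1) cJ by blast
          have "y \<otimes>\<^bsub>R\<^esub> u = (x \<otimes>\<^bsub>R\<^esub> y) \<otimes>\<^bsub>R\<^esub> b"
            using xc yc cJ[OF b] by (simp add: ux(1) R.m_ac)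
          moreover have "y \<otimes>\<^bsub>R'\<^esub> u = (x \<otimes>\<^bsub>R\<^esub> y) \<otimes>\<^bsub>R'\<^esub> b"
            using xc yc cJ[OF b] V(2)[OF x y(1)] m_assoc' m_comm' by (metis ux(2))
          ultimately have "mult_diff y u = mult_diff (x \<otimes>\<^bsub>R\<^esub> y) b"
            by (simp add: mult_diff_def)
          then show ?thesis using WD[OF y(2) b] by simp
        qed
      qed
    qed
    have VWU: "V \<union> W \<union> U \<subseteq> carrier R" using V(1) WJ U(1) Jc by blast
    \<comment> \<open>This case has to precede the general one, where a generator \<open>x c\<close>
      from \<open>U\<close> is handled through the product of \<open>x\<close> with an element of
      \<open>J\<close>.\<close>
    have VJ: "mult_diff v a \<in> ?J" if v: "v \<in> V" and a: "a \<in> J" for v a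
    proof -
      have vc: "v \<in> carrier R" using v V(1) cJ by blast
      have "mult_diff a v \<in> ?J"
      proof (rule mult_diff_aspan[OF sub vc VWU _ U(2)[THEN subsetD, OF a]])
        fix z assume z: "z \<in> V \<union> W \<union> U"
        then have zc: "z \<in> carrier R" using VWU by blast
        consider "z \<in> V" | "z \<in> W" | "z \<in> U" using z by blast
        then show "mult_diff z v \<in> ?J"
        proof cases
          case 1
          then have "mult_diff z v = \<zero>\<^bsub>R\<^esub>"
            using V(2) v zc vc by (subst mult_diff_eq_0_iff) auto
          then show ?thesis using sub by (simp add: additive_subgroup.zero_closed)
        next
          case 2
          then show ?thesis using WD V(1) v by blast
        next
          case 3
          then show ?thesis using VU[OF v 3] mult_diff_comm[OF zc vc] by simp
        qed
      qed
      then show ?thesis using mult_diff_comm[OF vc cJ[OF a]] by simp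
    qed
    show ?case
    proof (intro ballI)
      fix a b assume a: "a \<in> J" and b: "b \<in> J"
      show "mult_diff a b \<in> ?J"
      proof (rule mult_diff_aspan[OF sub cJ[OF b] VWU _ U(2)[THEN subsetD, OF a]])
        fix z assume "z \<in> V \<union> W \<union> U"
        then consider "z \<in> V" | "z \<in> W" | "z \<in> U" by blast
        then show "mult_diff z b \<in> ?J"
        proof cases
          case 1 then show ?thesis using VJ b by blast
        next
          case 2 then show ?thesis using WD b by blast
        next
          case 3
          then obtain x c where x: "x \<in> V" and c: "c \<in> J"
            and z: "z = x \<otimes>\<^bsub>R\<^esub> c" "z = x \<otimes>\<^bsub>R'\<^esub> c" using Y by blast
          have xJ: "x \<in> J" using x V(1) by blast
          note [simp] = cJ[OF xJ] cJ[OF c] cJ[OF b]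
          let ?d = "mult_diff c b"
          have d: "?d \<in> jpow R J m" using Suc c b by blast
          have cb: "c \<otimes>\<^bsub>R'\<^esub> b \<in> J" using J' c b by blast
          \<comment> \<open>For \<open>z = x c\<close> the inner product \<open>c b\<close> is
            replaced by its value in \<open>R'\<close>; the error \<open>?d\<close> lies in the
            previous power and is multiplied by \<open>x\<close> in \<open>J\<close>. What remains
            compares two products of \<open>x\<close> with one and the same element of
            \<open>J\<close>.\<close>
          have 1: "z \<otimes>\<^bsub>R\<^esub> b = x \<otimes>\<^bsub>R\<^esub> (c \<otimes>\<^bsub>R'\<^esub> b) \<oplus>\<^bsub>R\<^esub> x \<otimes>\<^bsub>R\<^esub> ?d"
          proof -
            have "c \<otimes>\<^bsub>R\<^esub> b = c \<otimes>\<^bsub>R'\<^esub> b \<oplus>\<^bsub>R\<^esub> ?d"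
              by (simp add: mult_diff_def R.minus_eq R.a_lcomm[of _ "c \<otimes>\<^bsub>R\<^esub> b"] R.r_neg)
            then show ?thesis by (simp add: z(1) R.m_assoc R.r_distr)
          qed
          have 2: "z \<otimes>\<^bsub>R'\<^esub> b = x \<otimes>\<^bsub>R'\<^esub> (c \<otimes>\<^bsub>R'\<^esub> b)"
            using z(2) by (simp add: m_assoc')
          have "mult_diff z b = mult_diff x (c \<otimes>\<^bsub>R'\<^esub> b) \<oplus>\<^bsub>R\<^esub> x \<otimes>\<^bsub>R\<^esub> ?d"
            unfolding mult_diff_def[of z] 1 2
            by (simp add: mult_diff_def[of x] R.minus_eq R.a_ac)
          then show ?thesis
            using VJ[OF x cb] up[OF xJ d] additive_subgroup.a_closed[OF sub] by simp
        qed
      qed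
    qed
  qed
  have "mult_diff a b = \<zero>\<^bsub>R\<^esub>" using key[of m] nil ab by blast
  then show ?thesis using mult_diff_eq_0_iff ab cJ by blast
qed

text \<open>For products, associativity in each ring reduces multiplication by \<open>a b\<close> to
  multiplying by \<open>b\<close> and then by \<open>a\<close>, and both of these are common to the
  two rings. Thus it suffices to record ring generators instead of additive ones.\<close>

lemma subring_common_mult:
  assumes "\<one>\<^bsub>R\<^esub> \<in> common_mult"
  shows "subring common_mult R"
proof (rule R.subringI)
  fix a b assume a: "a \<in> common_mult" and b: "b \<in> common_mult"
  then have ab: "a \<in> carrier R" "b \<in> carrier R" by (auto simp: common_mult_def)
  show "\<ominus>\<^bsub>R\<^esub> a \<in> common_mult"
    using a by (simp add: common_mult_def R.l_minus l_minus')
  show "a \<oplus>\<^bsub>R\<^esub> b \<in> common_mult"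
    using a b by (simp add: common_mult_def R.l_distr l_distr')
  have "a \<otimes>\<^bsub>R\<^esub> b \<otimes>\<^bsub>R\<^esub> c = a \<otimes>\<^bsub>R\<^esub> b \<otimes>\<^bsub>R'\<^esub> c" if c: "c \<in> carrier R" for c
  proof -
    have "a \<otimes>\<^bsub>R\<^esub> b \<otimes>\<^bsub>R\<^esub> c = a \<otimes>\<^bsub>R\<^esub> (b \<otimes>\<^bsub>R'\<^esub> c)"
      using b c ab by (simp add: common_mult_def R.m_assoc)
    also have "\<dots> = a \<otimes>\<^bsub>R'\<^esub> (b \<otimes>\<^bsub>R'\<^esub> c)"
      using a c ab by (simp add: common_mult_def)
    also have "\<dots> = a \<otimes>\<^bsub>R\<^esub> b \<otimes>\<^bsub>R'\<^esub> c"
      using a b c ab m_assoc' by (simp add: common_mult_def)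
    finally show ?thesis .
  qed
  then show "a \<otimes>\<^bsub>R\<^esub> b \<in> common_mult" using ab by (simp add: common_mult_def)
qed (use assms in \<open>auto simp: common_mult_def\<close>)

end

section \<open>Generators modulo the nilradical\<close>

lemma (in cring) nonunit_in_maximalideal:
  assumes fin: "finite (carrier R)" and a: "a \<in> carrier R" "a \<notin> Units R"
  shows "\<exists>M. maximalideal M R \<and> a \<in> M"
proof -
  let ?F = "{I. ideal I R \<and> a \<in> I \<and> \<one> \<notin> I}"
  have "\<one> \<notin> PIdl a"
  proof
    assume "\<one> \<in> PIdl a"
    then obtain b where "b \<in> carrier R" "\<one> = b \<otimes> a" unfolding cgenideal_def by blast
    then have "a \<in> Units R" using a(1) m_comm unfolding Units_def by auto
    then show False using a(2) by blast
  qed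
  then have "PIdl a \<in> ?F" using a(1) cgenideal_ideal cgenideal_self by blast
  moreover have sub: "?F \<subseteq> Pow (carrier R)" using ideal.Icarr by fastforce
  ultimately obtain M where M: "M \<in> ?F" and max: "\<forall>I\<in>?F. card I \<le> card M"
    using finite_has_greatest_nat[of ?F card] finite_subset[OF sub] fin by blast
  have "maximalideal M R"
  proof (rule maximalidealI)
    show "ideal M R" using M by blast
    show "carrier R \<noteq> M" using M by blast
    fix I assume I: "ideal I R" "M \<subseteq> I" "I \<subseteq> carrier R"
    show "I = M \<or> I = carrier R"
    proof (cases "\<one> \<in> I")
      case True
      then show ?thesis using ideal.one_imp_carrier[OF I(1)] by blast
    next
      case False
      then have "card I \<le> card M" using I M max by blast
      then have "M = I" using I finite_subset[OF I(3) fin] by (intro card_seteq) auto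
      then show ?thesis by blast
    qed
  qed
  then show ?thesis using M by blast
qed

lemma (in cring) pow_in_ideal:
  assumes "ideal I R" "x \<in> I" "0 < (k::nat)"
  shows "x [^] k \<in> I"
proof -
  obtain j where "k = Suc j" using assms(3) gr0_implies_Suc by blast
  then show ?thesis using ideal.I_l_closed[OF assms(1,2)] ideal.Icarr[OF assms(1,2)] by simp
qed

text \<open>Two powers of \<open>x\<close> coincide, so \<open>x^i (1 - x^(j - i)) = 0\<close>. The
  second factor is congruent to 1 modulo every maximal ideal, hence a unit, and
  \<open>x^i = 0\<close>.\<close>

lemma (in cring) nilpotent_if_in_all_maximalideals:
  assumes fin: "finite (carrier R)" and x: "x \<in> carrier R"
    and M: "\<And>M. maximalideal M R \<Longrightarrow> x \<in> M"
  shows "\<exists>k::nat. x [^] k = \<zero>"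
proof -
  have "\<not> inj (\<lambda>k::nat. x [^] k)"
  proof
    assume "inj (\<lambda>k::nat. x [^] k)"
    moreover have "finite (range (\<lambda>k::nat. x [^] k))"
      using x by (intro finite_subset[OF _ fin]) auto
    ultimately show False using finite_imageD by blast
  qed
  then obtain i j :: nat where ij: "i < j" "x [^] i = x [^] j"
    unfolding inj_def by (metis linorder_neqE_nat)
  define y where "y = \<one> \<ominus> x [^] (j - i)"
  have y: "y \<in> carrier R" unfolding y_def using x by simp
  have "x [^] j = x [^] i \<otimes> x [^] (j - i)"
    using x ij(1) by (simp add: nat_pow_mult)
  then have zero: "x [^] i \<otimes> y = \<zero>"
    using ij(2) x by (simp add: y_def minus_eq r_distr r_minus r_neg)
  have "y \<in> Units R"
  proof (rule ccontr)
    assume "y \<notin> Units R"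
    then obtain N where N: "maximalideal N R" "y \<in> N"
      using nonunit_in_maximalideal[OF fin y] by blast
    have id: "ideal N R" using N(1) by (rule maximalideal.axioms(1))
    have "x [^] (j - i) \<in> N" using pow_in_ideal[OF id M[OF N(1)]] ij by simp
    then have "y \<oplus> x [^] (j - i) \<in> N"
      using N(2) id by (simp add: additive_subgroup.a_closed ideal.axioms(1))
    moreover have "y \<oplus> x [^] (j - i) = \<one>" using x by (simp add: y_def minus_eq a_assoc l_neg)
    ultimately have "\<one> \<in> N" by simp
    then show False using ideal.one_imp_carrier[OF id] maximalideal.I_notcarr[OF N(1)] by blast
  qed
  then obtain z where z: "z \<in> carrier R" "y \<otimes> z = \<one>" unfolding Units_def by blast
  have "x [^] i = (x [^] i \<otimes> y) \<otimes> z" using x y z by (simp add: m_assoc)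
  then show ?thesis using zero z by auto
qed

section \<open>Residue fields and the Chinese remainder theorem\<close>

lemma carrier_FactRing: "carrier (R Quot I) = a_r_coset R I ` carrier R"
  unfolding FactRing_def A_RCOSETS_def' by auto

lemma zero_FactRing: "\<zero>\<^bsub>R Quot I\<^esub> = I"
  by (simp add: FactRing_def)

text \<open>The multiplicative group of the finite field \<open>R Quot M\<close> is cyclic;
  \<open>g\<close> lifts a generator.\<close>

lemma (in cring) residue_field_generator:
  assumes fin: "finite (carrier R)" and M: "maximalideal M R"
  shows "\<exists>g\<in>carrier R. \<forall>x\<in>carrier R. x \<notin> M \<longrightarrow> (\<exists>k::nat. x \<ominus> g [^] k \<in> M)"
proof -
  interpret M: maximalideal M R by (rule M)
  interpret Q: field "R Quot M" by (rule M.quotient_is_field[OF is_cring])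
  interpret h: ring_hom_cring R "R Quot M" "(+>) M" by (rule M.rcos_ring_hom_cring[OF is_cring])
  note car = carrier_FactRing[of R M]
  then have "finite (carrier (R Quot M))" using fin by simp
  from Q.finite_field_mult_group_has_gen[OF this, unfolded nat_pow_mult_of] obtain a
    where a: "a \<in> carrier (mult_of (R Quot M))"
      and gen: "carrier (mult_of (R Quot M)) = {a [^]\<^bsub>R Quot M\<^esub> i | i::nat. i \<in> UNIV}"
    by (rule bexE)
  from a have "a \<in> (+>) M ` carrier R" unfolding carrier_mult_of car by (rule DiffD1)
  then obtain g where g: "a = M +> g" "g \<in> carrier R" by (rule imageE)
  have pow: "a [^]\<^bsub>R Quot M\<^esub> k = M +> (g [^] k)" for k :: nat
    unfolding g(1) by (rule h.hom_pow[OF g(2), symmetric])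
  have "\<exists>k::nat. x \<ominus> g [^] k \<in> M" if x: "x \<in> carrier R" "x \<notin> M" for x
  proof -
    have "M +> x \<noteq> M" using M.rcos_const_imp_mem[OF x(1)] x(2) by metis
    then have "M +> x \<in> carrier (mult_of (R Quot M))"
      unfolding carrier_mult_of car zero_FactRing using x(1) by simp
    then have "\<exists>k::nat. M +> x = a [^]\<^bsub>R Quot M\<^esub> k" unfolding gen by simp
    then obtain k :: nat where "M +> x = M +> (g [^] k)" unfolding pow by metis
    then show ?thesis
      using quotient_eq_iff_same_a_r_cos[OF M.is_ideal x(1) nat_pow_closed[OF g(2)]] by metis
  qed
  then show ?thesis using g(2) by metis
qed

text \<open>The solution is kept inside a subring \<open>Z\<close> because the result is used twice:
  for the whole ring, to construct generators, and for an arbitrary subring containing these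
  generators, to show that it is everything.\<close>

lemma (in cring) chinese_remainder_in_subring:
  assumes Z: "subring Z R" and fin: "finite \<N>" and id: "\<And>M. M \<in> \<N> \<Longrightarrow> ideal M R"
    and e: "\<And>M. M \<in> \<N> \<Longrightarrow> \<exists>e\<in>Z. e \<ominus> \<one> \<in> M \<and> (\<forall>M'\<in>\<N>. M' \<noteq> M \<longrightarrow> e \<in> M')"
    and c: "\<And>M. M \<in> \<N> \<Longrightarrow> c M \<in> Z"
  shows "\<exists>x\<in>Z. \<forall>M\<in>\<N>. x \<ominus> c M \<in> M"
proof -
  have Zc: "z \<in> carrier R" if "z \<in> Z" for z using that subringE(1)[OF Z] by blast
  have "\<exists>x\<in>Z. \<forall>M\<in>\<F>. x \<ominus> c M \<in> M" if "\<F> \<subseteq> \<N>" "finite \<F>" for \<F>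
    using that(2,1)
  proof (induction \<F> rule: finite_induct)
    case empty
    then show ?case using subringE(2)[OF Z] by blast
  next
    case (insert M \<F>)
    then obtain x where x: "x \<in> Z" "\<And>M. M \<in> \<F> \<Longrightarrow> x \<ominus> c M \<in> M" by auto
    have MN: "M \<in> \<N>" using insert.prems by blast
    obtain e where e: "e \<in> Z" "e \<ominus> \<one> \<in> M" "\<And>M'. M' \<in> \<N> \<Longrightarrow> M' \<noteq> M \<Longrightarrow> e \<in> M'"
      using e[OF MN] by blast
    \<comment> \<open>Modulo \<open>M\<close> the factor \<open>e\<close> is 1 and \<open>y\<close>
      becomes \<open>c M\<close>; modulo the other ideals \<open>e\<close> is 0 and \<open>y\<close>
      stays \<open>x\<close>.\<close>
    define y where "y = x \<oplus> e \<otimes> (c M \<ominus> x)"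
    have cZ: "c M \<in> Z" using c MN by blast
    note [simp] = Zc[OF x(1)] Zc[OF e(1)] Zc[OF cZ]
    have "c M \<ominus> x \<in> Z"
      using subringE(5,7)[OF Z] x(1) cZ by (simp add: minus_eq)
    then have "y \<in> Z"
      unfolding y_def using subringE(6,7)[OF Z] x(1) e(1) by simp
    moreover have "y \<ominus> c M' \<in> M'" if M': "M' \<in> insert M \<F>" for M'
    proof (cases "M' = M")
      case True
      have "y \<ominus> c M = (e \<ominus> \<one>) \<otimes> (c M \<ominus> x)"
        unfolding y_def by (simp add: minus_eq l_distr r_distr l_minus r_minus minus_add a_ac)
      then show ?thesis using True ideal.I_r_closed[OF id[OF MN] e(2)] by simp
    next
      case False
      then have M'F: "M' \<in> \<F>" "M' \<in> \<N>" using M' insert.prems by auto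
      have cc: "c M' \<in> carrier R" using Zc c M'F by blast
      have "y \<ominus> c M' = (x \<ominus> c M') \<oplus> e \<otimes> (c M \<ominus> x)"
        unfolding y_def using cc by (simp add: minus_eq a_ac)
      moreover have "e \<otimes> (c M \<ominus> x) \<in> M'"
        using ideal.I_r_closed[OF id[OF M'F(2)] e(3)[OF M'F(2) False]] by simp
      ultimately show ?thesis
        using x(2)[OF M'F(1)] id[OF M'F(2)] by (simp add: additive_subgroup.a_closed ideal.axioms(1))
    qed
    ultimately show ?case by blast
  qed
  then show ?thesis using fin by blast
qed

text \<open>Each \<open>N\<close> in the family contains an element outside \<open>M\<close>. The
  product of these avoids \<open>M\<close>, which is prime, and lies in every \<open>N\<close>;
  multiplying by an inverse modulo \<open>M\<close> makes it congruent to 1.\<close>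

lemma (in cring) maximalideal_separating_element:
  assumes fin: "finite \<N>" and max: "\<And>M. M \<in> \<N> \<Longrightarrow> maximalideal M R"
    and M: "maximalideal M R" "M \<notin> \<N>" and finR: "finite (carrier R)"
  shows "\<exists>e\<in>carrier R. e \<ominus> \<one> \<in> M \<and> (\<forall>M'\<in>\<N>. e \<in> M')"
proof -
  interpret M: maximalideal M R by (rule M)
  interpret P: primeideal M R by (rule maximalideal_prime[OF M(1)])
  have oneM: "\<one> \<notin> M" using M.I_notcarr M.one_imp_carrier by blast
  have "\<exists>a\<in>carrier R. a \<notin> M \<and> (\<forall>M'\<in>\<N>. a \<in> M')"
    using fin max M(2)
  proof (induction \<N> rule: finite_induct)
    case empty
    then show ?case using oneM by auto
  next
    case (insert N \<N>)
    then obtain a where a: "a \<in> carrier R" "a \<notin> M" "\<And>M'. M' \<in> \<N> \<Longrightarrow> a \<in> M'" by auto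
    have N: "maximalideal N R" using insert.prems by blast
    have idN: "ideal N R" using N by (rule maximalideal.axioms(1))
    have "\<not> N \<subseteq> M"
      using maximalideal.I_maximal[OF N M.is_ideal] M.a_subset M.I_notcarr insert.prems(2) by blast
    then obtain b where b: "b \<in> N" "b \<notin> M" by blast
    have bc: "b \<in> carrier R" using b ideal.Icarr[OF idN] by blast
    have "a \<otimes> b \<notin> M" using P.I_prime[OF a(1) bc] a(2) b(2) by blast
    moreover have "a \<otimes> b \<in> M'" if "M' \<in> insert N \<N>" for M'
    proof (cases "M' = N")
      case True
      then show ?thesis using ideal.I_l_closed[OF idN b(1) a(1)] by simp
    next
      case False
      then have "M' \<in> \<N>" using that by blast
      then show ?thesis
        using ideal.I_r_closed[OF maximalideal.axioms(1) a(3) bc] insert.prems(1) by blast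
    qed
    ultimately show ?case using a bc by blast
  qed
  then obtain a where a: "a \<in> carrier R" "a \<notin> M" "\<And>M'. M' \<in> \<N> \<Longrightarrow> a \<in> M'" by auto
  interpret Q: field "R Quot M" by (rule M.quotient_is_field[OF is_cring])
  interpret h: ring_hom_cring R "R Quot M" "(+>) M" by (rule M.rcos_ring_hom_cring[OF is_cring])
  note car = carrier_FactRing[of R M]
  have "M +> a \<noteq> \<zero>\<^bsub>R Quot M\<^esub>" using M.rcos_const_imp_mem a(1,2) zero_FactRing by metis
  then have "M +> a \<in> Units (R Quot M)" unfolding Q.field_Units car using a(1) by blast
  then obtain b where b: "b \<in> carrier R" "(M +> a) \<otimes>\<^bsub>R Quot M\<^esub> (M +> b) = \<one>\<^bsub>R Quot M\<^esub>"
    unfolding Units_def car by blast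
  then have "M +> (a \<otimes> b) = M +> \<one>" using a(1) h.hom_mult h.hom_one by metis
  then have "a \<otimes> b \<ominus> \<one> \<in> M"
    using quotient_eq_iff_same_a_r_cos[OF M.is_ideal, of "a \<otimes> b" \<one>] a(1) b(1) by simp
  moreover have "a \<otimes> b \<in> M'" if "M' \<in> \<N>" for M'
    using ideal.I_r_closed[OF maximalideal.axioms(1)[OF max[OF that]] a(3)[OF that] b(1)] .
  ultimately show ?thesis using a(1) b(1) by blast
qed

lemma (in cring) pow_diff_in_ideal:
  assumes I: "ideal I R" and x: "x \<in> carrier R" "y \<in> carrier R" "x \<ominus> y \<in> I"
  shows "x [^] (k::nat) \<ominus> y [^] k \<in> I"
proof (induction k)
  case 0
  then show ?case using I by (simp add: r_neg minus_eq additive_subgroup.zero_closed ideal.axioms(1))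
next
  case (Suc k)
  have "x [^] Suc k \<ominus> y [^] Suc k = (x [^] k \<ominus> y [^] k) \<otimes> x \<oplus> y [^] k \<otimes> (x \<ominus> y)"
    using x by (simp add: minus_eq l_distr r_distr l_minus r_minus a_ac r_neg1 r_neg2 r_neg)
  then show ?case
    using ideal.I_r_closed[OF I Suc x(1)] ideal.I_l_closed[OF I x(3), of "y [^] k"] x
      additive_subgroup.a_closed[OF ideal.axioms(1)[OF I]] by simp
qed

section \<open>Small additive spanning sets and the number of maximal ideals\<close>

lemma (in cring) exists_small_spanning_subset:
  assumes p: "prime p" and ord: "order R = p ^ n" and H: "additive_subgroup H R" and X: "X \<subseteq> carrier R"
  obtains Y where "Y \<subseteq> X" "finite Y" "X \<subseteq> aspan R (H \<union> Y)"
    "p ^ card Y * card H \<le> card (aspan R (H \<union> Y))" "card Y \<le> n"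
  using add.exists_small_generating_subset[of p n H X] assms additive_subgroup.a_subgroup[OF H]
  by (auto simp: order_def)

lemma (in cring) exists_small_spanning_set:
  assumes p: "prime p" and ord: "order R = p ^ n" and H: "additive_subgroup H R"
  obtains Y where "Y \<subseteq> H" "finite Y" "H = aspan R Y" "card Y \<le> n"
proof -
  have zero: "additive_subgroup {\<zero>} R" by (rule additive_subgroupI') auto
  have Hc: "H \<subseteq> carrier R" using H by (rule additive_subgroup.a_subset)
  obtain Y where Y: "Y \<subseteq> H" "finite Y" "H \<subseteq> aspan R ({\<zero>} \<union> Y)" "card Y \<le> n"
    using exists_small_spanning_subset[OF p ord zero Hc] by metis
  have sub: "additive_subgroup (aspan R Y) R" using Y(1) Hc by (intro additive_subgroup_aspan) blast
  have "aspan R ({\<zero>} \<union> Y) \<subseteq> aspan R Y"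
    using aspan_superset[of Y R] sub by (intro aspan_least) (auto simp: additive_subgroup.zero_closed)
  moreover have "aspan R Y \<subseteq> H" by (rule aspan_least[OF Y(1) H])
  ultimately show ?thesis using that[of Y] Y by blast
qed

lemma (in cring) minus_minus_cancel_right:
  assumes "x \<in> carrier R" "y \<in> carrier R" "c \<in> carrier R"
  shows "(x \<ominus> c) \<ominus> (y \<ominus> c) = x \<ominus> y"
  using assms by (simp add: minus_eq minus_add a_assoc a_comm[of "\<ominus> y" c] r_neg1)

lemma (in cring) maximalideal_not_in:
  assumes "maximalideal M R" "x \<in> carrier R" "x \<ominus> \<one> \<in> M"
  shows "x \<notin> M"
proof
  assume "x \<in> M"
  have sub: "additive_subgroup M R"
    using assms(1) maximalideal.axioms(1) ideal.axioms(1) by blast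
  have "x \<ominus> (x \<ominus> \<one>) \<in> M" by (rule additive_subgroup_minus_closed[OF sub \<open>x \<in> M\<close> assms(3)])
  moreover have "x \<ominus> (x \<ominus> \<one>) = \<one>" using assms(2) by (simp add: minus_eq minus_add r_neg2)
  ultimately show False
    using ideal.one_imp_carrier maximalideal.I_notcarr maximalideal.axioms(1) assms(1) by metis
qed

text \<open>Separating elements \<open>e M\<close> are additively independent in the following
  sense: a subset \<open>Y\<close> of them without \<open>e M\<close> lies in \<open>M\<close>, so
  its span cannot contain \<open>e M\<close>. Hence a spanning subset of size at most
  \<open>n\<close> contains all of them.\<close>

lemma (in cring) card_maximalideals_le:
  assumes p: "prime p" and ord: "order R = p ^ n" and fin: "finite (carrier R)"
  shows "finite {M. maximalideal M R}" "card {M. maximalideal M R} \<le> n"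
proof -
  let ?\<M> = "{M. maximalideal M R}"
  have "?\<M> \<subseteq> Pow (carrier R)"
    using maximalideal.axioms(1) ideal.Icarr by fastforce
  then show finM: "finite ?\<M>" using fin by (meson finite_Pow_iff finite_subset)
  have "\<exists>e\<in>carrier R. e \<ominus> \<one> \<in> M \<and> (\<forall>M'\<in>?\<M> - {M}. e \<in> M')" if "M \<in> ?\<M>" for M
    using that finM fin by (intro maximalideal_separating_element) auto
  then have "\<forall>M\<in>?\<M>. \<exists>e. e \<in> carrier R \<and> e \<ominus> \<one> \<in> M \<and> (\<forall>M'\<in>?\<M> - {M}. e \<in> M')"
    by (metis (no_types, lifting))
  from bchoice[OF this] obtain e where e: "\<And>M. M \<in> ?\<M> \<Longrightarrow> e M \<in> carrier R" "\<And>M. M \<in> ?\<M> \<Longrightarrow> e M \<ominus> \<one> \<in> M"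
    "\<And>M M'. M \<in> ?\<M> \<Longrightarrow> M' \<in> ?\<M> \<Longrightarrow> M' \<noteq> M \<Longrightarrow> e M \<in> M'" by blast
  have zero: "additive_subgroup {\<zero>} R" by (rule additive_subgroupI') auto
  have sub: "additive_subgroup M R" if "M \<in> ?\<M>" for M
    using that maximalideal.axioms(1) ideal.axioms(1) by blast
  have ec: "e ` ?\<M> \<subseteq> carrier R" using e(1) by blast
  have ne: "e M \<notin> M" if "M \<in> ?\<M>" for M using maximalideal_not_in e that by blast
  obtain Y where Y: "Y \<subseteq> e ` ?\<M>" "e ` ?\<M> \<subseteq> aspan R ({\<zero>} \<union> Y)" "card Y \<le> n"
    using exists_small_spanning_subset[OF p ord zero ec] by metis
  have "e M \<in> Y" if M: "M \<in> ?\<M>" for M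
  proof (rule ccontr)
    assume nY: "e M \<notin> Y"
    have "aspan R ({\<zero>} \<union> Y) \<subseteq> M"
    proof (rule aspan_least[OF _ sub[OF M]])
      have "y \<in> M" if "y \<in> Y" for y
      proof -
        obtain N where N: "N \<in> ?\<M>" "y = e N" using \<open>y \<in> Y\<close> Y(1) by blast
        then have "N \<noteq> M" using nY \<open>y \<in> Y\<close> by blast
        then show ?thesis using e(3)[OF N(1) M] N(2) by blast
      qed
      then show "{\<zero>} \<union> Y \<subseteq> M" using additive_subgroup.zero_closed[OF sub[OF M]] by blast
    qed
    then show False using Y(2) M ne by blast
  qed
  then have "e ` ?\<M> = Y" using Y(1) by blast
  moreover have "inj_on e ?\<M>" by (rule inj_onI) (metis e(3) ne)
  ultimately show "card ?\<M> \<le> n" using Y(3) card_image by metis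
qed

text \<open>Idempotents indexed by the binary digits of a numbering of the residue fields separate the
  fields, and one further element generates all of them at once.\<close>

lemma (in cring) exists_few_generators:
  assumes p: "prime p" and ord: "order R = p ^ n" and fin: "finite (carrier R)" and nk: "n \<le> 2 ^ k"
  obtains J T where "ideal J R" "\<And>x. x \<in> J \<Longrightarrow> \<exists>k::nat. x [^] k = \<zero>"
    "T \<subseteq> carrier R" "finite T" "card T \<le> k + 2" "\<one> \<in> T"
    "\<And>Z. subring Z R \<Longrightarrow> T \<subseteq> Z \<Longrightarrow> J \<subseteq> Z \<Longrightarrow> Z = carrier R"
proof -
  define \<M> where "\<M> = {M. maximalideal M R}"
  have finM: "finite \<M>" and cardM: "card \<M> \<le> n"
    using card_maximalideals_le[OF p ord fin] unfolding \<M>_def by auto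
  have max: "maximalideal M R" if "M \<in> \<M>" for M using that unfolding \<M>_def by blast
  have id: "ideal M R" if "M \<in> \<M>" for M using max[OF that] by (rule maximalideal.axioms(1))
  have sub: "additive_subgroup M R" if "M \<in> \<M>" for M using id[OF that] by (rule ideal.axioms(1))
  \<comment> \<open>Including the carrier keeps the intersection inside \<open>R\<close> even when
    there is no maximal ideal, as in the zero ring.\<close>
  define J where "J = \<Inter>(insert (carrier R) \<M>)"
  have J: "ideal J R" unfolding J_def using id oneideal by (intro i_Intersect) auto
  have nil: "\<exists>k::nat. x [^] k = \<zero>" if "x \<in> J" for x
    using that unfolding J_def \<M>_def by (intro nilpotent_if_in_all_maximalideals[OF fin]) auto
  have "card \<M> \<le> card (Pow {..<k})" using cardM nk by (simp add: card_Pow)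
  \<comment> \<open>\<open>f M\<close> is the set of positions of the binary digits 1 in the label
    of \<open>M\<close>; \<open>k\<close> digits suffice for \<open>n\<close> labels.\<close>
  then obtain f where f: "f ` \<M> \<subseteq> Pow {..<k}" "inj_on f \<M>"
    using card_le_inj[OF finM, of "Pow {..<k}"] by auto
  have sep: "\<exists>e\<in>carrier R. e \<ominus> \<one> \<in> M \<and> (\<forall>M'\<in>\<M>. M' \<noteq> M \<longrightarrow> e \<in> M')" if "M \<in> \<M>" for M
    using maximalideal_separating_element[of "\<M> - {M}" M] finM fin max that by auto
  have crt: "\<exists>x\<in>carrier R. \<forall>M\<in>\<M>. x \<ominus> c M \<in> M" if "\<And>M. M \<in> \<M> \<Longrightarrow> c M \<in> carrier R" for c
    using chinese_remainder_in_subring[OF carrier_is_subring finM id sep, of c] that by blast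
  have "\<exists>x\<in>carrier R. \<forall>M\<in>\<M>. x \<ominus> (if b \<in> f M then \<one> else \<zero>) \<in> M" for b
    by (rule crt) auto
  then obtain E where E: "\<And>b. E b \<in> carrier R"
    "\<And>b M. M \<in> \<M> \<Longrightarrow> E b \<ominus> (if b \<in> f M then \<one> else \<zero>) \<in> M" by metis
  have E1: "E b \<ominus> \<one> \<in> M" if "M \<in> \<M>" "b \<in> f M" for b M using E(2)[OF that(1), of b] that by simp
  have E0: "E b \<in> M" if "M \<in> \<M>" "b \<notin> f M" for b M
    using E(2)[OF that(1), of b] that E(1) by (simp add: minus_eq)
  have "\<exists>g. \<forall>M\<in>\<M>. g M \<in> carrier R \<and> (\<forall>x\<in>carrier R. x \<notin> M \<longrightarrow> (\<exists>k::nat. x \<ominus> g M [^] k \<in> M))"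
    using residue_field_generator[OF fin max] by (intro bchoice) blast
  then obtain g where g: "\<And>M. M \<in> \<M> \<Longrightarrow> g M \<in> carrier R"
    "\<And>M x. M \<in> \<M> \<Longrightarrow> x \<in> carrier R \<Longrightarrow> x \<notin> M \<Longrightarrow> \<exists>k::nat. x \<ominus> g M [^] k \<in> M" by blast
  obtain z where z: "z \<in> carrier R" "\<And>M. M \<in> \<M> \<Longrightarrow> z \<ominus> g M \<in> M" using crt[of g] g(1) by blast
  define T where "T = insert \<one> (insert z (E ` {..<k}))"
  have "card T \<le> k + 2"
  proof -
    have "card (insert \<one> (insert z (E ` {..<k}))) \<le> Suc (Suc (card (E ` {..<k})))"
      by (metis (no_types) card_insert_le_m1 diff_Suc_1 finite_imageI finite_insert finite_lessThan
          le_SucI card_insert_if le_refl)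
    also have "\<dots> \<le> k + 2" using card_image_le[of "{..<k}" E] by simp
    finally show ?thesis unfolding T_def .
  qed
  moreover have "T \<subseteq> carrier R" unfolding T_def using z(1) E(1) by auto
  moreover have "Z = carrier R" if Z: "subring Z R" "T \<subseteq> Z" "J \<subseteq> Z" for Z
  proof
    note Zc = subringE(1)[OF Z(1)]
    show "Z \<subseteq> carrier R" by (rule Zc)
    have zZ: "z \<in> Z" and EZ: "\<And>b. b < k \<Longrightarrow> E b \<in> Z" using Z(2) unfolding T_def by auto
    \<comment> \<open>The element is the product over \<open>b < j\<close> of \<open>E b\<close> or
      \<open>1 - E b\<close>, according to the digit of \<open>M\<close> at \<open>b\<close>. Each
      factor is 1 modulo \<open>M\<close> and 0 modulo every \<open>M'\<close> with a different
      digit there.\<close>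
    have eps: "\<exists>e\<in>Z. e \<ominus> \<one> \<in> M \<and> (\<forall>M'\<in>\<M>. (\<exists>b<j. (b \<in> f M) \<noteq> (b \<in> f M')) \<longrightarrow> e \<in> M')"
      if M: "M \<in> \<M>" and "j \<le> k" for M j
      using that(2)
    proof (induction j)
      case 0
      show ?case using subringE(3)[OF Z(1)] additive_subgroup.zero_closed[OF sub[OF M]]
        by (intro bexI[of _ \<one>]) (auto simp: minus_eq r_neg)
    next
      case (Suc j)
      then obtain e where e: "e \<in> Z" "e \<ominus> \<one> \<in> M"
        "\<And>M' b. M' \<in> \<M> \<Longrightarrow> b < j \<Longrightarrow> (b \<in> f M) \<noteq> (b \<in> f M') \<Longrightarrow> e \<in> M'" by (metis Suc_leD)
      define F where "F = (if j \<in> f M then E j else \<one> \<ominus> E j)"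
      have FZ: "F \<in> Z" unfolding F_def using EZ[of j] Suc.prems subringE(3,5,7)[OF Z(1)]
        by (auto simp: minus_eq)
      have FM: "F \<ominus> \<one> \<in> M"
      proof (cases "j \<in> f M")
        case True
        then show ?thesis unfolding F_def using E1[OF M] by simp
      next
        case False
        then have "F \<ominus> \<one> = \<ominus> E j" unfolding F_def using E(1)[of j] 
          by (simp add: minus_eq a_assoc a_comm[of "\<ominus> E j" "\<ominus> \<one>"] r_neg2)
        then show ?thesis using additive_subgroup.a_inv_closed[OF sub[OF M] E0[OF M False]] by simp
      qed
      have FM': "F \<in> M'" if M': "M' \<in> \<M>" "(j \<in> f M) \<noteq> (j \<in> f M')" for M'
      proof (cases "j \<in> f M")
        case True
        then show ?thesis unfolding F_def using E0[OF M'(1)] M'(2) by simp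
      next
        case False
        then have "E j \<ominus> \<one> \<in> M'" using E1[OF M'(1)] M'(2) by simp
        then have "\<ominus> (E j \<ominus> \<one>) \<in> M'" by (rule additive_subgroup.a_inv_closed[OF sub[OF M'(1)]])
        moreover have "\<ominus> (E j \<ominus> \<one>) = \<one> \<ominus> E j" using E(1)[of j] by (simp add: minus_eq minus_add a_comm)
        ultimately show ?thesis unfolding F_def using False by simp
      qed
      have ec: "e \<in> carrier R" and Fc: "F \<in> carrier R" using e(1) FZ Zc by auto
      have "e \<otimes> F \<in> Z" by (rule subringE(6)[OF Z(1) e(1) FZ])
      moreover have "e \<otimes> F \<ominus> \<one> \<in> M"
      proof -
        have "e \<otimes> F \<ominus> \<one> = e \<otimes> (F \<ominus> \<one>) \<oplus> (e \<ominus> \<one>)"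
          using ec Fc by (simp add: minus_eq r_distr r_minus a_ac r_neg1 r_neg2)
        then show ?thesis
          using ideal.I_l_closed[OF id[OF M] FM ec] additive_subgroup.a_closed[OF sub[OF M]] e(2) by simp
      qed
      moreover have "e \<otimes> F \<in> M'" if M': "M' \<in> \<M>" "\<exists>b<Suc j. (b \<in> f M) \<noteq> (b \<in> f M')" for M'
      proof -
        obtain b where b: "b < Suc j" "(b \<in> f M) \<noteq> (b \<in> f M')" using M'(2) by blast
        show ?thesis
        proof (cases "b = j")
          case True
          then show ?thesis using ideal.I_l_closed[OF id[OF M'(1)] FM'[OF M'(1)] ec] b(2) by simp
        next
          case False
          then show ?thesis using ideal.I_r_closed[OF id[OF M'(1)] e(3)[OF M'(1) _ b(2)] Fc] b(1) by simp
        qed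
      qed
      ultimately show ?case by blast
    qed
    have eps': "\<exists>e\<in>Z. e \<ominus> \<one> \<in> M \<and> (\<forall>M'\<in>\<M>. M' \<noteq> M \<longrightarrow> e \<in> M')" if M: "M \<in> \<M>" for M
    proof -
      have "\<exists>b<k. (b \<in> f M) \<noteq> (b \<in> f M')" if "M' \<in> \<M>" "M' \<noteq> M" for M'
      proof -
        have "f M \<noteq> f M'" using f(2) M that by (metis inj_on_contraD)
        moreover have "f M \<subseteq> {..<k}" "f M' \<subseteq> {..<k}" using f(1) M that(1) by auto
        ultimately show ?thesis by blast
      qed
      then show ?thesis using eps[OF M le_refl] by metis
    qed
    show "carrier R \<subseteq> Z"
    proof
      fix x assume x: "x \<in> carrier R"
      have powZ: "z [^] (k::nat) \<in> Z" for k
        by (induction k) (use subringE(3,6)[OF Z(1)] zZ in auto)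
      \<comment> \<open>Modulo \<open>M\<close> every element is 0 or a power of \<open>g M\<close>,
        and \<open>z\<close> represents all the \<open>g M\<close> at once. Gluing these residues
        inside \<open>Z\<close> approximates \<open>x\<close> up to an element of \<open>J\<close>,
        which \<open>Z\<close> contains.\<close>
      have "\<exists>c\<in>Z. x \<ominus> c \<in> M" if M: "M \<in> \<M>" for M
      proof (cases "x \<in> M")
        case True
        then show ?thesis using subringE(2)[OF Z(1)] x by (intro bexI[of _ \<zero>]) (auto simp: minus_eq)
      next
        case False
        then obtain k :: nat where k: "x \<ominus> g M [^] k \<in> M" using g(2)[OF M x] by blast
        have "z [^] k \<ominus> g M [^] k \<in> M"
          by (rule pow_diff_in_ideal[OF id[OF M] z(1) g(1)[OF M] z(2)[OF M]])
        then have "(x \<ominus> g M [^] k) \<ominus> (z [^] k \<ominus> g M [^] k) \<in> M"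
          using additive_subgroup_minus_closed[OF sub[OF M] k] by blast
        moreover have "(x \<ominus> g M [^] k) \<ominus> (z [^] k \<ominus> g M [^] k) = x \<ominus> z [^] k"
          using x z(1) g(1)[OF M] by (simp add: minus_minus_cancel_right)
        ultimately show ?thesis using powZ by metis
      qed
      then obtain c where c: "\<And>M. M \<in> \<M> \<Longrightarrow> c M \<in> Z" "\<And>M. M \<in> \<M> \<Longrightarrow> x \<ominus> c M \<in> M" by metis
      obtain y where y: "y \<in> Z" "\<And>M. M \<in> \<M> \<Longrightarrow> y \<ominus> c M \<in> M"
        using chinese_remainder_in_subring[OF Z(1) finM id eps', of c] c(1) by blast
      have yc: "y \<in> carrier R" using y(1) Zc by blast
      have "x \<ominus> y \<in> M" if M: "M \<in> \<M>" for M
      proof -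
        have "c M \<in> carrier R" using c(1)[OF M] Zc by blast
        then have "x \<ominus> y = (x \<ominus> c M) \<ominus> (y \<ominus> c M)"
          using x yc by (simp add: minus_minus_cancel_right)
        then show ?thesis using additive_subgroup_minus_closed[OF sub[OF M] c(2)[OF M] y(2)[OF M]] by simp
      qed
      then have "x \<ominus> y \<in> Z" using Z(3) x yc unfolding J_def by auto
      then have "(x \<ominus> y) \<oplus> y \<in> Z" using y(1) by (rule subringE(7)[OF Z(1)])
      then show "x \<in> Z" using x yc by (simp add: minus_eq a_assoc l_neg)
    qed
  qed
  ultimately show ?thesis using that[of J T] J nil unfolding T_def by blast
qed

section \<open>Short descriptions of the multiplication\<close>

text \<open>A form of Nakayama's lemma, by descending induction from the vanishing power. In a
  product from a power of \<open>J\<close>, write the first factor through \<open>X\<close> and the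
  square of \<open>J\<close>: the \<open>X\<close> part gives elements \<open>x b\<close>, the rest
  falls into the next power.\<close>

lemma (in cring) nilpotent_ideal_generators:
  assumes J: "ideal J R" and nil: "jpow R J m = {\<zero>}"
    and X: "X \<subseteq> J" "J \<subseteq> aspan R (jpow R J 1 \<union> X)"
  shows "J \<subseteq> aspan R (X \<union> {x \<otimes> b | x b. x \<in> X \<and> b \<in> J})"
proof -
  define N where "N = aspan R (X \<union> {x \<otimes> b | x b. x \<in> X \<and> b \<in> J})"
  have Jc: "x \<in> carrier R" if "x \<in> J" for x using ideal.Icarr[OF J that] .
  have XB: "X \<union> {x \<otimes> b | x b. x \<in> X \<and> b \<in> J} \<subseteq> carrier R" using X(1) Jc by auto
  have N: "additive_subgroup N R" unfolding N_def by (rule additive_subgroup_aspan[OF XB])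
  have XN: "x \<in> N" if "x \<in> X" for x
    using that aspan_superset[of _ R] unfolding N_def by blast
  have XbN: "x \<otimes> b \<in> N" if "x \<in> X" "b \<in> J" for x b
    using that aspan_superset[of "X \<union> {x \<otimes> b | x b. x \<in> X \<and> b \<in> J}" R] unfolding N_def by blast
  have idk: "ideal (jpow R J k) R" for k by (rule ideal_jpow[OF J])
  have jc: "x \<in> carrier R" if "x \<in> jpow R J k" for x k using ideal.Icarr[OF idk that] .
  have jJ: "jpow R J k \<subseteq> J" for k
    by (induction k) (use jpow_Suc_subset[OF J] in \<open>simp, blast\<close>)
  have pre: "additive_subgroup {a \<in> carrier R. a \<otimes> b \<in> H} R"
    if "additive_subgroup H R" "b \<in> carrier R" for H b
    by (rule additive_subgroupI')
       (use that in \<open>auto simp: l_minus l_distr additive_subgroup.zero_closed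
          additive_subgroup.a_closed additive_subgroup.a_inv_closed\<close>)
  have step: "jpow R J k \<subseteq> N" if IH: "jpow R J (Suc k) \<subseteq> N" for k
  proof (cases k)
    case 0
    have "J \<subseteq> N" using X(2) aspan_least[OF _ N, of "jpow R J 1 \<union> X"] IH XN 0 by auto
    then show ?thesis using 0 by simp
  next
    case (Suc j)
    show ?thesis unfolding Suc jpow.simps
    proof (rule ideal_prod_least[OF N])
      fix a b assume a: "a \<in> J" and b: "b \<in> jpow R J j"
      have bc: "b \<in> carrier R" using b jc by blast
      \<comment> \<open>With the index shift, \<open>c\<close> has degree 2 and \<open>b\<close>
        degree \<open>j + 1\<close>, so the product has degree \<open>j + 3 = k + 2\<close>, which
        is what \<open>jpow R J (Suc k)\<close> stands for.\<close>
      have up: "c \<otimes> b \<in> jpow R J (Suc k)" if "c \<in> jpow R J 1" for c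
      proof -
        have "J \<cdot> J \<subseteq> {a \<in> carrier R. a \<otimes> b \<in> jpow R J (Suc k)}"
        proof (rule ideal_prod_least[OF pre[OF ideal.axioms(1)[OF idk] bc]])
          fix d e assume d: "d \<in> J" and e: "e \<in> J"
          have "e \<otimes> b \<in> jpow R J k" unfolding Suc using ideal_prod.prod[OF e b] by simp
          then have "d \<otimes> (e \<otimes> b) \<in> jpow R J (Suc k)" using ideal_prod.prod[OF d] by simp
          then show "d \<otimes> e \<in> {a \<in> carrier R. a \<otimes> b \<in> jpow R J (Suc k)}"
            using Jc[OF d] Jc[OF e] bc by (simp add: m_assoc)
        qed
        then show ?thesis using that by auto
      qed
      have "aspan R (jpow R J 1 \<union> X) \<subseteq> {a \<in> carrier R. a \<otimes> b \<in> N}"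
      proof (rule aspan_least[OF _ pre[OF N bc]])
        have "c \<otimes> b \<in> N" "c \<in> carrier R" if "c \<in> jpow R J 1" for c
          using up[OF that] IH jc[OF that] by auto
        moreover have "x \<otimes> b \<in> N" "x \<in> carrier R" if "x \<in> X" for x
          using XbN that b jJ X(1) Jc by auto
        ultimately show "jpow R J 1 \<union> X \<subseteq> {a \<in> carrier R. a \<otimes> b \<in> N}" by blast
      qed
      then show "a \<otimes> b \<in> N" using X(2) a by blast
    qed
  qed
  have "jpow R J (m - i) \<subseteq> N" for i
  proof (induction i)
    case 0
    show ?case using nil additive_subgroup.zero_closed[OF N] by simp
  next
    case (Suc i)
    show ?case
    proof (cases "i < m")
      case True
      then have "Suc (m - Suc i) = m - i" by simp
      then show ?thesis using step[of "m - Suc i"] Suc by simp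
    qed (use Suc in simp)
  qed
  from this[of m] show ?thesis unfolding N_def by simp
qed

lemma card_UN_le_mult:
  assumes "finite I" "card I \<le> n" "\<And>i. i \<in> I \<Longrightarrow> card (A i) \<le> t"
  shows "card (\<Union>i\<in>I. A i) \<le> n * t"
proof -
  have "card (\<Union>i\<in>I. A i) \<le> (\<Sum>i\<in>I. card (A i))" by (rule card_UN_le[OF assms(1)])
  also have "\<dots> \<le> card I * t" using sum_bounded_above[of I "\<lambda>i. card (A i)" t] assms(3) by simp
  also have "\<dots> \<le> n * t" using assms(2) by simp
  finally show ?thesis .
qed

text \<open>\<open>S\<close> is chosen greedily: each element multiplies the order of \<open>S J\<close> by at least
  \<open>p\<^sup>t\<close>, so \<open>S\<close> is small, and afterwards every multiplication map has small rank modulo \<open>S J\<close>.\<close>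

lemma (in cring) exists_absorbing_set:
  assumes p: "prime p" and ord: "order R = p ^ n" and fin: "finite (carrier R)"
    and J: "ideal J R" and nt: "n \<le> t * t" and t: "0 < t"
  defines "W \<equiv> \<lambda>S. aspan R {s \<otimes> c | s c. s \<in> S \<and> c \<in> J}"
  shows "\<exists>S. S \<subseteq> J \<and> finite S \<and> card S \<le> t \<and>
    (\<forall>X\<subseteq>J. \<forall>x\<in>J. \<exists>Y\<subseteq>X. finite Y \<and> card Y \<le> t \<and>
       aspan R X \<subseteq> aspan R (Y \<union> {v \<in> aspan R X. x \<otimes> v \<in> W S}))"
proof -
  have Jc: "x \<in> carrier R" if "x \<in> J" for x using ideal.Icarr[OF J that] .
  have finJ: "finite J" using finite_subset[OF _ fin, of J] Jc by blast
  have Wsub: "additive_subgroup (W S) R" if "S \<subseteq> J" for S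
    unfolding W_def using that Jc by (intro additive_subgroup_aspan) auto
  have Wc: "W S \<subseteq> carrier R" if "S \<subseteq> J" for S
    using additive_subgroup.a_subset[OF Wsub[OF that]] .
  have Wpos: "1 \<le> card (W S)" if "S \<subseteq> J" for S
    using additive_subgroup.zero_closed[OF Wsub[OF that]] finite_subset[OF Wc[OF that] fin]
    by (metis One_nat_def Suc_leI card_gt_0_iff empty_iff)
  \<comment> \<open>Membership forces \<open>t * card S\<close> to be at most \<open>n\<close>,
    hence at most \<open>t * t\<close>; this bounds the greedy choice by \<open>t\<close>
    elements.\<close>
  let ?F = "{S. S \<subseteq> J \<and> p ^ (t * card S) \<le> card (W S)}"
  have "{} \<in> ?F" using Wpos[of "{}"] by simp
  moreover have "finite ?F" by (rule finite_subset[of _ "Pow J"]) (use finJ in auto)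
  ultimately obtain S where S: "S \<in> ?F" and max: "\<forall>Z\<in>?F. card Z \<le> card S"
    using finite_has_greatest_nat[of ?F card] by blast
  have SJ: "S \<subseteq> J" using S by blast
  have finS: "finite S" using SJ finJ finite_subset by blast
  have p1: "1 < p" using prime_gt_1_nat[OF p] .
  have "p ^ (t * card S) \<le> p ^ n"
    using S card_mono[OF fin Wc[OF SJ]] ord unfolding order_def by auto
  then have "t * card S \<le> n" using power_le_imp_le_exp p1 by blast
  then have "t * card S \<le> t * t" using nt by linarith
  then have cardS: "card S \<le> t" using t by simp
  have grow: "card (W (insert x S)) < p ^ t * card (W S)" if x: "x \<in> J" for x
  proof (cases "x \<in> S")
    case True
    have "1 < p ^ t" by (rule one_less_power[OF p1 t])
    then show ?thesis using Wpos[OF SJ] True by (simp add: insert_absorb)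
  next
    case False
    then have ci: "card (insert x S) = Suc (card S)" using finS by simp
    have "insert x S \<notin> ?F"
    proof
      assume "insert x S \<in> ?F"
      from bspec[OF max this] show False unfolding ci by simp
    qed
    moreover have "insert x S \<subseteq> J" using x SJ by blast
    ultimately have "card (W (insert x S)) < p ^ (t * Suc (card S))" unfolding mem_Collect_eq ci by simp
    also have "\<dots> = p ^ t * p ^ (t * card S)" by (simp add: power_add)
    also have "\<dots> \<le> p ^ t * card (W S)" using S by simp
    finally show ?thesis .
  qed
  have main: "\<exists>Y\<subseteq>X. finite Y \<and> card Y \<le> t \<and> aspan R X \<subseteq> aspan R (Y \<union> {v \<in> aspan R X. x \<otimes> v \<in> W S})"
    if XJ: "X \<subseteq> J" and x: "x \<in> J" for X x
  proof -
    have xX: "(\<otimes>) x ` X \<subseteq> carrier R" using XJ x Jc by auto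
    \<comment> \<open>\<open>card Z\<close> bounds the rank of multiplication by \<open>x\<close> on
      the span of \<open>X\<close> modulo \<open>W S\<close>. By \<open>grow\<close>, adjoining
      \<open>x\<close> to \<open>S\<close> multiplies the order by less than \<open>p ^ t\<close>,
      so this rank is below \<open>t\<close>; \<open>Y\<close> consists of preimages of
      \<open>Z\<close>.\<close>
    obtain Z where Z: "Z \<subseteq> (\<otimes>) x ` X" "finite Z" "(\<otimes>) x ` X \<subseteq> aspan R (W S \<union> Z)"
      "p ^ card Z * card (W S) \<le> card (aspan R (W S \<union> Z))"
      using exists_small_spanning_subset[OF p ord Wsub[OF SJ] xX] by metis
    obtain Y where Y: "Y \<subseteq> X" "inj_on ((\<otimes>) x) Y" "Z = (\<otimes>) x ` Y"
      using subset_image_inj[of Z "(\<otimes>) x" X] Z(1) by metis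
    have finY: "finite Y" using Y Z(2) finite_imageD by blast
    have cYZ: "card Y = card Z" using Y card_image by metis
    have "aspan R (W S \<union> Z) \<subseteq> W (insert x S)"
    proof (rule aspan_least[OF _ Wsub])
      have "W S \<subseteq> W (insert x S)" unfolding W_def by (intro add.mono_generate) blast
      moreover have "Z \<subseteq> W (insert x S)"
        using Y XJ aspan_superset[of "{s \<otimes> c | s c. s \<in> insert x S \<and> c \<in> J}" R] unfolding W_def by blast
      ultimately show "W S \<union> Z \<subseteq> W (insert x S)" by blast
      show "insert x S \<subseteq> J" using x SJ by blast
    qed
    then have "card (aspan R (W S \<union> Z)) \<le> card (W (insert x S))"
      using finite_subset[OF Wc fin] x SJ by (intro card_mono) auto
    then have "p ^ card Z * card (W S) < p ^ t * card (W S)" using Z(4) grow[OF x] by linarith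
    then have "p ^ card Z < p ^ t" by simp
    then have "card Z < t" using p1 power_less_imp_less_exp by blast
    let ?V = "aspan R X"
    let ?K = "{v \<in> ?V. x \<otimes> v \<in> W S}"
    have Xc: "X \<subseteq> carrier R" using XJ Jc by blast
    have V: "additive_subgroup ?V R" by (rule additive_subgroup_aspan[OF Xc])
    have Vc: "?V \<subseteq> carrier R" using additive_subgroup.a_subset[OF V] .
    have YK: "Y \<union> ?K \<subseteq> carrier R" using Y(1) Xc Vc by blast
    have Yc: "Y \<subseteq> carrier R" using Y(1) Xc by blast
    have aY: "additive_subgroup (aspan R Y) R" by (rule additive_subgroup_aspan[OF Yc])
    have aYc: "aspan R Y \<subseteq> carrier R" using additive_subgroup.a_subset[OF aY] .
    have xc: "x \<in> carrier R" using x Jc by blast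
    have aYV: "aspan R Y \<subseteq> ?V" by (rule add.mono_generate[OF Y(1)])
    have sub: "additive_subgroup (aspan R (Y \<union> ?K)) R" by (rule additive_subgroup_aspan[OF YK])
    note Wcl = additive_subgroup.a_closed[OF Wsub[OF SJ]] additive_subgroup.zero_closed[OF Wsub[OF SJ]]
      additive_subgroup.a_inv_closed[OF Wsub[OF SJ]]
    note aYcl = additive_subgroup.a_closed[OF aY] additive_subgroup.zero_closed[OF aY]
      additive_subgroup.a_inv_closed[OF aY]
    \<comment> \<open>The elements congruent modulo \<open>W S\<close> to \<open>x\<close> times an
      element of the span of \<open>Y\<close>. This subgroup contains \<open>x v\<close> for every
      \<open>v\<close> in \<open>X\<close>, so \<open>v\<close> differs from an element of the span
      of \<open>Y\<close> by one that \<open>x\<close> sends into \<open>W S\<close>.\<close>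
    define D where "D = {a \<in> carrier R. \<exists>y\<in>aspan R Y. a \<ominus> x \<otimes> y \<in> W S}"
    have DI: "a \<in> D" if "a \<in> carrier R" "y \<in> aspan R Y" "a \<ominus> x \<otimes> y \<in> W S" for a y
      using that unfolding D_def by blast
    have D: "additive_subgroup D R"
    proof (rule additive_subgroupI')
      show "D \<subseteq> carrier R" unfolding D_def by blast
      show "\<zero> \<in> D" by (rule DI[of _ \<zero>]) (use Wcl aYcl xc in \<open>simp_all add: minus_eq\<close>)
    next
      fix a assume "a \<in> D"
      then obtain y where a: "a \<in> carrier R" "y \<in> aspan R Y" "a \<ominus> x \<otimes> y \<in> W S" unfolding D_def by blast
      have yc: "y \<in> carrier R" using a(2) aYc by blast
      have "\<ominus> a \<ominus> x \<otimes> (\<ominus> y) = \<ominus> (a \<ominus> x \<otimes> y)" using a(1) yc xc by (simp add: minus_eq r_minus minus_add)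
      then show "\<ominus> a \<in> D" using Wcl(3)[OF a(3)] aYcl(3)[OF a(2)] a(1) by (intro DI[of _ "\<ominus> y"]) auto
    next
      fix a b assume "a \<in> D" "b \<in> D"
      then obtain y z where a: "a \<in> carrier R" "y \<in> aspan R Y" "a \<ominus> x \<otimes> y \<in> W S"
        and b: "b \<in> carrier R" "z \<in> aspan R Y" "b \<ominus> x \<otimes> z \<in> W S" unfolding D_def by blast
      have yc: "y \<in> carrier R" "z \<in> carrier R" using a(2) b(2) aYc by auto
      have "(a \<oplus> b) \<ominus> x \<otimes> (y \<oplus> z) = (a \<ominus> x \<otimes> y) \<oplus> (b \<ominus> x \<otimes> z)"
        using a(1) b(1) yc xc by (simp add: minus_eq r_distr minus_add a_ac)
      then show "a \<oplus> b \<in> D"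
        using Wcl(1)[OF a(3) b(3)] aYcl(1)[OF a(2) b(2)] a(1) b(1) by (intro DI[of _ "y \<oplus> z"]) auto
    qed
    have WZD: "aspan R (W S \<union> Z) \<subseteq> D"
    proof (rule aspan_least[OF _ D])
      have "w \<in> D" if "w \<in> W S" for w
        by (rule DI[of _ \<zero>]) (use that Wc[OF SJ] aYcl xc in \<open>auto simp: minus_eq\<close>)
      moreover have "x \<otimes> y \<in> D" if "y \<in> Y" for y
        by (rule DI[of _ y])
           (use that Yc aspan_superset[of Y R] xc Wcl in \<open>auto simp: minus_eq r_neg subset_iff\<close>)
      ultimately show "W S \<union> Z \<subseteq> D" using Y(3) by blast
    qed
    have "X \<subseteq> aspan R (Y \<union> ?K)"
    proof
      fix v assume v: "v \<in> X"
      then have "x \<otimes> v \<in> D" using Z(3) WZD by blast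
      then obtain y where y: "y \<in> aspan R Y" "x \<otimes> v \<ominus> x \<otimes> y \<in> W S" unfolding D_def by blast
      have c: "v \<in> carrier R" "y \<in> carrier R" using v Xc y(1) aYc by auto
      have vV: "v \<in> ?V" using v aspan_superset[of X R] by blast
      have "v \<ominus> y \<in> ?V" using additive_subgroup_minus_closed[OF V vV] y(1) aYV by blast
      moreover have "x \<otimes> (v \<ominus> y) = x \<otimes> v \<ominus> x \<otimes> y" using c xc by (simp add: minus_eq r_distr r_minus)
      ultimately have "v \<ominus> y \<in> ?K" using y(2) by simp
      then have 1: "v \<ominus> y \<in> aspan R (Y \<union> ?K)" using aspan_superset[of "Y \<union> ?K" R] by blast
      have 2: "y \<in> aspan R (Y \<union> ?K)" using y(1) add.mono_generate[of Y "Y \<union> ?K"] by blast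
      have "v = (v \<ominus> y) \<oplus> y" using c by (simp add: minus_eq a_assoc l_neg)
      then show "v \<in> aspan R (Y \<union> ?K)" using additive_subgroup.a_closed[OF sub 1 2] by simp
    qed
    then have "?V \<subseteq> aspan R (Y \<union> ?K)" by (rule aspan_least[OF _ sub])
    then show ?thesis using Y(1) finY cYZ \<open>card Z < t\<close> by (intro exI[of _ Y]) auto
  qed
  show ?thesis using SJ finS cardS main by (intro exI[of _ S]) simp
qed

text \<open>\<open>B\<close> spans the nilradical \<open>J\<close>, \<open>Q\<close> spans \<open>J\<^sup>2\<close>, \<open>X\<close> generates \<open>J\<close> modulo \<open>J\<^sup>2\<close>, and
  \<open>P\<close> is a set of entries \<open>(a, b, a b)\<close> of the multiplication table which together with the products
  of elements of \<open>X\<close> determines the whole table.\<close>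

definition short_description ::
    "nat \<Rightarrow> nat \<Rightarrow> nat \<Rightarrow> 'a ring \<Rightarrow> 'a set \<times> 'a set \<times> 'a set \<times> ('a \<times> 'a \<times> 'a) set \<Rightarrow> bool" where
  "short_description p n m R = (\<lambda>(B, Q, X, P).
     B \<subseteq> carrier R \<and> card B \<le> n \<and> Q \<subseteq> carrier R \<and> card Q \<le> n \<and> X \<subseteq> carrier R \<and>
     p ^ card X * card (aspan R Q) \<le> p ^ n \<and> (\<forall>x\<in>X. \<forall>y\<in>X. x \<otimes>\<^bsub>R\<^esub> y \<in> aspan R Q) \<and>
     P \<subseteq> (\<lambda>(a, b). (a, b, a \<otimes>\<^bsub>R\<^esub> b)) ` (carrier R \<times> carrier R) \<and> card P \<le> m \<and>
     (\<forall>a\<in>aspan R B. \<forall>b\<in>aspan R B. a \<otimes>\<^bsub>R\<^esub> b \<in> aspan R B) \<and>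
     (\<forall>R'. same_additive_group R R' \<longrightarrow> (\<forall>a\<in>aspan R B. \<forall>b\<in>aspan R B. a \<otimes>\<^bsub>R'\<^esub> b \<in> aspan R B) \<longrightarrow>
        (\<forall>x\<in>X. \<forall>y\<in>X. x \<otimes>\<^bsub>R\<^esub> y = x \<otimes>\<^bsub>R'\<^esub> y) \<longrightarrow> (\<forall>(a, b, c)\<in>P. c = a \<otimes>\<^bsub>R'\<^esub> b) \<longrightarrow>
        (\<forall>a\<in>carrier R. \<forall>b\<in>carrier R. a \<otimes>\<^bsub>R\<^esub> b = a \<otimes>\<^bsub>R'\<^esub> b)))"

context same_additive_group

\<comment> \<open>From recorded products to the whole multiplication\<close>
begin

lemma mult_eq_aspan:
  assumes "b \<in> carrier R" "X \<subseteq> carrier R" "\<And>x. x \<in> X \<Longrightarrow> x \<otimes>\<^bsub>R\<^esub> b = x \<otimes>\<^bsub>R'\<^esub> b"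
    and a: "a \<in> aspan R X"
  shows "a \<otimes>\<^bsub>R\<^esub> b = a \<otimes>\<^bsub>R'\<^esub> b"
proof -
  have ac: "a \<in> carrier R" using R.add.generate_incl[of X] assms(2) a by auto
  have "additive_subgroup {\<zero>\<^bsub>R\<^esub>} R" by (rule R.additive_subgroupI') auto
  then have "mult_diff a b \<in> {\<zero>\<^bsub>R\<^esub>}"
    using assms by (intro mult_diff_aspan[OF _ _ assms(2) _ a]) (auto simp: mult_diff_eq_0_iff subset_iff)
  then show ?thesis using mult_diff_eq_0_iff[OF ac assms(1)] by simp
qed

lemma mult_eq_swap:
  assumes "a \<in> carrier R" "b \<in> carrier R" "a \<otimes>\<^bsub>R\<^esub> b = a \<otimes>\<^bsub>R'\<^esub> b"
  shows "b \<otimes>\<^bsub>R\<^esub> a = b \<otimes>\<^bsub>R'\<^esub> a"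
  using assms R.m_comm m_comm' by simp

lemma mult_eq_aspan_aspan:
  assumes "X \<subseteq> carrier R" "\<And>x y. x \<in> X \<Longrightarrow> y \<in> X \<Longrightarrow> x \<otimes>\<^bsub>R\<^esub> y = x \<otimes>\<^bsub>R'\<^esub> y"
    and a: "a \<in> aspan R X" and b: "b \<in> aspan R X"
  shows "a \<otimes>\<^bsub>R\<^esub> b = a \<otimes>\<^bsub>R'\<^esub> b"
proof -
  have bc: "b \<in> carrier R" using R.add.generate_incl[of X] assms(1) b by auto
  have "x \<otimes>\<^bsub>R\<^esub> b = x \<otimes>\<^bsub>R'\<^esub> b" if x: "x \<in> X" for x
    using mult_eq_aspan[OF _ assms(1) _ b, of x] x assms(1,2) mult_eq_swap[OF bc, of x] by blast
  then show ?thesis using mult_eq_aspan[OF bc assms(1) _ a] by blast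
qed

text \<open>The generation hypothesis is used twice. First, \<open>common_mult + J\<close> is a
  subring containing \<open>T\<close> and \<open>J\<close>, so it is everything, which shows that
  each element of \<open>J\<close> multiplies all of \<open>R\<close> alike in both rings. Then
  \<open>common_mult\<close> itself contains \<open>T\<close> and \<open>J\<close>.\<close>

lemma mult_eq_of_ideal:
  assumes J: "ideal J R" and JJ: "\<And>a b. a \<in> J \<Longrightarrow> b \<in> J \<Longrightarrow> a \<otimes>\<^bsub>R\<^esub> b = a \<otimes>\<^bsub>R'\<^esub> b"
    and T: "T \<subseteq> common_mult" "\<one>\<^bsub>R\<^esub> \<in> T"
    and gen: "\<And>Z. subring Z R \<Longrightarrow> T \<subseteq> Z \<Longrightarrow> J \<subseteq> Z \<Longrightarrow> Z = carrier R"
  shows "common_mult = carrier R"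
proof -
  have Jc: "x \<in> carrier R" if "x \<in> J" for x using ideal.Icarr[OF J that] .
  have Jadd: "additive_subgroup J R" using J by (rule ideal.axioms(1))
  have cm: "subring common_mult R" using T by (intro subring_common_mult) blast
  note cmc = subringE(1)[OF cm, THEN subsetD]
  define Z where "Z = {z \<oplus>\<^bsub>R\<^esub> j | z j. z \<in> common_mult \<and> j \<in> J}"
  have ZI: "z \<oplus>\<^bsub>R\<^esub> j \<in> Z" if "z \<in> common_mult" "j \<in> J" for z j using that unfolding Z_def by blast
  have TZ: "c \<in> Z" if "c \<in> common_mult" for c
    using ZI[OF that additive_subgroup.zero_closed[OF Jadd]] cmc[OF that] by simp
  have JZ: "j \<in> Z" if "j \<in> J" for j
    using ZI[OF subringE(2)[OF cm] that] Jc[OF that] by simp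
  have "subring Z R"
  proof (rule R.subringI)
    show "Z \<subseteq> carrier R" unfolding Z_def using cmc Jc by auto
    show "\<one>\<^bsub>R\<^esub> \<in> Z" using TZ T by blast
    fix a b assume "a \<in> Z" and "b \<in> Z"
    then obtain z j z' j' where a: "a = z \<oplus>\<^bsub>R\<^esub> j" "z \<in> common_mult" "j \<in> J"
      and b: "b = z' \<oplus>\<^bsub>R\<^esub> j'" "z' \<in> common_mult" "j' \<in> J" unfolding Z_def by blast
    note c [simp] = cmc[OF a(2)] cmc[OF b(2)] Jc[OF a(3)] Jc[OF b(3)]
    have "\<ominus>\<^bsub>R\<^esub> a = (\<ominus>\<^bsub>R\<^esub> z) \<oplus>\<^bsub>R\<^esub> (\<ominus>\<^bsub>R\<^esub> j)" by (simp add: a(1) R.minus_add)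
    then show "\<ominus>\<^bsub>R\<^esub> a \<in> Z"
      using ZI[OF subringE(5)[OF cm a(2)] additive_subgroup.a_inv_closed[OF Jadd a(3)]] by simp
    have "a \<oplus>\<^bsub>R\<^esub> b = (z \<oplus>\<^bsub>R\<^esub> z') \<oplus>\<^bsub>R\<^esub> (j \<oplus>\<^bsub>R\<^esub> j')" by (simp add: a(1) b(1) R.a_ac)
    then show "a \<oplus>\<^bsub>R\<^esub> b \<in> Z"
      using ZI[OF subringE(7)[OF cm a(2) b(2)] additive_subgroup.a_closed[OF Jadd a(3) b(3)]] by simp
    have "a \<otimes>\<^bsub>R\<^esub> b = (z \<otimes>\<^bsub>R\<^esub> z') \<oplus>\<^bsub>R\<^esub> (z \<otimes>\<^bsub>R\<^esub> j' \<oplus>\<^bsub>R\<^esub> j \<otimes>\<^bsub>R\<^esub> (z' \<oplus>\<^bsub>R\<^esub> j'))"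
      by (simp add: a(1) b(1) R.l_distr R.r_distr R.a_ac)
    moreover have "z \<otimes>\<^bsub>R\<^esub> j' \<oplus>\<^bsub>R\<^esub> j \<otimes>\<^bsub>R\<^esub> (z' \<oplus>\<^bsub>R\<^esub> j') \<in> J"
      by (intro additive_subgroup.a_closed[OF Jadd] ideal.I_l_closed[OF J] ideal.I_r_closed[OF J])
        (use a b in auto)
    ultimately show "a \<otimes>\<^bsub>R\<^esub> b \<in> Z"
      using ZI[OF subringE(6)[OF cm a(2) b(2)]] by simp
  qed
  then have Z: "Z = carrier R" using gen TZ JZ T by blast
  have JC: "j \<in> common_mult" if j: "j \<in> J" for j
  proof -
    have "j \<otimes>\<^bsub>R\<^esub> b = j \<otimes>\<^bsub>R'\<^esub> b" if "b \<in> carrier R" for b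
    proof -
      obtain z i where b: "b = z \<oplus>\<^bsub>R\<^esub> i" "z \<in> common_mult" "i \<in> J" using \<open>b \<in> carrier R\<close> Z unfolding Z_def by blast
      note [simp] = cmc[OF b(2)] Jc[OF b(3)] Jc[OF j]
      have "z \<otimes>\<^bsub>R\<^esub> j = z \<otimes>\<^bsub>R'\<^esub> j" using b(2) unfolding common_mult_def by simp
      then have "b \<otimes>\<^bsub>R\<^esub> j = b \<otimes>\<^bsub>R'\<^esub> j" using JJ[OF b(3) j] by (simp add: b(1) R.l_distr l_distr')
      then show ?thesis using that by (intro mult_eq_swap[of b j]) auto
    qed
    then show ?thesis using Jc[OF j] unfolding common_mult_def by blast
  qed
  show ?thesis by (rule gen[OF cm T(1)]) (use JC in blast)
qed

end

text \<open>The three terms of the bound count the products of \<open>S \<union> T\<close> with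
  additive generators \<open>G\<close>, the factorisations \<open>u = x b\<close> for
  \<open>u\<close> in \<open>U\<close>, and the products of each \<open>u\<close> with the at most
  \<open>t\<close> elements of \<open>Y u\<close>.\<close>

lemma short_description_exists:
  fixes R :: "'a ring" (structure)
  assumes cring: "cring R" and p: "prime p" and ord: "order R = p ^ n" and fin: "finite (carrier R)"
    and nt: "n \<le> t * t" and t: "0 < t" and nk: "n \<le> 2 ^ k"
  shows "\<exists>d. short_description p n (n * (t + k + 2) + n + n * t) R d"
proof -
  interpret cring R by (rule cring)
  obtain J T where J: "ideal J R" and nilJ: "\<And>x. x \<in> J \<Longrightarrow> \<exists>k::nat. x [^] k = \<zero>"
    and T: "T \<subseteq> carrier R" "finite T" "card T \<le> k + 2" "\<one> \<in> T"
    and gen: "\<And>Z. subring Z R \<Longrightarrow> T \<subseteq> Z \<Longrightarrow> J \<subseteq> Z \<Longrightarrow> Z = carrier R"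
    using exists_few_generators[OF p ord fin nk] by blast
  obtain m where m: "jpow R J m = {\<zero>}" using jpow_eventually_zero[OF fin J nilJ] by blast
  have Jc: "x \<in> carrier R" if "x \<in> J" for x using ideal.Icarr[OF J that] .
  have Jcs: "J \<subseteq> carrier R" using Jc by blast
  have Jadd: "additive_subgroup J R" using J by (rule ideal.axioms(1))
  have zero: "additive_subgroup {\<zero>} R" by (rule additive_subgroupI') auto
  have car: "additive_subgroup (carrier R) R" by (rule additive_subgroupI') auto
  obtain G where G: "G \<subseteq> carrier R" "finite G" "carrier R = aspan R G" "card G \<le> n"
    using exists_small_spanning_set[OF p ord car] by blast
  obtain B where B: "B \<subseteq> J" "J = aspan R B" "card B \<le> n"
    using exists_small_spanning_set[OF p ord Jadd] by blast
  define J2 where "J2 = jpow R J 1"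
  have J2add: "additive_subgroup J2 R" unfolding J2_def using ideal_jpow[OF J] ideal.axioms(1) by blast
  have J2J: "J2 \<subseteq> J" using jpow_Suc_subset[OF J, of 0] unfolding J2_def One_nat_def jpow.simps(1) .
  obtain Q where Q: "Q \<subseteq> J2" "J2 = aspan R Q" "card Q \<le> n"
    using exists_small_spanning_set[OF p ord J2add] by blast
  obtain X where X: "X \<subseteq> J" "finite X" "J \<subseteq> aspan R (J2 \<union> X)"
      "p ^ card X * card J2 \<le> card (aspan R (J2 \<union> X))"
    using exists_small_spanning_subset[OF p ord J2add Jcs] by metis
  have Xc: "X \<subseteq> carrier R" using X(1) Jc by blast
  have "card (aspan R (J2 \<union> X)) \<le> p ^ n"
    using card_mono[OF fin, of "aspan R (J2 \<union> X)"] add.generate_incl[of "J2 \<union> X"] J2J Xc Jcs ord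
    by (simp add: order_def)
  \<comment> \<open>This limits the order of the square of \<open>J\<close> to
    \<open>p ^ (n - card X)\<close>: the trade-off between the size of \<open>X\<close> and the room
    for its products that leads to the cubic main term.\<close>
  then have cX: "p ^ card X * card (aspan R Q) \<le> p ^ n" using X(4) Q(2) by simp
  have XX: "x \<otimes> y \<in> aspan R Q" if "x \<in> X" "y \<in> X" for x y
  proof -
    have "x \<otimes> y \<in> J2" unfolding J2_def using ideal_prod.prod[of x J y J R] that X(1) by auto
    then show ?thesis using Q(2) by simp
  qed
  define V where "V = aspan R X"
  have VJ: "V \<subseteq> J" unfolding V_def by (rule aspan_least[OF X(1) Jadd])
  from exists_absorbing_set[OF p ord fin J nt t] obtain S
    where S0: "S \<subseteq> J \<and> finite S \<and> card S \<le> t \<and> (\<forall>X\<subseteq>J. \<forall>x\<in>J. \<exists>Y\<subseteq>X. finite Y \<and> card Y \<le> t \<and>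
      aspan R X \<subseteq> aspan R (Y \<union> {v \<in> aspan R X. x \<otimes> v \<in> aspan R {s \<otimes> c | s c. s \<in> S \<and> c \<in> J}}))"
    by (rule exE)
  then have S: "S \<subseteq> J" "finite S" "card S \<le> t" by simp_all
  define W where "W = aspan R {s \<otimes> c | s c. s \<in> S \<and> c \<in> J}"
  have SX: "\<forall>x\<in>J. \<exists>Y\<subseteq>X. finite Y \<and> card Y \<le> t \<and> V \<subseteq> aspan R (Y \<union> {v \<in> V. x \<otimes> v \<in> W})"
    using S0 X(1) unfolding V_def W_def by simp
  have Sc: "{s \<otimes> c | s c. s \<in> S \<and> c \<in> J} \<subseteq> carrier R" using S(1) Jc by auto
  have Wadd: "additive_subgroup W R" unfolding W_def by (rule additive_subgroup_aspan[OF Sc])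
  have VWc: "V \<union> W \<subseteq> carrier R" using VJ Jc additive_subgroup.a_subset[OF Wadd] by blast
  define H where "H = aspan R (V \<union> W)"
  have H: "additive_subgroup H R" unfolding H_def by (rule additive_subgroup_aspan[OF VWc])
  define XJ where "XJ = {x \<otimes> b | x b. x \<in> X \<and> b \<in> J}"
  have XJc: "XJ \<subseteq> carrier R" unfolding XJ_def using Xc Jc by auto
  \<comment> \<open>Only what is missing from \<open>V\<close> and \<open>W\<close> is taken from
    the elements \<open>x b\<close>; being selected from \<open>XJ\<close>, each \<open>u\<close>
    comes with a factorisation.\<close>
  obtain U where U: "U \<subseteq> XJ" "finite U" "XJ \<subseteq> aspan R (H \<union> U)" "card U \<le> n"
    using exists_small_spanning_subset[OF p ord H XJc] by metis
  have UJ: "U \<subseteq> J" using U(1) X(1) ideal.I_l_closed[OF J] Jc unfolding XJ_def by blast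
  have Uc: "U \<subseteq> carrier R" using UJ Jc by blast
  have HU: "aspan R (H \<union> U) = aspan R (V \<union> W \<union> U)"
    unfolding H_def using add.generate_insert_generate[of "V \<union> W" U] VWc Uc by simp
  have JVWU: "J \<subseteq> aspan R (V \<union> W \<union> U)"
  proof -
    have "J \<subseteq> aspan R (X \<union> XJ)"
      unfolding XJ_def using nilpotent_ideal_generators[OF J m X(1)] X(3) unfolding J2_def by blast
    also have "\<dots> \<subseteq> aspan R (V \<union> W \<union> U)"
    proof (rule aspan_least)
      show "additive_subgroup (aspan R (V \<union> W \<union> U)) R"
        using VWc Uc by (intro additive_subgroup_aspan) blast
      show "X \<union> XJ \<subseteq> aspan R (V \<union> W \<union> U)"
        using U(3) HU aspan_superset[of X R] aspan_superset[of "V \<union> W \<union> U" R] unfolding V_def by blast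
    qed
    finally show ?thesis .
  qed
  define \<Phi> where "\<Phi> u x b Y \<longleftrightarrow> x \<in> X \<and> b \<in> J \<and> u = x \<otimes> b \<and> Y \<subseteq> X \<and> finite Y \<and> card Y \<le> t \<and>
      V \<subseteq> aspan R (Y \<union> {v \<in> V. x \<otimes> v \<in> W})" for u x b Y
  have "\<exists>x b Y. \<Phi> u x b Y" if u: "u \<in> U" for u
  proof -
    obtain x b where xb: "x \<in> X" "b \<in> J" "u = x \<otimes> b" using u U(1) unfolding XJ_def by blast
    have "x \<in> J" using xb(1) X(1) by blast
    from bspec[OF SX this] obtain Y where "Y \<subseteq> X" "finite Y" "card Y \<le> t"
      "V \<subseteq> aspan R (Y \<union> {v \<in> V. x \<otimes> v \<in> W})" by blast
    then have "\<Phi> u x b Y" unfolding \<Phi>_def using xb by simp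
    then show ?thesis by blast
  qed
  then obtain x b Y where "\<And>u. u \<in> U \<Longrightarrow> \<Phi> u (x u) (b u) (Y u)" by metis
  then have U': "\<And>u. u \<in> U \<Longrightarrow> x u \<in> X \<and> b u \<in> J \<and> u = x u \<otimes> b u \<and> Y u \<subseteq> X \<and>
      finite (Y u) \<and> card (Y u) \<le> t \<and> V \<subseteq> aspan R (Y u \<union> {v \<in> V. x u \<otimes> v \<in> W})"
    unfolding \<Phi>_def .
  define tr where "tr = (\<lambda>(a, b). (a, b, a \<otimes> b))"
  define P1 where "P1 = tr ` ((S \<union> T) \<times> G)"
  define P2 where "P2 = tr ` ((\<lambda>u. (x u, b u)) ` U)"
  define P3 where "P3 = (\<Union>u\<in>U. tr ` (Y u \<times> {u}))"
  define P where "P = P1 \<union> P2 \<union> P3"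
  have "card P1 \<le> n * (t + k + 2)"
  proof -
    have "card P1 \<le> card ((S \<union> T) \<times> G)" unfolding P1_def using S(2) T(2) G(2) by (intro card_image_le) auto
    also have "\<dots> \<le> (t + k + 2) * n" unfolding card_cartesian_product
      using card_Un_le[of S T] S(3) T(3) G(4) by (intro mult_le_mono) auto
    finally show ?thesis by (simp add: mult.commute)
  qed
  moreover have "card P2 \<le> n"
    unfolding P2_def image_image using card_image_le[OF U(2)] U(4) le_trans by blast
  moreover have "card P3 \<le> n * t"
    unfolding P3_def
  proof (rule card_UN_le_mult[OF U(2,4)])
    fix u assume u: "u \<in> U"
    have "card (tr ` (Y u \<times> {u})) \<le> card (Y u \<times> {u})" using U'[OF u] by (intro card_image_le) auto
    then show "card (tr ` (Y u \<times> {u})) \<le> t" using U'[OF u] by (simp add: card_cartesian_product)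
  qed
  ultimately have cardP: "card P \<le> n * (t + k + 2) + n + n * t"
    unfolding P_def using card_Un_le[of "P1 \<union> P2" P3] card_Un_le[of P1 P2] by linarith
  have Pc: "P \<subseteq> tr ` (carrier R \<times> carrier R)"
  proof -
    have "P1 \<subseteq> tr ` (carrier R \<times> carrier R)" unfolding P1_def using S(1) Jc T(1) G(1) by blast
    moreover have "P2 \<subseteq> tr ` (carrier R \<times> carrier R)" unfolding P2_def using U' Xc Jc by blast
    moreover have "P3 \<subseteq> tr ` (carrier R \<times> carrier R)" unfolding P3_def using U' Xc Uc by blast
    ultimately show ?thesis unfolding P_def by blast
  qed
  have det: "\<forall>a\<in>carrier R. \<forall>b\<in>carrier R. a \<otimes> b = a \<otimes>\<^bsub>R'\<^esub> b"
    if R': "same_additive_group R R'" and J': "\<forall>a\<in>J. \<forall>b\<in>J. a \<otimes>\<^bsub>R'\<^esub> b \<in> J"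
      and X': "\<forall>x\<in>X. \<forall>y\<in>X. x \<otimes> y = x \<otimes>\<^bsub>R'\<^esub> y" and P': "\<forall>(a, b, c)\<in>P. c = a \<otimes>\<^bsub>R'\<^esub> b" for R'
  proof -
    interpret same_additive_group R R' by (rule R')
    have trP: "a \<otimes> c = a \<otimes>\<^bsub>R'\<^esub> c" if "tr (a, c) \<in> P" for a c using P' that unfolding tr_def by auto
    have ST: "S \<union> T \<subseteq> common_mult"
    proof
      fix s assume s: "s \<in> S \<union> T"
      have sc: "s \<in> carrier R" using s S(1) Jc T(1) by blast
      have "s \<otimes> g = s \<otimes>\<^bsub>R'\<^esub> g" if "g \<in> G" for g
        using that s by (intro trP) (auto simp: P_def P1_def)
      \<comment> \<open>The factors are exchanged because agreement extends to spans in the first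
        argument.\<close>
      then have "g \<otimes> s = g \<otimes>\<^bsub>R'\<^esub> s" if "g \<in> G" for g
        using that G(1) sc by (intro mult_eq_swap[of s g]) auto
      then have "c \<otimes> s = c \<otimes>\<^bsub>R'\<^esub> s" if "c \<in> carrier R" for c
        using mult_eq_aspan[OF sc G(1)] that unfolding G(3)[symmetric] by blast
      then show "s \<in> common_mult" unfolding common_mult_def using sc mult_eq_swap[of _ s] by blast
    qed
    have JJ: "a \<otimes> c = a \<otimes>\<^bsub>R'\<^esub> c" if "a \<in> J" "c \<in> J" for a c
    proof (rule mult_eq_on_nilpotent_ideal[OF J _ m S(1) _ VJ _ W_def UJ JVWU _ that])
      show "a \<otimes>\<^bsub>R'\<^esub> c \<in> J" if "a \<in> J" "c \<in> J" for a c using J' that by blast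
      show "S \<subseteq> common_mult" using ST by blast
      show "v \<otimes> w = v \<otimes>\<^bsub>R'\<^esub> w" if "v \<in> V" "w \<in> V" for v w
        using mult_eq_aspan_aspan[OF Xc _ that[unfolded V_def]] X' by blast
      fix u assume u: "u \<in> U"
      have XV: "X \<subseteq> V" unfolding V_def by (rule aspan_superset)
      have 1: "u = x u \<otimes>\<^bsub>R'\<^esub> b u"
        using U'[OF u] trP[of "x u" "b u"] u unfolding P_def P2_def by auto
      have 2: "\<forall>y\<in>Y u. y \<otimes> u = y \<otimes>\<^bsub>R'\<^esub> u"
        using trP u unfolding P_def P3_def by blast
      show "\<exists>x\<in>V. \<exists>b\<in>J. \<exists>Y\<subseteq>V. u = x \<otimes> b \<and> u = x \<otimes>\<^bsub>R'\<^esub> b \<and>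
          (\<forall>y\<in>Y. y \<otimes> u = y \<otimes>\<^bsub>R'\<^esub> u) \<and> V \<subseteq> aspan R (Y \<union> {v \<in> V. x \<otimes> v \<in> W})"
        using U'[OF u] 1 2 XV
        by (intro bexI[of _ "x u"] bexI[of _ "b u"] exI[of _ "Y u"] conjI) auto
    qed
    have "common_mult = carrier R"
      by (rule mult_eq_of_ideal[OF J JJ _ T(4) gen]) (use ST in auto)
    then show ?thesis unfolding common_mult_def by blast
  qed
  have "short_description p n (n * (t + k + 2) + n + n * t) R (B, Q, X, P)"
    unfolding short_description_def prod.case tr_def[symmetric] B(2)[symmetric]
  proof (intro conjI)
    show "B \<subseteq> carrier R" "Q \<subseteq> carrier R" using B(1) Q(1) J2J Jcs by blast+
    show "\<forall>x\<in>X. \<forall>y\<in>X. x \<otimes> y \<in> aspan R Q" using XX by blast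
    show "\<forall>a\<in>J. \<forall>b\<in>J. a \<otimes> b \<in> J" using ideal.I_l_closed[OF J] Jc by blast
    show "\<forall>R'. same_additive_group R R' \<longrightarrow> (\<forall>a\<in>J. \<forall>b\<in>J. a \<otimes>\<^bsub>R'\<^esub> b \<in> J) \<longrightarrow>
        (\<forall>x\<in>X. \<forall>y\<in>X. x \<otimes> y = x \<otimes>\<^bsub>R'\<^esub> y) \<longrightarrow> (\<forall>(a, b, c)\<in>P. c = a \<otimes>\<^bsub>R'\<^esub> b) \<longrightarrow>
        (\<forall>a\<in>carrier R. \<forall>b\<in>carrier R. a \<otimes> b = a \<otimes>\<^bsub>R'\<^esub> b)"
      by (intro allI impI) (rule det)
  qed (fact B(3) Q(3) Xc cX Pc cardP)+
  then show ?thesis by (rule exI)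
qed

section \<open>Coding finite abelian p-groups by carries\<close>

definition digits :: "nat \<Rightarrow> nat \<Rightarrow> nat list set" where
  "digits p k = {c. length c = k \<and> set c \<subseteq> {..<p}}"

lemma card_digits: "card (digits p k) = p ^ k"
proof -
  have "digits p k = {c. set c \<subseteq> {..<p} \<and> length c = k}" unfolding digits_def by blast
  then show ?thesis using card_lists_length_eq[of "{..<p}" k] by simp
qed

lemma finite_digits: "finite (digits p k)"
  using finite_lists_length_eq[of "{..<p}" k] unfolding digits_def by (simp add: conj_commute)

text \<open>In an abelian group of order \<open>p\<^sup>n\<close> with a chain of subgroups of index \<open>p\<close> and
  representatives \<open>gs\<close>, every element has unique base \<open>p\<close> digits with respect to \<open>gs\<close>.  Addition
  is digit-wise with carries, the carry at \<open>g\<close> being the digit expansion \<open>r\<close> of \<open>p g\<close> in the smaller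
  subgroup; so the list \<open>rs\<close> of carries determines the group.  Heads of lists are most significant.\<close>

fun digit_sum :: "('a, 'b) ring_scheme \<Rightarrow> 'a list \<Rightarrow> nat list \<Rightarrow> 'a" where
  "digit_sum R (g # gs) (c # cs) = add_pow R c g \<oplus>\<^bsub>R\<^esub> digit_sum R gs cs"
| "digit_sum R _ _ = \<zero>\<^bsub>R\<^esub>"

fun carry_chain :: "('a, 'b) ring_scheme \<Rightarrow> nat \<Rightarrow> 'a list \<Rightarrow> nat list list \<Rightarrow> bool" where
  "carry_chain R p [] [] = True"
| "carry_chain R p (g # gs) (r # rs) \<longleftrightarrow> g \<in> carrier R \<and> r \<in> digits p (length gs) \<and>
     add_pow R p g = digit_sum R gs r \<and> carry_chain R p gs rs"
| "carry_chain R p _ _ = False"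

fun digit_add :: "nat \<Rightarrow> nat list list \<Rightarrow> nat list \<Rightarrow> nat list \<Rightarrow> nat list" where
  "digit_add p (r # rs) (a # as) (b # bs) =
     (if a + b < p then (a + b) # digit_add p rs as bs
      else (a + b - p) # digit_add p rs (digit_add p rs as bs) r)"
| "digit_add p _ _ _ = []"

lemma carry_chain_length: "carry_chain R p gs rs \<Longrightarrow> length gs = length rs"
  by (induction R p gs rs rule: carry_chain.induct) auto

lemma carry_chain_subset: "carry_chain R p gs rs \<Longrightarrow> set gs \<subseteq> carrier R"
  by (induction R p gs rs rule: carry_chain.induct) auto

lemma carry_chain_codes:
  "carry_chain R p gs rs \<Longrightarrow> set rs \<subseteq> {c. set c \<subseteq> {..<p} \<and> length c \<le> length gs}"
  by (induction R p gs rs rule: carry_chain.induct) (fastforce simp: digits_def)+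

context ring
begin

lemma digit_sum_closed [simp]:
  "set gs \<subseteq> carrier R \<Longrightarrow> digit_sum R gs c \<in> carrier R"
proof (induction gs arbitrary: c)
  case (Cons g gs)
  then show ?case by (cases c) auto
qed simp

lemma digit_add_closed:
  assumes "carry_chain R p gs rs" "a \<in> digits p (length gs)" "b \<in> digits p (length gs)"
  shows "digit_add p rs a b \<in> digits p (length gs)"
  using assms
proof (induction rs arbitrary: gs a b)
  case Nil
  then show ?case by (cases gs) (auto simp: digits_def)
next
  case (Cons r rs)
  obtain g hs where gs: "gs = g # hs" using Cons.prems(1) by (cases gs) auto
  obtain x a' where a: "a = x # a'" "a' \<in> digits p (length hs)" "x < p"
    using Cons.prems(2) unfolding gs by (cases a) (auto simp: digits_def)
  obtain y b' where b: "b = y # b'" "b' \<in> digits p (length hs)" "y < p"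
    using Cons.prems(3) unfolding gs by (cases b) (auto simp: digits_def)
  have hs: "carry_chain R p hs rs" "r \<in> digits p (length hs)" using Cons.prems(1) gs by auto
  have 1: "digit_add p rs a' b' \<in> digits p (length hs)" by (rule Cons.IH[OF hs(1) a(2) b(2)])
  have 2: "digit_add p rs (digit_add p rs a' b') r \<in> digits p (length hs)"
    by (rule Cons.IH[OF hs(1) 1 hs(2)])
  have "x + y - p < p" using a(3) b(3) by arith
  then show ?case using 1 2 unfolding gs a(1) b(1) by (auto simp: digits_def)
qed

lemma digit_sum_add:
  assumes "carry_chain R p gs rs" "a \<in> digits p (length gs)" "b \<in> digits p (length gs)"
  shows "digit_sum R gs (digit_add p rs a b) = digit_sum R gs a \<oplus> digit_sum R gs b"
  using assms
proof (induction rs arbitrary: gs a b)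
  case Nil
  then show ?case by (cases gs) (auto simp: digits_def)
next
  case (Cons r rs)
  obtain g hs where gs: "gs = g # hs" using Cons.prems(1) by (cases gs) auto
  obtain x a' where a: "a = x # a'" "a' \<in> digits p (length hs)" "x < p"
    using Cons.prems(2) unfolding gs by (cases a) (auto simp: digits_def)
  obtain y b' where b: "b = y # b'" "b' \<in> digits p (length hs)" "y < p"
    using Cons.prems(3) unfolding gs by (cases b) (auto simp: digits_def)
  have hs: "carry_chain R p hs rs" "r \<in> digits p (length hs)" "g \<in> carrier R"
    "add_pow R (p) g = digit_sum R hs r" using Cons.prems(1) gs by auto
  have sub: "set hs \<subseteq> carrier R" by (rule carry_chain_subset[OF hs(1)])
  have 1: "digit_add p rs a' b' \<in> digits p (length hs)" by (rule digit_add_closed[OF hs(1) a(2) b(2)])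
  have s: "digit_sum R gs a \<oplus> digit_sum R gs b = add_pow R (x + y) g \<oplus> digit_sum R hs (digit_add p rs a' b')"
    unfolding gs a(1) b(1) using hs(3) sub Cons.IH[OF hs(1) a(2) b(2)]
    by (simp add: add.nat_pow_mult[symmetric] a_ac)
  show ?case
  proof (cases "x + y < p")
    case True
    then show ?thesis using s unfolding gs a(1) b(1) by simp
  next
    case False
    then have "add_pow R (x + y) g = add_pow R (x + y - p) g \<oplus> digit_sum R hs r"
      using hs(3,4) add.nat_pow_mult[of g "x + y - p" p] by simp
    moreover have "digit_sum R hs (digit_add p rs (digit_add p rs a' b') r) =
        digit_sum R hs (digit_add p rs a' b') \<oplus> digit_sum R hs r"
      by (rule Cons.IH[OF hs(1) 1 hs(2)])
    ultimately have "digit_sum R gs a \<oplus> digit_sum R gs b =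
        add_pow R (x + y - p) g \<oplus> digit_sum R hs (digit_add p rs (digit_add p rs a' b') r)"
      unfolding s using hs(3) sub by (simp add: a_ac)
    moreover have "digit_sum R gs (digit_add p (r # rs) a b) =
        add_pow R (x + y - p) g \<oplus> digit_sum R hs (digit_add p rs (digit_add p rs a' b') r)"
      unfolding gs a(1) b(1) using False by simp
    ultimately show ?thesis by simp
  qed
qed

lemma digit_sum_zeros:
  "set gs \<subseteq> carrier R \<Longrightarrow> digit_sum R gs (replicate (length gs) 0) = \<zero>"
  by (induction gs) (auto simp: add.nat_pow_0)

lemma additive_subgroup_digit_sum:
  assumes ch: "carry_chain R p gs rs" and fin: "finite (carrier R)" and p: "0 < p"
  shows "additive_subgroup (digit_sum R gs ` digits p (length gs)) R"
proof -
  let ?H = "digit_sum R gs ` digits p (length gs)"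
  have sub: "set gs \<subseteq> carrier R" by (rule carry_chain_subset[OF ch])
  have Hc: "?H \<subseteq> carrier R" using sub by auto
  have add: "a \<oplus> b \<in> ?H" if a: "a \<in> ?H" and b: "b \<in> ?H" for a b
  proof -
    obtain c d where "a = digit_sum R gs c" "c \<in> digits p (length gs)"
      "b = digit_sum R gs d" "d \<in> digits p (length gs)" using a b by blast
    then show ?thesis using digit_sum_add[OF ch, of c d] digit_add_closed[OF ch, of c d] by (metis imageI)
  qed
  have zero: "\<zero> \<in> ?H"
    using p digit_sum_zeros[OF sub]
    by (intro image_eqI[of _ _ "replicate (length gs) 0"]) (auto simp: digits_def)
  show ?thesis
  proof (rule additive_subgroupI'[OF Hc zero _ add])
    fix a assume a: "a \<in> ?H"
    have ac: "a \<in> carrier R" using a Hc by blast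
    have mult: "add_pow R (k) a \<in> ?H" for k :: nat
      by (induction k) (use zero add a in \<open>simp_all add: add.nat_pow_Suc\<close>)
    have pos: "0 < order R" using fin ac unfolding order_def by (auto simp: card_gt_0_iff)
    have "order (add_monoid R) = order R" by (simp add: order_def)
    then have "add_pow R (order R) a = \<zero>" using add.pow_order_eq_1[of a] ac by simp
    moreover have "add_pow R (order R) a = add_pow R (order R - 1) a \<oplus> a"
      using pos add.nat_pow_Suc[of "order R - 1" a] by simp
    ultimately have "\<ominus> a = add_pow R (order R - 1) a" using ac by (metis add.nat_pow_closed minus_equality)
    then show "\<ominus> a \<in> ?H" using mult by simp
  qed
qed

lemma exists_carry_chain:
  assumes p: "prime p" and ord: "order R = p ^ n"
  shows "\<exists>gs rs. carry_chain R p gs rs \<and> length gs = n \<and> bij_betw (digit_sum R gs) (digits p n) (carrier R)"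
proof -
  have p0: "0 < p" and p1: "1 < p" using prime_gt_0_nat[OF p] prime_gt_1_nat[OF p] by auto
  have fin: "finite (carrier R)" using ord p0 by (metis order_gt_0_iff_finite zero_less_power)
  have oadd: "order (add_monoid R) = p ^ n" using ord by (simp add: order_def)
  have "\<exists>gs rs. carry_chain R p gs rs \<and> length gs = k \<and> p ^ k \<le> card (digit_sum R gs ` digits p k)"
    if "k \<le> n" for k using that
  proof (induction k)
    case 0
    have "digits p 0 = {[]}" by (auto simp: digits_def)
    then show ?case by (intro exI[of _ "[]"]) simp
  next
    case (Suc k)
    then obtain gs rs where ch: "carry_chain R p gs rs" and len: "length gs = k"
      and big: "p ^ k \<le> card (digit_sum R gs ` digits p k)" by auto
    define H where "H = digit_sum R gs ` digits p k"
    have H: "additive_subgroup H R"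
      unfolding H_def using additive_subgroup_digit_sum[OF ch fin p0] len by simp
    have "card H \<le> p ^ k"
      unfolding H_def using card_image_le[OF finite_digits, of "digit_sum R gs" p k] by (simp add: card_digits)
    also have "p ^ k < p ^ n" using Suc.prems p1 by (intro power_strict_increasing) auto
    finally have "H \<noteq> carrier R" using ord by (auto simp: order_def)
    then obtain g0 where g0: "g0 \<in> carrier R" "g0 \<notin> H" using additive_subgroup.a_subset[OF H] by blast
    have "add_pow R (p ^ n) g0 = \<zero>" using add.pow_order_eq_1[of g0] g0(1) oadd by simp
    then have ex: "add_pow R (p ^ n) g0 \<in> H" using additive_subgroup.zero_closed[OF H] by simp
    define j where "j = (LEAST j. add_pow R (p ^ j) g0 \<in> H)"
    have j: "add_pow R (p ^ j) g0 \<in> H" unfolding j_def by (rule LeastI[where P = "\<lambda>j. add_pow R (p ^ j) g0 \<in> H", OF ex])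
    have "j \<noteq> 0"
    proof
      assume "j = 0"
      then show False using j g0 by (simp add: add.nat_pow_Suc)
    qed
    then obtain i where i: "j = Suc i" using not0_implies_Suc by blast
    define g where "g = add_pow R (p ^ i) g0"
    have gH: "g \<notin> H" unfolding g_def
      using not_less_Least[of i "\<lambda>j. add_pow R (p ^ j) g0 \<in> H"] i unfolding j_def by simp
    have gc: "g \<in> carrier R" unfolding g_def using g0(1) by simp
    have "add_pow R (p) g \<in> H" unfolding g_def using j g0(1) i by (simp add: add.nat_pow_pow mult.commute)
    then obtain r where r: "r \<in> digits p k" "add_pow R (p) g = digit_sum R gs r" unfolding H_def by blast
    have ch': "carry_chain R p (g # gs) (r # rs)" using ch gc r len by simp
    define H' where "H' = digit_sum R (g # gs) ` digits p (Suc k)"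
    have H': "additive_subgroup H' R"
      unfolding H'_def using additive_subgroup_digit_sum[OF ch' fin p0] len by simp
    have sub: "set gs \<subseteq> carrier R" by (rule carry_chain_subset[OF ch])
    have "h \<in> H'" if "h \<in> H" for h
    proof -
      obtain c where "c \<in> digits p k" "h = digit_sum R gs c" using \<open>h \<in> H\<close> unfolding H_def by blast
      then show ?thesis unfolding H'_def using p0 sub
        by (intro image_eqI[of _ _ "0 # c"]) (auto simp: digits_def add.nat_pow_0)
    qed
    moreover have "g \<in> H'"
      unfolding H'_def using p1 p0 digit_sum_zeros[OF sub] gc len
      by (intro image_eqI[of _ _ "1 # replicate k 0"]) (auto simp: digits_def add.nat_pow_Suc)
    ultimately have "aspan R (insert g H) \<subseteq> H'" by (intro aspan_least[OF _ H']) blast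
    then have "card (aspan R (insert g H)) \<le> card H'"
      using finite_subset[OF additive_subgroup.a_subset[OF H'] fin] card_mono by blast
    moreover have "p * card H \<le> card (aspan R (insert g H))"
      using add.card_generate_insert[OF p oadd additive_subgroup.a_subgroup[OF H]] gc gH by simp
    moreover have "p * p ^ k \<le> p * card H" using big unfolding H_def by simp
    ultimately have "p ^ Suc k \<le> card H'" unfolding power_Suc by linarith
    then show ?case using ch' len unfolding H'_def by (intro exI[of _ "g # gs"] exI[of _ "r # rs"]) simp
  qed
  from this[OF le_refl] obtain gs rs where ch: "carry_chain R p gs rs" and len: "length gs = n"
    and big: "p ^ n \<le> card (digit_sum R gs ` digits p n)" by auto
  have sub: "digit_sum R gs ` digits p n \<subseteq> carrier R" using carry_chain_subset[OF ch] by auto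
  have img: "digit_sum R gs ` digits p n = carrier R"
    using card_seteq[OF fin sub] big ord by (simp add: order_def)
  moreover have "inj_on (digit_sum R gs) (digits p n)"
    using img ord by (intro eq_card_imp_inj_on finite_digits) (simp add: card_digits order_def)
  ultimately show ?thesis using ch len unfolding bij_betw_def by blast
qed

end

lemma carry_chain_additive_iso:
  assumes "ring R" "ring R'" and ch: "carry_chain R p gs rs" "carry_chain R' p gs' rs"
    and bij: "bij_betw (digit_sum R gs) (digits p (length gs)) (carrier R)"
      "bij_betw (digit_sum R' gs') (digits p (length gs')) (carrier R')"
  shows "\<exists>h. bij_betw h (carrier R) (carrier R') \<and>
    (\<forall>a\<in>carrier R. \<forall>b\<in>carrier R. h (a \<oplus>\<^bsub>R\<^esub> b) = h a \<oplus>\<^bsub>R'\<^esub> h b)"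
proof -
  let ?D = "digits p (length gs)"
  have len: "length gs' = length gs" using carry_chain_length ch by metis
  define d where "d = inv_into ?D (digit_sum R gs)"
  have d: "d x \<in> ?D" "digit_sum R gs (d x) = x" if "x \<in> carrier R" for x
    using that bij(1) unfolding d_def bij_betw_def by (auto intro: inv_into_into f_inv_into_f)
  have dd: "d (digit_sum R gs c) = c" if "c \<in> ?D" for c
    using that bij(1) unfolding d_def bij_betw_def by simp
  have "bij_betw d (carrier R) ?D" unfolding d_def by (rule bij_betw_inv_into[OF bij(1)])
  then have "bij_betw (digit_sum R' gs' \<circ> d) (carrier R) (carrier R')"
    using bij(2) unfolding len by (rule bij_betw_trans)
  moreover have "(digit_sum R' gs' \<circ> d) (a \<oplus>\<^bsub>R\<^esub> b) = (digit_sum R' gs' \<circ> d) a \<oplus>\<^bsub>R'\<^esub> (digit_sum R' gs' \<circ> d) b"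
    if "a \<in> carrier R" "b \<in> carrier R" for a b
  proof -
    let ?s = "digit_add p rs (d a) (d b)"
    have "a \<oplus>\<^bsub>R\<^esub> b = digit_sum R gs ?s"
      using ring.digit_sum_add[OF assms(1) ch(1) d(1) d(1)] d(2) that by metis
    then have "d (a \<oplus>\<^bsub>R\<^esub> b) = ?s"
      using dd[OF ring.digit_add_closed[OF assms(1) ch(1) d(1)[OF that(1)] d(1)[OF that(2)]]] by simp
    then show ?thesis
      using ring.digit_sum_add[OF assms(2) ch(2), of "d a" "d b"] d(1) that len by simp
  qed
  ultimately show ?thesis by blast
qed

section \<open>Counting descriptions\<close>

lemma card_quotient_le:
  assumes eq: "equiv A r" and fin: "finite D" and f: "f ` A \<subseteq> D"
    and inj: "\<And>x y. x \<in> A \<Longrightarrow> y \<in> A \<Longrightarrow> f x = f y \<Longrightarrow> (x, y) \<in> r"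
  shows "card (A // r) \<le> card D"
proof (rule surj_card_le[OF fin])
  show "A // r \<subseteq> (\<lambda>d. r `` {SOME x. x \<in> A \<and> f x = d}) ` D"
  proof
    fix X assume "X \<in> A // r"
    then obtain x where x: "x \<in> A" "X = r `` {x}" by (auto elim: quotientE)
    have "(SOME y. y \<in> A \<and> f y = f x) \<in> A \<and> f (SOME y. y \<in> A \<and> f y = f x) = f x"
      by (rule someI[of _ x]) (use x in simp)
    then have "(x, SOME y. y \<in> A \<and> f y = f x) \<in> r" using x(1) by (intro inj) auto
    then have "X = r `` {SOME y. y \<in> A \<and> f y = f x}" unfolding x(2) by (rule equiv_class_eq[OF eq])
    then show "X \<in> (\<lambda>d. r `` {SOME x. x \<in> A \<and> f x = d}) ` D" using x f by blast
  qed
qed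

lemma ring_transport:
  assumes R: "cring R" and S: "abelian_group S" and h: "bij_betw h (carrier R) (carrier S)"
    and add: "\<And>a b. a \<in> carrier R \<Longrightarrow> b \<in> carrier R \<Longrightarrow> h (a \<oplus>\<^bsub>R\<^esub> b) = h a \<oplus>\<^bsub>S\<^esub> h b"
  shows "\<exists>T :: 'b ring. cring T \<and> R \<simeq> T \<and> carrier T = carrier S \<and> add T = add S \<and> zero T = zero S"
proof -
  interpret R: cring R by (rule R)
  interpret S: abelian_group S by (rule S)
  define g where "g = inv_into (carrier R) h"
  have g: "g (h a) = a" if "a \<in> carrier R" for a
    using that h by (simp add: g_def bij_betw_def)
  have hc: "h a \<in> carrier S" if "a \<in> carrier R" for a using that h by (auto simp: bij_betw_def)
  define T :: "'b ring" where "T = \<lparr>carrier = carrier S, mult = (\<lambda>a b. h (g a \<otimes>\<^bsub>R\<^esub> g b)),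
    one = h \<one>\<^bsub>R\<^esub>, zero = zero S, add = add S\<rparr>"
  have T: "carrier T = carrier S" "add T = add S" "zero T = zero S" by (simp_all add: T_def)
  have iso: "h \<in> ring_iso R T"
    by (rule ring_iso_memI) (use h in \<open>simp_all add: T_def hc add g\<close>)
  have "h \<zero>\<^bsub>R\<^esub> \<oplus>\<^bsub>S\<^esub> h \<zero>\<^bsub>R\<^esub> = h \<zero>\<^bsub>R\<^esub>" using add[of "\<zero>\<^bsub>R\<^esub>" "\<zero>\<^bsub>R\<^esub>"] by simp
  then have z: "h \<zero>\<^bsub>R\<^esub> = zero S" using hc[of "\<zero>\<^bsub>R\<^esub>"] by (metis R.zero_closed S.add.l_cancel_one')
  have "h ` carrier R = carrier T" using h T(1) by (simp add: bij_betw_def)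
  then have "cring T" using R.ring_iso_imp_img_cring[OF iso] z T by (simp add: T_def)
  then show ?thesis using iso T unfolding is_ring_iso_def by blast
qed

lemma card_subsets_le:
  assumes "finite A"
  shows "finite {B. B \<subseteq> A \<and> card B \<le> k} \<and> card {B. B \<subseteq> A \<and> card B \<le> k} \<le> (card A + 1) ^ k"
proof (induction k)
  case 0
  have "{B. B \<subseteq> A \<and> card B \<le> 0} = {{}}" using assms finite_subset by fastforce
  then show ?case by simp
next
  case (Suc k)
  let ?S = "\<lambda>k. {B. B \<subseteq> A \<and> card B \<le> k}"
  let ?f = "\<lambda>(x, B). case x of None \<Rightarrow> B | Some a \<Rightarrow> insert a B"
  let ?A = "insert None (Some ` A)"
  have fin: "finite (?A \<times> ?S k)" using assms Suc by simp
  have "?S (Suc k) \<subseteq> ?f ` (?A \<times> ?S k)"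
  proof
    fix B assume B: "B \<in> ?S (Suc k)"
    show "B \<in> ?f ` (?A \<times> ?S k)"
    proof (cases "card B \<le> k")
      case True
      then show ?thesis using B by (intro image_eqI[of _ _ "(None, B)"]) auto
    next
      case False
      then obtain a where a: "a \<in> B" using B by (metis card.empty equals0I le0)
      have "card (B - {a}) \<le> k" using B a by (simp add: card_Diff_singleton le_diff_conv)
      then show ?thesis using B a by (intro image_eqI[of _ _ "(Some a, B - {a})"]) auto
    qed
  qed
  then have 1: "card (?S (Suc k)) \<le> card (?A \<times> ?S k)" using surj_card_le[OF fin] by blast
  have "card (?A \<times> ?S k) = (card A + 1) * card (?S k)"
    using assms by (simp add: card_cartesian_product card_image)
  also have "\<dots> \<le> (card A + 1) ^ Suc k"
    unfolding power_Suc using Suc by (intro mult_le_mono2) blast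
  finally have "card (?S (Suc k)) \<le> (card A + 1) ^ Suc k" using 1 by linarith
  moreover have "finite (?S (Suc k))" by (rule finite_subset[of _ "Pow A"]) (use assms in auto)
  ultimately show ?case by blast
qed

lemma card_ordered_pairs:
  fixes X :: "nat set"
  assumes "finite X"
  shows "card {(x, y). x \<in> X \<and> y \<in> X \<and> x \<le> y} = card X * (card X + 1) div 2"
proof -
  let ?L = "{(x, y). x \<in> X \<and> y \<in> X \<and> x \<le> y}" and ?G = "{(x, y). x \<in> X \<and> y \<in> X \<and> y \<le> x}"
  have fin: "finite ?L" "finite ?G" by (rule finite_subset[of _ "X \<times> X"]; use assms in auto)+
  have "card ((\<lambda>(x, y). (y, x)) ` ?L) = card ?L" by (rule card_image) (auto simp: inj_on_def)
  moreover have "(\<lambda>(x, y). (y, x)) ` ?L = ?G" by auto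
  ultimately have "card ?G = card ?L" by simp
  moreover have "?L \<union> ?G = X \<times> X" by auto
  moreover have "?L \<inter> ?G = (\<lambda>x. (x, x)) ` X" by auto
  moreover have "card ((\<lambda>x. (x, x)) ` X) = card X" by (intro card_image) (auto simp: inj_on_def)
  ultimately have "2 * card ?L = card X * card X + card X"
    using card_Un_Int[OF fin] by (simp add: card_cartesian_product)
  then show ?thesis by simp
qed

text \<open>A ring is moved onto a fixed additive group \<open>base_ring\<close> chosen for its isomorphism type of
  additive groups (its code), so that two rings with the same code have literally equal addition.\<close>

definition structure_code :: "nat \<Rightarrow> nat \<Rightarrow> nat ring \<Rightarrow> nat list list" where
  "structure_code p n R = (SOME rs. \<exists>gs. carry_chain R p gs rs \<and> length gs = n \<and>
     bij_betw (digit_sum R gs) (digits p n) (carrier R))"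

definition base_ring :: "nat \<Rightarrow> nat \<Rightarrow> nat list list \<Rightarrow> nat ring" where
  "base_ring p n c = (SOME R. R \<in> crings_of_order (p ^ n) \<and> structure_code p n R = c)"

definition transported :: "nat \<Rightarrow> nat \<Rightarrow> nat ring \<Rightarrow> nat ring" where
  "transported p n R = (let S = base_ring p n (structure_code p n R) in
     SOME T. cring T \<and> R \<simeq> T \<and> carrier T = carrier S \<and> add T = add S \<and> zero T = zero S)"

lemma structure_code:
  assumes "prime p" "R \<in> crings_of_order (p ^ n)"
  shows "\<exists>gs. carry_chain R p gs (structure_code p n R) \<and> length gs = n \<and>
     bij_betw (digit_sum R gs) (digits p n) (carrier R)"
proof -
  have "cring R" "order R = p ^ n" using assms(2) by (auto simp: crings_of_order_def)
  then have "\<exists>rs gs. carry_chain R p gs rs \<and> length gs = n \<and>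
     bij_betw (digit_sum R gs) (digits p n) (carrier R)"
    using ring.exists_carry_chain[of R p n] assms(1) cring.axioms(1) by blast
  then show ?thesis unfolding structure_code_def by (rule someI_ex)
qed

lemma base_ring:
  assumes "R \<in> crings_of_order (p ^ n)"
  shows "base_ring p n (structure_code p n R) \<in> crings_of_order (p ^ n)"
    "structure_code p n (base_ring p n (structure_code p n R)) = structure_code p n R"
proof -
  have "base_ring p n (structure_code p n R) \<in> crings_of_order (p ^ n) \<and>
    structure_code p n (base_ring p n (structure_code p n R)) = structure_code p n R"
    unfolding base_ring_def by (rule someI[of _ R]) (use assms in simp)
  then show "base_ring p n (structure_code p n R) \<in> crings_of_order (p ^ n)"
    "structure_code p n (base_ring p n (structure_code p n R)) = structure_code p n R" by auto
qed

lemma transported: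
  assumes p: "prime p" and R: "R \<in> crings_of_order (p ^ n)"
  defines "S \<equiv> base_ring p n (structure_code p n R)" and "T \<equiv> transported p n R"
  shows "cring T" "R \<simeq> T" "carrier T = carrier S" "add T = add S" "zero T = zero S"
proof -
  have S: "S \<in> crings_of_order (p ^ n)" "structure_code p n S = structure_code p n R"
    unfolding S_def using base_ring[OF R] by auto
  have rings: "cring R" "cring S" using R S by (auto simp: crings_of_order_def)
  obtain gs where gs: "carry_chain R p gs (structure_code p n R)" "length gs = n"
     "bij_betw (digit_sum R gs) (digits p n) (carrier R)" using structure_code[OF p R] by blast
  obtain gs' where gs': "carry_chain S p gs' (structure_code p n R)" "length gs' = n"
     "bij_betw (digit_sum S gs') (digits p n) (carrier S)" using structure_code[OF p S(1)] S(2) by auto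
  have "\<exists>h. bij_betw h (carrier R) (carrier S) \<and>
    (\<forall>a\<in>carrier R. \<forall>b\<in>carrier R. h (a \<oplus>\<^bsub>R\<^esub> b) = h a \<oplus>\<^bsub>S\<^esub> h b)"
    by (rule carry_chain_additive_iso[OF _ _ gs(1) gs'(1)])
       (use rings cring.axioms(1) gs gs' in auto)
  then obtain h where h: "bij_betw h (carrier R) (carrier S)"
    "\<And>a b. a \<in> carrier R \<Longrightarrow> b \<in> carrier R \<Longrightarrow> h (a \<oplus>\<^bsub>R\<^esub> b) = h a \<oplus>\<^bsub>S\<^esub> h b" by blast
  have "abelian_group S" using rings(2) by (intro ring.is_abelian_group cring.axioms(1))
  from ring_transport[OF rings(1) this h]
  have "cring T \<and> R \<simeq> T \<and> carrier T = carrier S \<and> add T = add S \<and> zero T = zero S"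
    unfolding T_def transported_def Let_def S_def[symmetric] by (rule someI_ex)
  then show "cring T" "R \<simeq> T" "carrier T = carrier S" "add T = add S" "zero T = zero S" by auto
qed

lemma structure_code_bound:
  assumes p: "prime p"
  shows "finite (structure_code p n ` crings_of_order (p ^ n))"
    "card (structure_code p n ` crings_of_order (p ^ n)) \<le> p ^ (n * (n + 1))"
proof -
  let ?L = "{c. set c \<subseteq> {..<p} \<and> length c \<le> n}"
  have finL: "finite ?L" by (rule finite_lists_length_le) simp
  have "(\<Sum>i\<le>n. p ^ i) \<le> p ^ (n + 1)"
  proof (induction n)
    case 0
    show ?case using prime_ge_1_nat[OF p] by simp
  next
    case (Suc n)
    have "(\<Sum>i\<le>Suc n. p ^ i) \<le> 2 * p ^ Suc n" using Suc by simp
    also have "\<dots> \<le> p * p ^ Suc n" using prime_ge_2_nat[OF p] by (intro mult_le_mono1)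
    finally show ?case by simp
  qed
  then have cardL: "card ?L \<le> p ^ (n + 1)" using card_lists_length_le[of "{..<p}" n] by simp
  have sub: "structure_code p n ` crings_of_order (p ^ n) \<subseteq> {c. set c \<subseteq> ?L \<and> length c = n}"
  proof clarify
    fix R assume "R \<in> crings_of_order (p ^ n)"
    then obtain gs where gs: "carry_chain R p gs (structure_code p n R)" "length gs = n"
      using structure_code[OF p] by blast
    show "set (structure_code p n R) \<subseteq> ?L \<and> length (structure_code p n R) = n"
      using carry_chain_length[OF gs(1)] carry_chain_codes[OF gs(1)] gs(2) by simp
  qed
  have fin: "finite {c. set c \<subseteq> ?L \<and> length c = n}" by (rule finite_lists_length_eq[OF finL])
  then show "finite (structure_code p n ` crings_of_order (p ^ n))" using sub finite_subset by blast
  have "card (structure_code p n ` crings_of_order (p ^ n)) \<le> card {c. set c \<subseteq> ?L \<and> length c = n}"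
    by (rule card_mono[OF fin sub])
  also have "\<dots> = card ?L ^ n" by (rule card_lists_length_eq[OF finL])
  also have "\<dots> \<le> (p ^ (n + 1)) ^ n" using cardL by (rule power_mono) simp
  also have "\<dots> = p ^ (n * (n + 1))" unfolding power_mult[symmetric] by (simp only: mult.commute)
  finally show "card (structure_code p n ` crings_of_order (p ^ n)) \<le> p ^ (n * (n + 1))" .
qed

definition descriptions ::
    "nat \<Rightarrow> nat \<Rightarrow> nat \<Rightarrow> 'a ring \<Rightarrow> ('a set \<times> 'a set \<times> 'a set \<times> ('a \<times> 'a \<times> 'a) set) set" where
  "descriptions p n m S = {(B, Q, X, P). B \<subseteq> carrier S \<and> card B \<le> n \<and> Q \<subseteq> carrier S \<and> card Q \<le> n \<and>
     X \<subseteq> carrier S \<and> card X \<le> n \<and> p ^ card X * card (aspan S Q) \<le> p ^ n \<and>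
     P \<subseteq> carrier S \<times> carrier S \<times> carrier S \<and> card P \<le> m}"

lemma descriptions_bound:
  assumes p: "prime p" and S: "finite (carrier S)" "order S = p ^ n" and n: "0 < n"
  shows "finite (descriptions p n m S)" "card (descriptions p n m S) \<le> p ^ (6 * n * n + 4 * n * m)"
proof -
  let ?A = "{B. B \<subseteq> carrier S \<and> card B \<le> n}"
  let ?P = "{P. P \<subseteq> carrier S \<times> carrier S \<times> carrier S \<and> card P \<le> m}"
  have cS: "card (carrier S) = p ^ n" using S(2) by (simp add: order_def)
  have p2: "2 \<le> p" by (rule prime_ge_2_nat[OF p])
  have bound: "p ^ i + 1 \<le> p ^ j" if "i < j" for i j
  proof -
    have "p ^ i < p ^ j" using p2 that by (intro power_strict_increasing) auto
    then show ?thesis by simp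
  qed
  have A: "finite ?A" "card ?A \<le> (p ^ (2 * n)) ^ n"
  proof -
    have "card ?A \<le> (p ^ n + 1) ^ n" and fin: "finite ?A" using card_subsets_le[OF S(1), of n] cS by auto
    moreover have "(p ^ n + 1) ^ n \<le> (p ^ (2 * n)) ^ n" using bound[of n "2 * n"] n by (intro power_mono) auto
    ultimately show "finite ?A" "card ?A \<le> (p ^ (2 * n)) ^ n" using order.trans by blast+
  qed
  have P: "finite ?P" "card ?P \<le> (p ^ (4 * n)) ^ m"
  proof -
    have "finite (carrier S \<times> carrier S \<times> carrier S)" using S(1) by simp
    from card_subsets_le[OF this, of m]
    have "card ?P \<le> (card (carrier S \<times> carrier S \<times> carrier S) + 1) ^ m" and "finite ?P" by auto
    moreover have "card (carrier S \<times> carrier S \<times> carrier S) = p ^ (3 * n)"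
      unfolding card_cartesian_product cS power_add[symmetric] by (rule arg_cong[of _ _ "(^) p"]) simp
    moreover have "(p ^ (3 * n) + 1) ^ m \<le> (p ^ (4 * n)) ^ m"
      using bound[of "3 * n" "4 * n"] n by (intro power_mono) auto
    ultimately show "finite ?P" "card ?P \<le> (p ^ (4 * n)) ^ m" by auto
  qed
  have sub: "descriptions p n m S \<subseteq> ?A \<times> ?A \<times> ?A \<times> ?P" unfolding descriptions_def by auto
  have fin: "finite (?A \<times> ?A \<times> ?A \<times> ?P)" using A(1) P(1) by simp
  show "finite (descriptions p n m S)" by (rule finite_subset[OF sub fin])
  have "card (descriptions p n m S) \<le> card (?A \<times> ?A \<times> ?A \<times> ?P)" by (rule card_mono[OF fin sub])
  also have "\<dots> = card ?A * (card ?A * (card ?A * card ?P))" by (simp only: card_cartesian_product)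
  also have "\<dots> \<le> (p ^ (2 * n)) ^ n * ((p ^ (2 * n)) ^ n * ((p ^ (2 * n)) ^ n * (p ^ (4 * n)) ^ m))"
    using A(2) P(2) by (intro mult_le_mono)
  also have "\<dots> = p ^ (2 * n * n + (2 * n * n + (2 * n * n + 4 * n * m)))"
    by (simp only: power_add power_mult)
  also have "2 * n * n + (2 * n * n + (2 * n * n + 4 * n * m)) = 6 * n * n + 4 * n * m" by simp
  finally show "card (descriptions p n m S) \<le> p ^ (6 * n * n + 4 * n * m)" .
qed

definition ordered_pairs :: "nat set \<Rightarrow> (nat \<times> nat) set" where
  "ordered_pairs X = {(x, y). x \<in> X \<and> y \<in> X \<and> x \<le> y}"

definition product_tables :: "nat ring \<Rightarrow> nat set \<times> nat set \<times> nat set \<times> (nat \<times> nat \<times> nat) set \<Rightarrow>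
    (nat \<times> nat \<Rightarrow> nat) set" where
  "product_tables S = (\<lambda>(B, Q, X, P). ordered_pairs X \<rightarrow>\<^sub>E aspan S Q)"

lemma product_tables_bound:
  assumes p: "prime p" and S: "cring S" "finite (carrier S)" and d: "d \<in> descriptions p n m S"
    and b: "\<And>d. d \<le> n \<Longrightarrow> (n - d) * (d * (d + 1) div 2) \<le> b"
  shows "finite (product_tables S d)" "card (product_tables S d) \<le> p ^ b"
proof -
  interpret cring S by (rule S(1))
  obtain B Q X P where dd: "d = (B, Q, X, P)" by (cases d) auto
  have Q: "Q \<subseteq> carrier S" and X: "X \<subseteq> carrier S" "card X \<le> n"
    and bd: "p ^ card X * card (aspan S Q) \<le> p ^ n" using d unfolding dd descriptions_def by auto
  have finX: "finite X" using X(1) S(2) finite_subset by blast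
  have finQ: "finite (aspan S Q)"
    using finite_subset[OF additive_subgroup.a_subset[OF additive_subgroup_aspan[OF Q]] S(2)] .
  have finp: "finite (ordered_pairs X)"
    unfolding ordered_pairs_def by (rule finite_subset[of _ "X \<times> X"]) (use finX in auto)
  show "finite (product_tables S d)" unfolding dd product_tables_def using finp finQ by (simp add: finite_PiE)
  have "p ^ n = p ^ card X * p ^ (n - card X)" using X(2) by (simp add: power_add[symmetric])
  then have cQ: "card (aspan S Q) \<le> p ^ (n - card X)" using bd prime_gt_0_nat[OF p] by simp
  have "card (product_tables S d) = card (aspan S Q) ^ card (ordered_pairs X)"
    unfolding dd product_tables_def using finp by (simp add: card_PiE)
  also have "\<dots> \<le> (p ^ (n - card X)) ^ card (ordered_pairs X)" using cQ by (intro power_mono) auto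
  also have "\<dots> = p ^ ((n - card X) * (card X * (card X + 1) div 2))"
    unfolding ordered_pairs_def card_ordered_pairs[OF finX] by (simp only: power_mult)
  also have "\<dots> \<le> p ^ b" using b[OF X(2)] prime_ge_1_nat[OF p] by (intro power_increasing)
  finally show "card (product_tables S d) \<le> p ^ b" .
qed

definition description_of :: "nat \<Rightarrow> nat \<Rightarrow> nat \<Rightarrow> nat ring \<Rightarrow>
    nat set \<times> nat set \<times> nat set \<times> (nat \<times> nat \<times> nat) set" where
  "description_of p n m R = (SOME d. short_description p n m R d)"

definition ring_data :: "nat \<Rightarrow> nat \<Rightarrow> nat \<Rightarrow> nat ring \<Rightarrow> nat list list \<times>
    (nat set \<times> nat set \<times> nat set \<times> (nat \<times> nat \<times> nat) set) \<times> (nat \<times> nat \<Rightarrow> nat)" where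
  "ring_data p n m R = (let T = transported p n R; d = description_of p n m T in
     (structure_code p n R, d,
      restrict (\<lambda>(x, y). x \<otimes>\<^bsub>T\<^esub> y) (ordered_pairs (fst (snd (snd d))))))"

lemma add_monoid_cong:
  "carrier T = carrier S \<Longrightarrow> add T = add S \<Longrightarrow> zero T = zero S \<Longrightarrow> add_monoid T = add_monoid S"
  by simp

lemma ring_iso_id:
  assumes "cring R" "cring S" and c: "carrier S = carrier R" and a: "add S = add R"
    and m: "\<And>a b. a \<in> carrier R \<Longrightarrow> b \<in> carrier R \<Longrightarrow> a \<otimes>\<^bsub>R\<^esub> b = a \<otimes>\<^bsub>S\<^esub> b"
  shows "R \<simeq> S"
proof -
  interpret R: cring R by (rule assms(1))
  interpret S: cring S by (rule assms(2))
  have one: "\<one>\<^bsub>R\<^esub> \<in> carrier R" "\<one>\<^bsub>S\<^esub> \<in> carrier R" using R.one_closed S.one_closed c by simp_all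
  have "\<one>\<^bsub>R\<^esub> = \<one>\<^bsub>R\<^esub> \<otimes>\<^bsub>S\<^esub> \<one>\<^bsub>S\<^esub>" using S.r_one one(1) c by simp
  also have "\<dots> = \<one>\<^bsub>S\<^esub>" using m[OF one] R.l_one[OF one(2)] by simp
  finally have "id \<in> ring_iso R S" using c a m by (intro ring_iso_memI) auto
  then show ?thesis unfolding is_ring_iso_def by blast
qed

lemma short_description_unique:
  assumes R: "short_description p n m R d" "cring R" and S: "short_description p n m S d" "cring S"
    and same: "carrier S = carrier R" "add S = add R" "zero S = zero R"
    and tab: "\<And>x y. (x, y) \<in> ordered_pairs (fst (snd (snd d))) \<Longrightarrow> x \<otimes>\<^bsub>R\<^esub> y = x \<otimes>\<^bsub>S\<^esub> y"
  shows "R \<simeq> S"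
proof (rule ring_iso_id[OF R(2) S(2) same(1,2)])
  interpret R: cring R by (rule R(2))
  interpret S: cring S by (rule S(2))
  obtain B Q X P where d: "d = (B, Q, X, P)" by (cases d) auto
  have span: "aspan S B = aspan R B" using add_monoid_cong[OF same] by simp
  have sag: "same_additive_group R S"
    using R(2) S(2) same by (simp add: same_additive_group_def same_additive_group_axioms_def)
  have 1: "\<forall>a\<in>aspan R B. \<forall>b\<in>aspan R B. a \<otimes>\<^bsub>S\<^esub> b \<in> aspan R B"
    using S(1) unfolding d short_description_def prod.case span by (elim conjE)
  have X: "X \<subseteq> carrier R" using R(1) unfolding d short_description_def prod.case by (elim conjE)
  have 2: "x \<otimes>\<^bsub>R\<^esub> y = x \<otimes>\<^bsub>S\<^esub> y" if xy: "x \<in> X" "y \<in> X" for x y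
  proof (cases "x \<le> y")
    case True
    then show ?thesis using tab[of x y] xy unfolding d ordered_pairs_def by simp
  next
    case False
    then have "y \<otimes>\<^bsub>R\<^esub> x = y \<otimes>\<^bsub>S\<^esub> x" using tab[of y x] xy unfolding d ordered_pairs_def by simp
    moreover have "x \<in> carrier R" "y \<in> carrier R" using X xy by auto
    ultimately show ?thesis using R.m_comm[of x y] S.m_comm[of x y] same(1) by simp
  qed
  have "P \<subseteq> (\<lambda>(a, b). (a, b, a \<otimes>\<^bsub>S\<^esub> b)) ` (carrier S \<times> carrier S)"
    using S(1) unfolding d short_description_def prod.case by (elim conjE)
  then have 3: "\<forall>(a, b, c)\<in>P. c = a \<otimes>\<^bsub>S\<^esub> b" by auto
  have det: "\<forall>R'. same_additive_group R R' \<longrightarrow> (\<forall>a\<in>aspan R B. \<forall>b\<in>aspan R B. a \<otimes>\<^bsub>R'\<^esub> b \<in> aspan R B) \<longrightarrow>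
        (\<forall>x\<in>X. \<forall>y\<in>X. x \<otimes>\<^bsub>R\<^esub> y = x \<otimes>\<^bsub>R'\<^esub> y) \<longrightarrow> (\<forall>(a, b, c)\<in>P. c = a \<otimes>\<^bsub>R'\<^esub> b) \<longrightarrow>
        (\<forall>a\<in>carrier R. \<forall>b\<in>carrier R. a \<otimes>\<^bsub>R\<^esub> b = a \<otimes>\<^bsub>R'\<^esub> b)"
    using R(1) unfolding d short_description_def prod.case by (elim conjE)
  have "\<forall>a\<in>carrier R. \<forall>b\<in>carrier R. a \<otimes>\<^bsub>R\<^esub> b = a \<otimes>\<^bsub>S\<^esub> b"
    using det[rule_format, OF sag] 1 2 3 by auto
  then show "a \<otimes>\<^bsub>R\<^esub> b = a \<otimes>\<^bsub>S\<^esub> b" if "a \<in> carrier R" "b \<in> carrier R" for a b using that by blast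
qed

theorem num_crings_le:
  assumes p: "prime p" and n: "0 < n" and nt: "n \<le> t * t" and nk: "n \<le> 2 ^ k"
    and m: "m = n * (t + k + 2) + n + n * t"
    and b: "\<And>d. d \<le> n \<Longrightarrow> (n - d) * (d * (d + 1) div 2) \<le> b"
  shows "num_crings (p ^ n) \<le> p ^ (n * (n + 1) + (6 * n * n + 4 * n * m) + b)"
proof -
  have t: "0 < t" using n nt by (cases t) auto
  let ?C = "crings_of_order (p ^ n)"
  let ?K = "structure_code p n ` ?C"
  let ?S = "base_ring p n"
  define D where "D = Sigma ?K (\<lambda>c. Sigma (descriptions p n m (?S c)) (product_tables (?S c)))"
  have base: "cring (?S c)" "finite (carrier (?S c))" "order (?S c) = p ^ n" if "c \<in> ?K" for c
    using that base_ring(1)[of _ p n] by (auto simp: crings_of_order_def)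
  have inner: "finite (Sigma (descriptions p n m (?S c)) (product_tables (?S c)))"
    "card (Sigma (descriptions p n m (?S c)) (product_tables (?S c))) \<le> p ^ (6 * n * n + 4 * n * m) * p ^ b"
    if c: "c \<in> ?K" for c
  proof -
    note dB = descriptions_bound[OF p base(2,3)[OF c] n, of m]
    note tB = product_tables_bound[OF p base(1,2)[OF c] _ b]
    show "finite (Sigma (descriptions p n m (?S c)) (product_tables (?S c)))"
      using dB(1) tB(1) by (intro finite_SigmaI)
    have "card (Sigma (descriptions p n m (?S c)) (product_tables (?S c))) =
        (\<Sum>d\<in>descriptions p n m (?S c). card (product_tables (?S c) d))"
      using dB(1) tB(1) by (intro card_SigmaI) auto
    also have "\<dots> \<le> card (descriptions p n m (?S c)) * p ^ b"
      using sum_bounded_above[of "descriptions p n m (?S c)" "\<lambda>d. card (product_tables (?S c) d)" "p ^ b"]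
        tB(2) by simp
    also have "\<dots> \<le> p ^ (6 * n * n + 4 * n * m) * p ^ b" using dB(2) by (rule mult_le_mono1)
    finally show "card (Sigma (descriptions p n m (?S c)) (product_tables (?S c)))
        \<le> p ^ (6 * n * n + 4 * n * m) * p ^ b" .
  qed
  note cB = structure_code_bound[OF p, of n]
  have finD: "finite D" unfolding D_def by (rule finite_SigmaI[OF cB(1) inner(1)])
  have "card D = (\<Sum>c\<in>?K. card (Sigma (descriptions p n m (?S c)) (product_tables (?S c))))"
    unfolding D_def using cB(1) inner(1) by (intro card_SigmaI) auto
  also have "\<dots> \<le> card ?K * (p ^ (6 * n * n + 4 * n * m) * p ^ b)"
    using sum_bounded_above[of ?K _ "p ^ (6 * n * n + 4 * n * m) * p ^ b"] inner(2) by simp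
  also have "\<dots> \<le> p ^ (n * (n + 1)) * (p ^ (6 * n * n + 4 * n * m) * p ^ b)"
    using cB(2) by (rule mult_le_mono1)
  also have "\<dots> = p ^ (n * (n + 1) + (6 * n * n + 4 * n * m) + b)"
    by (simp only: power_add mult.assoc)
  finally have cardD: "card D \<le> p ^ (n * (n + 1) + (6 * n * n + 4 * n * m) + b)" .
  have desc: "short_description p n m (transported p n R) (description_of p n m (transported p n R))"
    if R: "R \<in> ?C" for R
  proof -
    note T = transported[OF p R]
    have "finite (carrier (transported p n R))" "order (transported p n R) = p ^ n"
      using T(3) base[of "structure_code p n R"] R by (simp_all add: order_def)
    then have "\<exists>d. short_description p n m (transported p n R) d"
      unfolding m using T(1) by (intro short_description_exists p nt t nk)
    then show ?thesis unfolding description_of_def by (rule someI_ex)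
  qed
  have "ring_data p n m ` ?C \<subseteq> D"
  proof (rule image_subsetI)
    fix R assume R: "R \<in> ?C"
    let ?T = "transported p n R"
    note T = transported[OF p R]
    interpret T: cring ?T by (rule T(1))
    obtain B Q X P where d: "description_of p n m ?T = (B, Q, X, P)"
      by (cases "description_of p n m ?T") auto
    note sd = desc[OF R, unfolded d short_description_def prod.case]
    have am: "add_monoid (?S (structure_code p n R)) = add_monoid ?T"
      using T(3-5) by (intro add_monoid_cong) simp_all
    have finT: "finite (carrier ?T)" using T(3) base[of "structure_code p n R"] R by simp
    have Q: "Q \<subseteq> carrier ?T" using sd by (elim conjE)
    have X: "X \<subseteq> carrier ?T" using sd by (elim conjE)
    have B: "B \<subseteq> carrier ?T" using sd by (elim conjE)
    have cB: "card B \<le> n" using sd by (elim conjE)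
    have cQ: "card Q \<le> n" using sd by (elim conjE)
    have cP: "card P \<le> m" using sd by (elim conjE)
    have bd: "p ^ card X * card (aspan ?T Q) \<le> p ^ n" using sd by (elim conjE)
    have XX: "\<forall>x\<in>X. \<forall>y\<in>X. x \<otimes>\<^bsub>?T\<^esub> y \<in> aspan ?T Q" using sd by (elim conjE)
    have P: "P \<subseteq> (\<lambda>(a, b). (a, b, a \<otimes>\<^bsub>?T\<^esub> b)) ` (carrier ?T \<times> carrier ?T)" using sd by (elim conjE)
    have P': "P \<subseteq> carrier ?T \<times> carrier ?T \<times> carrier ?T" using P by auto
    have as: "additive_subgroup (aspan ?T Q) ?T" by (rule T.additive_subgroup_aspan[OF Q])
    have "1 \<le> card (aspan ?T Q)"
      using additive_subgroup.zero_closed[OF as] finite_subset[OF additive_subgroup.a_subset[OF as] finT]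
      by (metis One_nat_def Suc_leI card_gt_0_iff empty_iff)
    then have "p ^ card X \<le> p ^ card X * card (aspan ?T Q)" by simp
    then have "p ^ card X \<le> p ^ n" using bd by linarith
    then have cX: "card X \<le> n" using power_le_imp_le_exp prime_gt_1_nat[OF p] by blast
    have "(B, Q, X, P) \<in> descriptions p n m (?S (structure_code p n R))"
      unfolding descriptions_def am using B cB Q cQ X cX bd P' cP T(3) by simp
    moreover have "restrict (\<lambda>(x, y). x \<otimes>\<^bsub>?T\<^esub> y) (ordered_pairs X) \<in>
        product_tables (?S (structure_code p n R)) (B, Q, X, P)"
      unfolding product_tables_def am prod.case using XX by (auto simp: ordered_pairs_def)
    ultimately show "ring_data p n m R \<in> D"
      unfolding ring_data_def Let_def D_def d using R by simp
  qed
  moreover have "(R, S) \<in> ring_iso_rel (p ^ n)"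
    if R: "R \<in> ?C" and S: "S \<in> ?C" and eq: "ring_data p n m R = ring_data p n m S" for R S
  proof -
    let ?T = "transported p n R" and ?U = "transported p n S"
    note T = transported[OF p R] and U = transported[OF p S]
    have code: "structure_code p n R = structure_code p n S"
      using eq unfolding ring_data_def Let_def prod.inject by (elim conjE)
    have d: "description_of p n m ?T = description_of p n m ?U"
      using eq unfolding ring_data_def Let_def prod.inject by (elim conjE)
    have r: "restrict (\<lambda>(x, y). x \<otimes>\<^bsub>?T\<^esub> y) (ordered_pairs (fst (snd (snd (description_of p n m ?T))))) =
        restrict (\<lambda>(x, y). x \<otimes>\<^bsub>?U\<^esub> y) (ordered_pairs (fst (snd (snd (description_of p n m ?U)))))"
      using eq unfolding ring_data_def Let_def prod.inject by (elim conjE)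
    have "?T \<simeq> ?U"
    proof (rule short_description_unique[OF desc[OF R] T(1) desc[OF S, folded d] U(1)])
      show "carrier ?U = carrier ?T" "add ?U = add ?T" "zero ?U = zero ?T"
        using T(3-5) U(3-5) code by simp_all
      fix x y assume "(x, y) \<in> ordered_pairs (fst (snd (snd (description_of p n m ?T))))"
      then show "x \<otimes>\<^bsub>?T\<^esub> y = x \<otimes>\<^bsub>?U\<^esub> y" using fun_cong[OF r, of "(x, y)"] unfolding d by simp
    qed
    have rR: "ring R" "ring S" using R S cring.axioms(1) unfolding crings_of_order_def by auto
    have "R \<simeq> ?U" by (rule ring_iso_trans[OF T(2) \<open>?T \<simeq> ?U\<close>])
    moreover have "?U \<simeq> S" by (rule ring_iso_sym[OF rR(2) U(2)])
    ultimately have "R \<simeq> S" by (rule ring_iso_trans)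
    then show ?thesis using R S unfolding ring_iso_rel_def by simp
  qed
  ultimately have "card (?C // ring_iso_rel (p ^ n)) \<le> card D"
    by (intro card_quotient_le[OF equiv_ring_iso_rel finD])
  then show ?thesis unfolding num_crings_def using cardD by linarith
qed

section \<open>Rings from symmetric bilinear maps\<close>

definition reduce :: "nat \<Rightarrow> nat \<Rightarrow> (nat \<Rightarrow> int) \<Rightarrow> nat \<Rightarrow> int" where
  "reduce p n f = restrict (\<lambda>k. f k mod int p) {..<n}"

text \<open>Coordinate \<open>0\<close> is the scalar part; the products of the coordinates \<open>1..d\<close>,
  with structure constants \<open>b\<close>, land in the coordinates above \<open>d\<close>.\<close>

definition null3_mult :: "nat \<Rightarrow> (nat \<Rightarrow> nat \<Rightarrow> nat \<Rightarrow> int) \<Rightarrow> (nat \<Rightarrow> int) \<Rightarrow> (nat \<Rightarrow> int) \<Rightarrow> nat \<Rightarrow> int" where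
  "null3_mult d b f g k = (if k = 0 then f 0 * g 0 else f 0 * g k + f k * g 0 +
     (if k \<le> d then 0 else \<Sum>i\<in>{1..d}. \<Sum>j\<in>{1..d}. b i j k * f i * g j))"

definition null3_ring :: "nat \<Rightarrow> nat \<Rightarrow> nat \<Rightarrow> (nat \<Rightarrow> nat \<Rightarrow> nat \<Rightarrow> int) \<Rightarrow> (nat \<Rightarrow> int) ring" where
  "null3_ring p n d b = \<lparr>carrier = {..<n} \<rightarrow>\<^sub>E {0..<int p},
     mult = (\<lambda>f g. reduce p n (null3_mult d b f g)), one = reduce p n (\<lambda>k. if k = 0 then 1 else 0),
     zero = reduce p n (\<lambda>k. 0), add = (\<lambda>f g. reduce p n (\<lambda>k. f k + g k))\<rparr>"

lemma reduce_carrier: "0 < p \<Longrightarrow> reduce p n f \<in> {..<n} \<rightarrow>\<^sub>E {0..<int p}"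
  unfolding reduce_def by auto

lemma reduce_id: "f \<in> {..<n} \<rightarrow>\<^sub>E {0..<int p} \<Longrightarrow> reduce p n f = f"
  unfolding reduce_def by (intro ext) (auto simp: restrict_def PiE_def Pi_def extensional_def)

lemma reduce_eqI: "(\<And>k. k < n \<Longrightarrow> [f k = g k] (mod int p)) \<Longrightarrow> reduce p n f = reduce p n g"
  unfolding reduce_def cong_def by (intro restrict_ext) auto

lemma reduce_cong: "k < n \<Longrightarrow> [reduce p n f k = f k] (mod int p)"
  unfolding reduce_def cong_def by simp

lemma null3_mult_cong:
  assumes "\<And>k. k < n \<Longrightarrow> [f k = f' k] (mod m)" "\<And>k. k < n \<Longrightarrow> [g k = g' k] (mod m)" "d < n" "k < n"
  shows "[null3_mult d b f g k = null3_mult d b f' g' k] (mod m)"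
proof -
  have "[(\<Sum>i\<in>{1..d}. \<Sum>j\<in>{1..d}. b i j k * f i * g j) = (\<Sum>i\<in>{1..d}. \<Sum>j\<in>{1..d}. b i j k * f' i * g' j)] (mod m)"
    using assms by (intro cong_sum cong_mult cong_refl) auto
  then show ?thesis unfolding null3_mult_def
    using assms by (auto intro!: cong_add cong_mult)
qed

lemma null3_mult_assoc:
  assumes "\<And>i j. b i j = b j i"
  shows "null3_mult d b (null3_mult d b f g) h k = null3_mult d b f (null3_mult d b g h) k"
proof -
  let ?M = "null3_mult d b"
  define B where "B f g = (\<Sum>i\<in>{1..d}. \<Sum>j\<in>{1..d}. b i j k * f i * g j)" for f g :: "nat \<Rightarrow> int"
  have M: "?M f g i = f 0 * g i + f i * g 0" if "i \<in> {1..d}" for f g i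
    using that by (simp add: null3_mult_def)
  have "B (?M f g) h = (\<Sum>i\<in>{1..d}. \<Sum>j\<in>{1..d}. b i j k * (f 0 * g i + f i * g 0) * h j)"
    unfolding B_def by (intro sum.cong refl) (simp only: M)
  then have 1: "B (?M f g) h = f 0 * B g h + g 0 * B f h"
    by (simp add: B_def sum_distrib_left sum.distrib[symmetric] algebra_simps)
  have "B f (?M g h) = (\<Sum>i\<in>{1..d}. \<Sum>j\<in>{1..d}. b i j k * f i * (g 0 * h j + g j * h 0))"
    unfolding B_def by (intro sum.cong refl) (simp only: M)
  then have 2: "B f (?M g h) = g 0 * B f h + h 0 * B f g"
    by (simp add: B_def sum_distrib_left sum.distrib[symmetric] algebra_simps)
  have M': "?M f g k = (if k = 0 then f 0 * g 0 else f 0 * g k + f k * g 0 + (if k \<le> d then 0 else B f g))"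
    for f g by (simp add: null3_mult_def B_def)
  have M0: "?M f g 0 = f 0 * g 0" for f g by (simp add: null3_mult_def)
  show ?thesis by (simp add: M'[of "?M f g"] M'[of f] M0 1 2 M' algebra_simps)
qed

lemma null3_mult_commute:
  assumes "\<And>i j. b i j = b j i"
  shows "null3_mult d b f g k = null3_mult d b g f k"
proof -
  have "(\<Sum>i\<in>{1..d}. \<Sum>j\<in>{1..d}. b i j k * f i * g j) = (\<Sum>i\<in>{1..d}. \<Sum>j\<in>{1..d}. b i j k * g i * f j)"
    by (subst sum.swap) (simp add: assms[of _ _] mult.commute mult.left_commute cong: sum.cong)
  then show ?thesis by (simp add: null3_mult_def)
qed

lemma cring_null3_ring:
  assumes p: "1 < p" and d: "d < n" and sym: "\<And>i j. b i j = b j i"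
  shows "cring (null3_ring p n d b)"
proof -
  have p0: "0 < p" using p by simp
  note rc = reduce_carrier[OF p0]
  note rr = reduce_cong[of _ n p]
  have mc: "[null3_mult d b f g k = null3_mult d b f' g' k] (mod int p)"
    if "\<And>k. k < n \<Longrightarrow> [f k = f' k] (mod int p)" "\<And>k. k < n \<Longrightarrow> [g k = g' k] (mod int p)" "k < n" for f f' g g' k
    using null3_mult_cong[OF that(1,2) d that(3)] .
  show ?thesis
  proof (rule cringI)
    show "abelian_group (null3_ring p n d b)"
    proof (rule abelian_groupI; unfold null3_ring_def ring.simps partial_object.simps monoid.simps)
      fix f g h assume f: "f \<in> {..<n} \<rightarrow>\<^sub>E {0..<int p}"
        and g: "g \<in> {..<n} \<rightarrow>\<^sub>E {0..<int p}" and h: "h \<in> {..<n} \<rightarrow>\<^sub>E {0..<int p}"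
      show "reduce p n (\<lambda>k. reduce p n (\<lambda>k. f k + g k) k + h k) =
          reduce p n (\<lambda>k. f k + reduce p n (\<lambda>k. g k + h k) k)"
      proof (rule reduce_eqI)
        fix k assume k: "k < n"
        have "[reduce p n (\<lambda>k. f k + g k) k + h k = f k + (g k + h k)] (mod int p)"
          unfolding add.assoc[symmetric] by (intro cong_add rr k cong_refl)
        moreover have "[f k + (g k + h k) = f k + reduce p n (\<lambda>k. g k + h k) k] (mod int p)"
          by (intro cong_add cong_sym[OF rr] k cong_refl)
        ultimately show "[reduce p n (\<lambda>k. f k + g k) k + h k = f k + reduce p n (\<lambda>k. g k + h k) k] (mod int p)"
          by (rule cong_trans)
      qed
    next
      fix f g assume f: "f \<in> {..<n} \<rightarrow>\<^sub>E {0..<int p}"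
      show "reduce p n (\<lambda>k. f k + g k) = reduce p n (\<lambda>k. g k + f k)" by (simp add: add.commute)
    next
      fix f assume f: "f \<in> {..<n} \<rightarrow>\<^sub>E {0..<int p}"
      have "reduce p n (\<lambda>k. reduce p n (\<lambda>k. 0) k + f k) = reduce p n f"
        by (rule reduce_eqI) (simp add: reduce_def)
      then show "reduce p n (\<lambda>k. reduce p n (\<lambda>k. 0) k + f k) = f" using reduce_id[OF f] by simp
      have "reduce p n (\<lambda>k. reduce p n (\<lambda>k. - f k) k + f k) = reduce p n (\<lambda>k. 0)"
      proof (rule reduce_eqI)
        fix k assume k: "k < n"
        have "[reduce p n (\<lambda>k. - f k) k + f k = - f k + f k] (mod int p)"
          by (intro cong_add rr k cong_refl)
        then show "[reduce p n (\<lambda>k. - f k) k + f k = 0] (mod int p)" by simp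
      qed
      then show "\<exists>g\<in>{..<n} \<rightarrow>\<^sub>E {0..<int p}. reduce p n (\<lambda>k. g k + f k) = reduce p n (\<lambda>k. 0)"
        using rc by blast
    qed (use rc in auto)
    show "comm_monoid (null3_ring p n d b)"
    proof (rule comm_monoidI; unfold null3_ring_def partial_object.simps monoid.simps)
      fix f g h assume f: "f \<in> {..<n} \<rightarrow>\<^sub>E {0..<int p}"
        and g: "g \<in> {..<n} \<rightarrow>\<^sub>E {0..<int p}" and h: "h \<in> {..<n} \<rightarrow>\<^sub>E {0..<int p}"
      show "reduce p n (null3_mult d b (reduce p n (null3_mult d b f g)) h) =
          reduce p n (null3_mult d b f (reduce p n (null3_mult d b g h)))"
      proof (rule reduce_eqI)
        fix k assume k: "k < n"
        have "[null3_mult d b (reduce p n (null3_mult d b f g)) h k = null3_mult d b f (null3_mult d b g h) k] (mod int p)"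
          unfolding null3_mult_assoc[of b, OF sym, symmetric] by (intro mc rr k cong_refl)
        moreover have "[null3_mult d b f (null3_mult d b g h) k = null3_mult d b f (reduce p n (null3_mult d b g h)) k] (mod int p)"
          by (intro mc cong_sym[OF rr] k cong_refl)
        ultimately show "[null3_mult d b (reduce p n (null3_mult d b f g)) h k =
            null3_mult d b f (reduce p n (null3_mult d b g h)) k] (mod int p)"
          by (rule cong_trans)
      qed
    next
      fix f g assume "f \<in> {..<n} \<rightarrow>\<^sub>E {0..<int p}" "g \<in> {..<n} \<rightarrow>\<^sub>E {0..<int p}"
      show "reduce p n (null3_mult d b f g) = reduce p n (null3_mult d b g f)"
        by (rule reduce_eqI) (simp add: null3_mult_commute[of b, OF sym])
    next
      fix f assume f: "f \<in> {..<n} \<rightarrow>\<^sub>E {0..<int p}"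
      have "reduce p n (null3_mult d b (reduce p n (\<lambda>k. if k = 0 then 1 else 0)) f) = reduce p n f"
      proof (rule reduce_eqI)
        fix k assume k: "k < n"
        have "[null3_mult d b (reduce p n (\<lambda>k. if k = 0 then 1 else 0)) f k =
            null3_mult d b (\<lambda>k. if k = 0 then 1 else 0) f k] (mod int p)"
          by (intro mc rr k cong_refl)
        also have "null3_mult d b (\<lambda>k. if k = 0 then 1 else 0) f k = f k"
          by (auto simp: null3_mult_def intro!: sum.neutral)
        finally show "[null3_mult d b (reduce p n (\<lambda>k. if k = 0 then 1 else 0)) f k = f k] (mod int p)" .
      qed
      then show "reduce p n (null3_mult d b (reduce p n (\<lambda>k. if k = 0 then 1 else 0)) f) = f"
        using reduce_id[OF f] by simp
    qed (use rc in auto)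
  next
    fix f g h assume "f \<in> carrier (null3_ring p n d b)" "g \<in> carrier (null3_ring p n d b)"
      "h \<in> carrier (null3_ring p n d b)"
    have "reduce p n (null3_mult d b (reduce p n (\<lambda>k. f k + g k)) h) =
        reduce p n (\<lambda>k. reduce p n (null3_mult d b f h) k + reduce p n (null3_mult d b g h) k)"
    proof (rule reduce_eqI)
      fix k assume k: "k < n"
      have "[null3_mult d b (reduce p n (\<lambda>k. f k + g k)) h k = null3_mult d b (\<lambda>k. f k + g k) h k] (mod int p)"
        by (intro mc rr k cong_refl)
      also have "null3_mult d b (\<lambda>k. f k + g k) h k = null3_mult d b f h k + null3_mult d b g h k"
        by (simp add: null3_mult_def algebra_simps sum.distrib)
      also have "[\<dots> = reduce p n (null3_mult d b f h) k + reduce p n (null3_mult d b g h) k] (mod int p)"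
        by (intro cong_add cong_sym[OF rr] k)
      finally show "[null3_mult d b (reduce p n (\<lambda>k. f k + g k)) h k =
        reduce p n (null3_mult d b f h) k + reduce p n (null3_mult d b g h) k] (mod int p)" .
    qed
    then show "(f \<oplus>\<^bsub>null3_ring p n d b\<^esub> g) \<otimes>\<^bsub>null3_ring p n d b\<^esub> h =
      f \<otimes>\<^bsub>null3_ring p n d b\<^esub> h \<oplus>\<^bsub>null3_ring p n d b\<^esub> g \<otimes>\<^bsub>null3_ring p n d b\<^esub> h"
      by (simp add: null3_ring_def)
  qed
qed

definition unit_vector :: "nat \<Rightarrow> nat \<Rightarrow> nat \<Rightarrow> nat \<Rightarrow> int" where
  "unit_vector p n i = reduce p n (\<lambda>k. if k = i then 1 else 0)"

lemma additive_maps_agree: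
  assumes p: "1 < p" and S: "abelian_group S"
    and h: "\<And>f. f \<in> {..<n} \<rightarrow>\<^sub>E {0..<int p} \<Longrightarrow> h f \<in> carrier S"
      "\<And>f g. f \<in> {..<n} \<rightarrow>\<^sub>E {0..<int p} \<Longrightarrow> g \<in> {..<n} \<rightarrow>\<^sub>E {0..<int p} \<Longrightarrow>
        h (reduce p n (\<lambda>k. f k + g k)) = h f \<oplus>\<^bsub>S\<^esub> h g"
    and h': "\<And>f. f \<in> {..<n} \<rightarrow>\<^sub>E {0..<int p} \<Longrightarrow> h' f \<in> carrier S"
      "\<And>f g. f \<in> {..<n} \<rightarrow>\<^sub>E {0..<int p} \<Longrightarrow> g \<in> {..<n} \<rightarrow>\<^sub>E {0..<int p} \<Longrightarrow>
        h' (reduce p n (\<lambda>k. f k + g k)) = h' f \<oplus>\<^bsub>S\<^esub> h' g"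
    and agree: "\<And>i. i < n \<Longrightarrow> h (unit_vector p n i) = h' (unit_vector p n i)"
    and f: "f \<in> {..<n} \<rightarrow>\<^sub>E {0..<int p}"
  shows "h f = h' f"
proof -
  interpret S: abelian_group S by (rule S)
  have p0: "0 < p" using p by simp
  let ?C = "{..<n} \<rightarrow>\<^sub>E {0..<int p}"
  let ?z = "reduce p n (\<lambda>k. 0)"
  have z: "?z \<in> ?C" by (rule reduce_carrier[OF p0])
  have "reduce p n (\<lambda>k. ?z k + ?z k) = ?z" by (rule reduce_eqI) (simp add: reduce_def)
  then have zero: "\<phi> ?z = \<zero>\<^bsub>S\<^esub>"
    if "\<phi> ?z \<in> carrier S" "\<phi> (reduce p n (\<lambda>k. ?z k + ?z k)) = \<phi> ?z \<oplus>\<^bsub>S\<^esub> \<phi> ?z" for \<phi>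
    using that S.add.l_cancel_one' by metis
  show ?thesis using f
  proof (induction "\<Sum>k<n. nat (f k)" arbitrary: f rule: less_induct)
    case less
    show ?case
    proof (cases "\<exists>k<n. f k \<noteq> 0")
      case False
      then have "f = reduce p n (\<lambda>k. 0)"
        using reduce_id[OF less.prems] reduce_eqI[of n f "\<lambda>k. 0" p] by simp
      then show ?thesis using zero[of h] zero[of h'] h[OF z] h' z h(2)[OF z z] h'(2)[OF z z] by simp
    next
      case True
      then obtain k where k: "k < n" "f k \<noteq> 0" by blast
      have fr: "0 \<le> f j \<and> f j < int p" if "j < n" for j using less.prems that by (auto simp: PiE_def Pi_def)
      have fk: "0 < f k" using fr[OF k(1)] k(2) by linarith
      define f' where "f' = f(k := f k - 1)"
      have f': "f' \<in> ?C" using less.prems k(1) fk fr[OF k(1)] unfolding f'_def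
        by (auto simp: PiE_def Pi_def extensional_def)
      have e: "unit_vector p n k \<in> ?C" unfolding unit_vector_def by (rule reduce_carrier[OF p0])
      have "(\<Sum>j<n. nat (f' j)) < (\<Sum>j<n. nat (f j))"
        using k(1) fk by (intro sum_strict_mono_ex1) (auto simp: f'_def)
      then have IH: "h f' = h' f'" using less.hyps f' by blast
      have "reduce p n (\<lambda>j. f' j + unit_vector p n k j) = reduce p n f"
      proof (rule reduce_eqI)
        fix j assume "j < n"
        then have "f' j + unit_vector p n k j = f j"
          using p by (simp add: f'_def unit_vector_def reduce_def)
        then show "[f' j + unit_vector p n k j = f j] (mod int p)" by simp
      qed
      then have fe: "reduce p n (\<lambda>j. f' j + unit_vector p n k j) = f" using reduce_id[OF less.prems] by simp
      show ?thesis using h(2)[OF f' e] h'(2)[OF f' e] IH agree[OF k(1)] unfolding fe by simp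
    qed
  qed
qed

lemma null3_mult_unit_vectors:
  assumes p: "1 < p" and ij: "i \<in> {1..d}" "j \<in> {1..d}" and k: "d < k" "k < n"
  shows "null3_mult d b (unit_vector p n i) (unit_vector p n j) k = b i j k"
proof -
  have u: "unit_vector p n i l = (if l = i then 1 else 0)" if "l \<in> {1..d}" for i l
    using that p k by (simp add: unit_vector_def reduce_def)
  have "(\<Sum>i'\<in>{1..d}. \<Sum>j'\<in>{1..d}. b i' j' k * unit_vector p n i i' * unit_vector p n j j') =
      (\<Sum>i'\<in>{1..d}. \<Sum>j'\<in>{1..d}. if i' = i then if j' = j then b i' j' k else 0 else 0)"
    by (intro sum.cong refl) (simp add: u)
  also have "\<dots> = (\<Sum>i'\<in>{1..d}. if i' = i then (\<Sum>j'\<in>{1..d}. if j' = j then b i' j' k else 0) else 0)"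
    by (intro sum.cong refl) simp
  also have "\<dots> = b i j k" using ij by (simp add: sum.delta)
  finally show ?thesis using ij k p by (simp add: null3_mult_def unit_vector_def reduce_def)
qed

definition table_tensor :: "((nat \<times> nat) \<times> nat \<Rightarrow> int) \<Rightarrow> nat \<Rightarrow> nat \<Rightarrow> nat \<Rightarrow> int" where
  "table_tensor \<beta> i j k = \<beta> ((min i j, max i j), k)"

theorem num_crings_ge:
  assumes prime: "prime p" and d: "d < n"
  shows "p ^ ((n - 1 - d) * (d * (d + 1) div 2)) \<le> num_crings (p ^ n) * p ^ (n * n)"
proof -
  have p: "1 < p" by (rule prime_gt_1_nat[OF prime])
  then have p0: "0 < p" by simp
  let ?q = "p ^ n" and ?C = "{..<n} \<rightarrow>\<^sub>E {0..<int p}"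
  let ?cls = "crings_of_order ?q // ring_iso_rel ?q"
  define T where "T = ordered_pairs {1..d} \<times> {d<..<n}"
  define \<B> where "\<B> = (T \<rightarrow>\<^sub>E {0..<int p})"
  define A where "A \<beta> = null3_ring p n d (table_tensor \<beta>)" for \<beta>
  have fin1: "finite (ordered_pairs {1..d})"
    unfolding ordered_pairs_def by (rule finite_subset[of _ "{1..d} \<times> {1..d}"]) auto
  then have finT: "finite T" unfolding T_def by simp
  have cT: "card T = (n - 1 - d) * (d * (d + 1) div 2)"
    unfolding T_def ordered_pairs_def card_cartesian_product card_ordered_pairs[OF finite_atLeastAtMost]
    by simp
  have cB: "card \<B> = p ^ ((n - 1 - d) * (d * (d + 1) div 2))"
    unfolding \<B>_def using finT cT by (simp add: card_PiE)
  have Ac: "carrier (A \<beta>) = ?C" for \<beta> unfolding A_def null3_ring_def by simp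
  have Acr: "cring (A \<beta>)" for \<beta>
    unfolding A_def by (rule cring_null3_ring[OF p d]) (auto simp: table_tensor_def min.commute max.commute)
  have fin: "finite (carrier (A \<beta>))" for \<beta> unfolding Ac by (simp add: finite_PiE)
  have ord: "order (A \<beta>) = ?q" for \<beta> unfolding order_def Ac by (simp add: card_PiE)
  have "\<forall>\<beta>. \<exists>S. S \<in> crings_of_order ?q \<and> A \<beta> \<simeq> S"
    using finite_cring_has_copy[OF Acr fin] unfolding ord by blast
  from choice[OF this] obtain S where S: "S \<beta> \<in> crings_of_order ?q" "A \<beta> \<simeq> S \<beta>" for \<beta> by blast
  define cl where "cl \<beta> = ring_iso_rel ?q `` {S \<beta>}" for \<beta>
  define rep where "rep X = (SOME R. R \<in> X)" for X :: "nat ring set"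
  have cl: "cl \<beta> \<in> ?cls" for \<beta> unfolding cl_def by (rule quotientI[OF S(1)])
  have rep: "rep X \<in> X" if "X \<in> ?cls" for X
    using in_quotient_imp_non_empty[OF equiv_ring_iso_rel that] unfolding rep_def by (simp add: some_in_eq)
  have repc: "rep X \<in> crings_of_order ?q" if "X \<in> ?cls" for X
    using rep[OF that] in_quotient_imp_subset[OF equiv_ring_iso_rel that] by blast
  have "\<forall>\<beta>. \<exists>h. h \<in> ring_iso (A \<beta>) (rep (cl \<beta>))"
  proof
    fix \<beta>
    have "S \<beta> \<simeq> rep (cl \<beta>)" using rep[OF cl, of \<beta>] unfolding cl_def ring_iso_rel_def by blast
    then have "A \<beta> \<simeq> rep (cl \<beta>)" by (rule ring_iso_trans[OF S(2)])
    then show "\<exists>h. h \<in> ring_iso (A \<beta>) (rep (cl \<beta>))" unfolding is_ring_iso_def by blast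
  qed
  from choice[OF this] obtain h where h: "h \<beta> \<in> ring_iso (A \<beta>) (rep (cl \<beta>))" for \<beta> by blast
  note hI = ring_iso_memE[OF h]
  define \<Phi> where "\<Phi> \<beta> = (cl \<beta>, restrict (\<lambda>i. h \<beta> (unit_vector p n i)) {..<n})" for \<beta>
  define D where "D = Sigma ?cls (\<lambda>X. {..<n} \<rightarrow>\<^sub>E carrier (rep X))"
  have uv: "unit_vector p n i \<in> ?C" for i unfolding unit_vector_def by (rule reduce_carrier[OF p0])
  have "\<Phi> ` \<B> \<subseteq> D"
  proof (rule image_subsetI)
    fix \<beta>
    have "restrict (\<lambda>i. h \<beta> (unit_vector p n i)) {..<n} \<in> {..<n} \<rightarrow>\<^sub>E carrier (rep (cl \<beta>))"
      unfolding restrict_PiE_iff using hI(1) uv unfolding Ac by blast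
    then show "\<Phi> \<beta> \<in> D" unfolding \<Phi>_def D_def using cl by simp
  qed
  moreover have "inj_on \<Phi> \<B>"
  proof (rule inj_onI)
    fix \<beta> \<gamma> assume \<beta>: "\<beta> \<in> \<B>" and \<gamma>: "\<gamma> \<in> \<B>" and eq: "\<Phi> \<beta> = \<Phi> \<gamma>"
    have clq: "cl \<beta> = cl \<gamma>" using eq unfolding \<Phi>_def by simp
    let ?R = "rep (cl \<beta>)"
    have crR: "cring ?R" using repc[OF cl] unfolding crings_of_order_def by blast
    have agree: "h \<beta> (unit_vector p n i) = h \<gamma> (unit_vector p n i)" if "i < n" for i
    proof -
      have "restrict (\<lambda>i. h \<beta> (unit_vector p n i)) {..<n} = restrict (\<lambda>i. h \<gamma> (unit_vector p n i)) {..<n}"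
        using eq unfolding \<Phi>_def by simp
      from fun_cong[OF this, of i] show ?thesis using that by simp
    qed
    have hh: "h \<beta> f = h \<gamma> f" if "f \<in> ?C" for f
    proof (rule additive_maps_agree[where h = "h \<beta>" and h' = "h \<gamma>" and n = n and S = ?R,
          OF p _ _ _ _ _ agree that])
      show "abelian_group ?R" using crR by (intro ring.is_abelian_group cring.axioms(1))
    next
      fix f assume f: "f \<in> ?C"
      show "h \<beta> f \<in> carrier ?R" by (rule hI(1)) (simp only: Ac f)
      show "h \<gamma> f \<in> carrier ?R" unfolding clq by (rule hI(1)) (simp only: Ac f)
    next
      fix f g assume f: "f \<in> ?C" and g: "g \<in> ?C"
      have add: "f \<oplus>\<^bsub>A \<delta>\<^esub> g = reduce p n (\<lambda>k. f k + g k)" for \<delta> by (simp add: A_def null3_ring_def)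
      show "h \<beta> (reduce p n (\<lambda>k. f k + g k)) = h \<beta> f \<oplus>\<^bsub>?R\<^esub> h \<beta> g"
        using hI(3)[of f \<beta> g] f g unfolding Ac add by blast
      show "h \<gamma> (reduce p n (\<lambda>k. f k + g k)) = h \<gamma> f \<oplus>\<^bsub>?R\<^esub> h \<gamma> g"
        using hI(3)[of f \<gamma> g] f g unfolding Ac add clq by blast
    qed
    have mult: "f \<otimes>\<^bsub>A \<delta>\<^esub> g = reduce p n (null3_mult d (table_tensor \<delta>) f g)" for f g \<delta>
      by (simp add: A_def null3_ring_def)
    have same: "reduce p n (null3_mult d (table_tensor \<beta>) f g) = reduce p n (null3_mult d (table_tensor \<gamma>) f g)"
      if f: "f \<in> ?C" and g: "g \<in> ?C" for f g
    proof -
      let ?x = "reduce p n (null3_mult d (table_tensor \<beta>) f g)"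
        and ?y = "reduce p n (null3_mult d (table_tensor \<gamma>) f g)"
      have xy: "?x \<in> ?C" "?y \<in> ?C" by (rule reduce_carrier[OF p0])+
      have "h \<beta> ?x = h \<beta> f \<otimes>\<^bsub>?R\<^esub> h \<beta> g" using hI(2)[of f \<beta> g] f g unfolding Ac mult by blast
      also have "\<dots> = h \<gamma> f \<otimes>\<^bsub>rep (cl \<gamma>)\<^esub> h \<gamma> g" unfolding clq hh[OF f] hh[OF g] ..
      also have "\<dots> = h \<gamma> ?y" using hI(2)[of f \<gamma> g] f g unfolding Ac mult by simp
      also have "\<dots> = h \<beta> ?y" by (rule hh[OF xy(2), symmetric])
      finally show ?thesis
        using hI(5)[of \<beta>] xy unfolding bij_betw_def inj_on_def Ac by blast
    qed
    show "\<beta> = \<gamma>"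
    proof (rule PiE_ext[OF \<beta>[unfolded \<B>_def] \<gamma>[unfolded \<B>_def]])
      fix t assume t: "t \<in> T"
      obtain i j k where tt: "t = ((i, j), k)" by (metis prod.exhaust)
      have ijk: "i \<in> {1..d}" "j \<in> {1..d}" "i \<le> j" "d < k" "k < n"
        using t unfolding tt T_def ordered_pairs_def by auto
      have val: "reduce p n (null3_mult d (table_tensor \<delta>) (unit_vector p n i) (unit_vector p n j)) k = \<delta> t"
        if \<delta>: "\<delta> \<in> \<B>" for \<delta>
      proof -
        have "\<delta> t \<in> {0..<int p}" by (rule PiE_mem[OF \<delta>[unfolded \<B>_def] t])
        moreover have "table_tensor \<delta> i j k = \<delta> t"
          using ijk(3) by (simp add: table_tensor_def tt)
        ultimately show ?thesis
          using null3_mult_unit_vectors[OF p ijk(1,2,4,5), of "table_tensor \<delta>"] ijk(5)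
          by (simp add: reduce_def)
      qed
      show "\<beta> t = \<gamma> t" using val[OF \<beta>] val[OF \<gamma>] same[OF uv uv] by simp
    qed
  qed
  moreover have repf: "finite (carrier (rep X))" "card (carrier (rep X)) = ?q" if "X \<in> ?cls" for X
    using repc[OF that] unfolding crings_of_order_def order_def by auto
  have finD: "finite D" unfolding D_def
    using finite_iso_classes[of ?q] repf(1) by (intro finite_SigmaI finite_PiE) auto
  ultimately have "card \<B> \<le> card D" using card_inj_on_le[of \<Phi> \<B> D] by blast
  also have "card D = (\<Sum>X\<in>?cls. card ({..<n} \<rightarrow>\<^sub>E carrier (rep X)))"
    unfolding D_def using finite_iso_classes[of ?q] repf(1) by (intro card_SigmaI ballI finite_PiE) auto
  also have "\<dots> = (\<Sum>X\<in>?cls. ?q ^ n)" by (intro sum.cong refl) (simp add: card_PiE repf(2))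
  also have "\<dots> = num_crings ?q * p ^ (n * n)" by (simp add: num_crings_def power_mult)
  finally show ?thesis unfolding cB .
qed

section \<open>Asymptotics\<close>

lemma num_crings_pos:
  assumes p: "prime p"
  shows "0 < num_crings (p ^ n)"
proof (cases n)
  case 0
  define Z :: "nat ring" where "Z = \<lparr>carrier = {0}, mult = (\<lambda>_ _. 0), one = 0, zero = 0, add = (\<lambda>_ _. 0)\<rparr>"
  have "cring Z"
  proof (rule cringI)
    show "abelian_group Z" by (rule abelian_groupI) (auto simp: Z_def)
    show "comm_monoid Z" by (rule comm_monoidI) (auto simp: Z_def)
  qed (auto simp: Z_def)
  then have "Z \<in> crings_of_order (p ^ n)" using 0 by (simp add: crings_of_order_def order_def Z_def)
  then have "crings_of_order (p ^ n) // ring_iso_rel (p ^ n) \<noteq> {}" by (auto simp: quotient_def)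
  then show ?thesis unfolding num_crings_def using finite_iso_classes by (simp add: card_gt_0_iff)
next
  case (Suc j)
  have "0 < p" by (rule prime_gt_0_nat[OF p])
  then have "0 < p ^ ((n - 1 - 0) * (0 * (0 + 1) div 2))" by simp
  also have "\<dots> \<le> num_crings (p ^ n) * p ^ (n * n)" by (rule num_crings_ge[OF p]) (simp add: Suc)
  finally show ?thesis by simp
qed

lemma cubic_bound:
  fixes x y :: real
  assumes "0 \<le> x" "0 \<le> y"
  shows "(x - y) * y ^ 2 \<le> 4 / 27 * x ^ 3"
proof -
  have "0 \<le> (3 * y - 2 * x)\<^sup>2 * (x + 3 * y)" using assms by simp
  also have "\<dots> = 4 * x ^ 3 - 27 * ((x - y) * y ^ 2)"
    by (simp add: power2_eq_square power3_eq_cube algebra_simps)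
  finally show ?thesis by simp
qed

lemma log_num_crings_le:
  assumes p: "prime p" and n: "0 < n"
  shows "log p (num_crings (p ^ n)) \<le> 2 / 27 * real n ^ 3 + 73 * real n powr (8 / 3)"
proof -
  have p1: "1 < p" by (rule prime_gt_1_nat[OF p])
  define t where "t = nat \<lceil>sqrt n\<rceil>"
  have "real t = of_int \<lceil>sqrt n\<rceil>" unfolding t_def by simp
  then have st: "sqrt n \<le> t" and ts: "t \<le> sqrt n + 1" by linarith+
  have s1: "1 \<le> sqrt n" using n by simp
  have "real n = sqrt n * sqrt n" by simp
  also have "\<dots> \<le> real t * real t" using st by (intro mult_mono) auto
  finally have nt: "n \<le> t * t" using of_nat_le_iff[where ?'a = real, of n "t * t"] by simp
  have "t * t \<le> 2 ^ t * 2 ^ t" using less_exp[of t] by (intro mult_le_mono) auto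
  then have nk: "n \<le> 2 ^ (2 * t)" using nt by (simp add: mult_2 power_add)
  have t1: "1 \<le> t" using st s1 by linarith
  define f where "f d = (n - d) * (d * (d + 1) div 2)" for d
  define b where "b = Max (f ` {..n})"
  have fb: "f d \<le> b" if "d \<le> n" for d unfolding b_def using that by (intro Max_ge) auto
  have "b \<in> f ` {..n}" unfolding b_def by (intro Max_in) auto
  then obtain d where d: "d \<le> n" "b = f d" by auto
  define m where "m = n * (t + 2 * t + 2) + n + n * t"
  have m: "m \<le> 7 * n * t"
  proof -
    have "m = 4 * n * t + 3 * n" unfolding m_def by (simp add: algebra_simps)
    also have "3 * n \<le> 3 * n * t" using t1 by simp
    finally show ?thesis by simp
  qed
  let ?e = "n * (n + 1) + (6 * n * n + 4 * n * m) + b"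
  have e: "?e \<le> 36 * (n * n * t) + b"
  proof -
    have "4 * n * m \<le> 4 * n * (7 * n * t)" using m by (intro mult_le_mono2)
    moreover have "4 * n * (7 * n * t) = 28 * (n * n * t)" "n * (n + 1) = n * n + n" "6 * n * n = 6 * (n * n)"
      by simp_all
    moreover have "n * n \<le> n * n * t" "n \<le> n * n" using t1 n by simp_all
    ultimately show ?thesis by linarith
  qed
  have "num_crings (p ^ n) \<le> p ^ ?e"
    by (rule num_crings_le[OF p n nt nk m_def]) (use fb in \<open>simp add: f_def\<close>)
  then have "real (num_crings (p ^ n)) \<le> real p ^ ?e" by (metis of_nat_le_iff of_nat_power)
  then have "log p (num_crings (p ^ n)) \<le> log p (real p ^ ?e)"
    using p1 num_crings_pos[OF p, of n] by (subst log_le_cancel_iff) auto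
  also have "\<dots> = real ?e" using p1 by (simp add: log_nat_power del: of_nat_add of_nat_mult)
  also have "\<dots> \<le> real (36 * (n * n * t) + b)" using e by (simp only: of_nat_le_iff)
  also have "\<dots> = 36 * (real n ^ 2 * real t) + real b" by (simp add: power2_eq_square)
  finally have 1: "log p (num_crings (p ^ n)) \<le> 36 * (real n ^ 2 * real t) + real b" .
  have sq: "real n ^ 2 * sqrt n \<le> real n powr (8 / 3)"
  proof -
    have "real n ^ 2 * sqrt n = real n powr 2 * real n powr (1 / 2)" using n by (simp add: powr_half_sqrt)
    also have "\<dots> = real n powr (2 + 1 / 2)" by (simp only: powr_add)
    also have "\<dots> \<le> real n powr (8 / 3)" using n by (intro powr_mono) auto
    finally show ?thesis .
  qed
  have "real t \<le> 2 * sqrt n" using ts s1 by linarith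
  then have "real n ^ 2 * real t \<le> real n ^ 2 * (2 * sqrt n)" by (intro mult_left_mono) auto
  then have 2: "36 * (real n ^ 2 * real t) \<le> 72 * real n powr (8 / 3)" using sq by linarith
  have "real (d * (d + 1) div 2) = real d * (real d + 1) / 2"
    by (subst real_of_nat_div) (auto simp: algebra_simps)
  then have "real b = (real n - real d) * (real d * (real d + 1) / 2)"
    unfolding d(2) f_def using d(1) by (simp add: of_nat_diff)
  also have "\<dots> = ((real n - real d) * real d ^ 2) / 2 + ((real n - real d) * real d) / 2"
    by (simp add: power2_eq_square field_simps)
  also have "\<dots> \<le> (4 / 27 * real n ^ 3) / 2 + (real n * real n) / 2"
  proof (rule add_mono)
    show "((real n - real d) * real d ^ 2) / 2 \<le> (4 / 27 * real n ^ 3) / 2"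
      using cubic_bound[of "real n" "real d"] by simp
    have "(real n - real d) * real d \<le> real n * real n" using d(1) by (intro mult_mono) auto
    then show "((real n - real d) * real d) / 2 \<le> (real n * real n) / 2" by simp
  qed
  finally have 3: "real b \<le> 2 / 27 * real n ^ 3 + real n ^ 2 / 2" by (simp add: power2_eq_square)
  have "real n ^ 2 * 1 \<le> real n ^ 2 * sqrt n" using s1 by (intro mult_left_mono) auto
  then have "real n ^ 2 / 2 \<le> real n powr (8 / 3)" using sq zero_le_power2[of "real n"] by linarith
  then show ?thesis using 1 2 3 by linarith
qed

lemma log_num_crings_ge:
  assumes p: "prime p" and n: "2 \<le> n"
  shows "2 / 27 * real n ^ 3 - 2 * real n powr (8 / 3) \<le> log p (num_crings (p ^ n))"
proof -
  have p1: "1 < p" by (rule prime_gt_1_nat[OF p])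
  define r where "r = n div 3"
  define d where "d = n - 1 - r"
  have rn: "r \<le> n - 1" using n unfolding r_def by linarith
  have "n \<le> 3 * r + 2" "3 * r \<le> n" unfolding r_def by presburger+
  then have "real n \<le> real (3 * r + 2)" "real (3 * r) \<le> real n" by (simp_all only: of_nat_le_iff)
  then have r: "(real n - 2) / 3 \<le> real r" "real r \<le> real n / 3" by simp_all
  have dr: "real d = real n - 1 - real r" unfolding d_def using rn n by (simp add: of_nat_diff)
  have rd: "r = n - 1 - d" and dn: "d < n" unfolding d_def using rn n by auto
  let ?e = "r * (d * (d + 1) div 2)"
  have "p ^ ?e \<le> num_crings (p ^ n) * p ^ (n * n)" using num_crings_ge[OF p dn] unfolding rd[symmetric] .
  then have "real p ^ ?e \<le> real (num_crings (p ^ n)) * real p ^ (n * n)"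
    by (metis of_nat_le_iff of_nat_mult of_nat_power)
  then have "log p (real p ^ ?e) \<le> log p (real (num_crings (p ^ n)) * real p ^ (n * n))"
    using p1 num_crings_pos[OF p, of n] by (subst log_le_cancel_iff) auto
  also have "\<dots> = log p (num_crings (p ^ n)) + real (n * n)"
    using p1 num_crings_pos[OF p, of n] by (simp add: log_mult log_nat_power)
  finally have 1: "real ?e - real n ^ 2 \<le> log p (num_crings (p ^ n))"
    using p1 by (simp add: log_nat_power power2_eq_square)
  have "real (d * (d + 1) div 2) = real d * (real d + 1) / 2"
    by (subst real_of_nat_div) (auto simp: algebra_simps)
  then have e: "real ?e = real r * (real d * (real d + 1) / 2)" by simp
  have d0: "0 \<le> 2 / 3 * real n - 1" "2 / 3 * real n - 1 \<le> real d" using n r dr by linarith+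
  have "(real n - 2) / 3 * ((2 / 3 * real n - 1) * (2 / 3 * real n - 1) / 2) \<le> real r * (real d * (real d + 1) / 2)"
    using d0 r(1) n by (intro mult_mono divide_right_mono) auto
  moreover have "2 / 27 * real n ^ 3 - real n ^ 2 \<le> (real n - 2) / 3 * ((2 / 3 * real n - 1) * (2 / 3 * real n - 1) / 2)"
  proof -
    have "(real n - 2) / 3 * ((2 / 3 * real n - 1) * (2 / 3 * real n - 1) / 2) - (2 / 27 * real n ^ 3 - real n ^ 2)
        = 17 / 27 * real n ^ 2 + 11 / 18 * real n - 1 / 3"
      by (simp add: power2_eq_square power3_eq_cube field_simps)
    moreover have "0 \<le> 17 / 27 * real n ^ 2 + 11 / 18 * real n - 1 / 3"
      using n zero_le_power2[of "real n"] by linarith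
    ultimately show ?thesis by linarith
  qed
  ultimately have 2: "2 / 27 * real n ^ 3 - real n ^ 2 \<le> real ?e" unfolding e by linarith
  have "real n ^ 2 = real n powr 2" using n by simp
  also have "\<dots> \<le> real n powr (8 / 3)" using n by (intro powr_mono) auto
  finally show ?thesis using 1 2 by linarith
qed

theorem theorem11p2:
  shows "\<exists>E :: nat \<Rightarrow> nat \<Rightarrow> real.
    (\<forall>p n. prime p \<longrightarrow>
       real (num_crings (p ^ n)) = real p powr (2 / 27 * real n ^ 3 + E p n)) \<and>
    (\<exists>C N. \<forall>p n. prime p \<longrightarrow> n \<ge> N \<longrightarrow> \<bar>E p n\<bar> \<le> C * real n powr (8 / 3))"
proof (intro exI conjI allI impI)
  let ?E = "\<lambda>p n. log (real p) (real (num_crings (p ^ n))) - 2 / 27 * real n ^ 3"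
  fix p n :: nat assume p: "prime p"
  show "real (num_crings (p ^ n)) = real p powr (2 / 27 * real n ^ 3 + ?E p n)"
    using num_crings_pos[OF p, of n] prime_gt_1_nat[OF p] by simp
next
  let ?E = "\<lambda>p n. log (real p) (real (num_crings (p ^ n))) - 2 / 27 * real n ^ 3"
  fix p n :: nat assume p: "prime p" and n: "2 \<le> n"
  have "0 \<le> real n powr (8 / 3)" by simp
  then show "\<bar>?E p n\<bar> \<le> 73 * real n powr (8 / 3)"
    using log_num_crings_le[OF p, of n] log_num_crings_ge[OF p n] n unfolding abs_le_iff by linarith
qed

end
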